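(* Let $G$ be a finite group and $M$, $N$ be $G$-lattices. Let $(E): 0\to C\xrightarrow{\iota}N\xrightarrow{\pi}M\to 0$ be an exact sequence of $G$-lattices with $C$ coflabby. For a prime number $p$, let $G_p$ be a $p$-Sylow subgroup of $G$ and $M|_{G_p}$ the $G_p$-lattice obtained from $M$ by restricting the action to $G_p$. Then: (1) $\mathrm{ord}(E)$ divides $|G|$. (2) $\mathrm{ord}(E)$ divides $\mathrm{p}\text{-}\mathrm{ord}(M)$. (3) $\mathrm{p}\text{-}\mathrm{ord}(M)=\mathrm{ord}(E)$ if $N$ is permutation, i.e. if $(E)$ is a coflabby resolution of $M$. In particular, if $a\,\mathrm{Id}_M:M\to M$ factors through a permutation $G$-lattice as a $\mathbb{Z}[G]$-homomorphism, i.e. there is a permutation $G$-lattice $P$ with $a\,\mathrm{Id}_M:M\xrightarrow{f}P\xrightarrow{g}M$, $g\circ f=a\,\mathrm{Id}_M$, then $\mathrm{p}\text{-}\mathrm{ord}(M)$ divides $a$. (4) $\mathrm{p}\text{-}\mathrm{ord}(M)$ divides $|G|$. (5) $\mathrm{p}\text{-}\mathrm{ord}(M)=\prod_{p\mid |G|}\mathrm{p}\text{-}\mathrm{ord}(M|_{G_p})$ (product over prime divisors $p$ of $|G|$), where $\mathrm{p}\text{-}\mathrm{ord}(M|_{G_p})$ divides $|G_p|$. (6) The following conditions are equivalent: (i) $\mathrm{p}\text{-}\mathrm{ord}(M)=1$; (ii) $\mathrm{p}\text{-}\mathrm{ord}(M|_{G_p})=1$ for any prime number $p$; (iii) $\mathrm{p}\text{-}\mathrm{ord}(M|_{G_p})=1$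 for any prime divisor $p\mid |G|$; (iv) $(E)$ with $N$ permutation (i.e. $(E)$ taken to be a coflabby resolution of $M$) splits; (v) $M$ is invertible. In particular, $M$ is invertible if and only if $M|_{G_p}$ is invertible for any prime number $p$, if and only if $M|_{G_p}$ is invertible for any prime divisor $p\mid |G|$.
   Context: For a finite group $G$, a $G$-lattice is a finitely generated free $\mathbb{Z}$-module with a $G$-action. A $G$-lattice is permutation if it has a $\mathbb{Z}$-basis permuted by $G$; invertible if it is a direct summand of a permutation $G$-lattice; coflabby if $H^1(H,C)=0$ for every subgroup $H\le G$. A coflabby resolution of $M$ is an exact sequence $0\to C\to P\to M\to 0$ of $G$-lattices with $P$ permutation and $C$ coflabby. For an exact sequence of $G$-lattices $(E):0\to A\to B\to C\to 0$, $\mathrm{ord}(E)$ is the order of the class of $(E)$ in the group $\mathrm{Ext}^1_{\mathbb{Z}[G]}(C,A)\simeq H^1(G,\mathrm{Hom}_{\mathbb{Z}}(C,A))$. The permutation order $\mathrm{p}\text{-}\mathrm{ord}(M)$ of a $G$-lattice $M$ is the smallest integer $a\ge 1$ such that $a\,\mathrm{Id}_M:M\to M$ factors through a permutation $G$-lattice as a $\mathbb{Z}[G]$-homomorphism, i.e. there are a permutation $G$-lattice $P$ and $\mathbb{Z}[G]$-homomorphisms $f:M\to P$, $g:P\to M$ with $g\circ f=a\,\mathrm{Id}_M$. (Here the "p" in "p-ord" stands for "permutation", not for a prime.) *)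

theory Defs
  imports "HOL-Algebra.Algebra" "HOL-Library.Countable_Set"
begin

text \<open>
  Throughout, \<open>G\<close> is a group and the \<open>\<int>\<close>-modules are the commutative groups of
  HOL-Algebra, hence written multiplicatively: \<open>x \<otimes> y\<close> is the sum, \<open>\<one>\<close> is zero, and
  \<open>x [^] a\<close> with \<open>a :: int\<close> is the scalar multiple \<open>a x\<close>.
  The restriction of a \<open>G\<close>-module to a subgroup \<open>H\<close> has the same \<open>M\<close> and \<open>\<rho>\<close>, taken over
  \<open>G\<lparr>carrier := H\<rparr>\<close>.
\<close>

section \<open>Lattices with a group action\<close>

definition G_module :: "'g monoid \<Rightarrow> 'm monoid \<Rightarrow> ('g \<Rightarrow> 'm \<Rightarrow> 'm) \<Rightarrow> bool" where
  "G_module G M \<rho> \<longleftrightarrow> comm_group M \<and> group_hom G (AutoGroup M) \<rho>"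

definition Z_basis :: "'m monoid \<Rightarrow> 'm set \<Rightarrow> bool" where
  "Z_basis M B \<longleftrightarrow> finite B \<and> B \<subseteq> carrier M \<and>
     bij_betw (\<lambda>a. \<Otimes>\<^bsub>M\<^esub>b\<in>B. b [^]\<^bsub>M\<^esub> a b) (B \<rightarrow>\<^sub>E (UNIV :: int set)) (carrier M)"

definition G_lattice :: "'g monoid \<Rightarrow> 'm monoid \<Rightarrow> ('g \<Rightarrow> 'm \<Rightarrow> 'm) \<Rightarrow> bool" where
  "G_lattice G M \<rho> \<longleftrightarrow> G_module G M \<rho> \<and> (\<exists>B. Z_basis M B)"

definition permutation_lattice :: "'g monoid \<Rightarrow> 'm monoid \<Rightarrow> ('g \<Rightarrow> 'm \<Rightarrow> 'm) \<Rightarrow> bool" where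
  "permutation_lattice G M \<rho> \<longleftrightarrow>
     G_module G M \<rho> \<and> (\<exists>B. Z_basis M B \<and> (\<forall>g\<in>carrier G. \<rho> g ` B = B))"

definition G_hom ::
  "'g monoid \<Rightarrow> 'm monoid \<Rightarrow> ('g \<Rightarrow> 'm \<Rightarrow> 'm) \<Rightarrow> 'n monoid \<Rightarrow> ('g \<Rightarrow> 'n \<Rightarrow> 'n) \<Rightarrow> ('m \<Rightarrow> 'n) set" where
  "G_hom G M \<rho> N \<sigma> = {f \<in> hom M N. \<forall>g\<in>carrier G. \<forall>x\<in>carrier M. f (\<rho> g x) = \<sigma> g (f x)}"

definition G_iso ::
  "'g monoid \<Rightarrow> 'm monoid \<Rightarrow> ('g \<Rightarrow> 'm \<Rightarrow> 'm) \<Rightarrow> 'n monoid \<Rightarrow> ('g \<Rightarrow> 'n \<Rightarrow> 'n) \<Rightarrow> ('m \<Rightarrow> 'n) set" where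
  "G_iso G M \<rho> N \<sigma> = {f \<in> G_hom G M \<rho> N \<sigma>. bij_betw f (carrier M) (carrier N)}"

definition sum_action ::
  "'m monoid \<Rightarrow> ('g \<Rightarrow> 'm \<Rightarrow> 'm) \<Rightarrow> 'n monoid \<Rightarrow> ('g \<Rightarrow> 'n \<Rightarrow> 'n) \<Rightarrow> 'g \<Rightarrow> 'm \<times> 'n \<Rightarrow> 'm \<times> 'n" where
  "sum_action M \<rho> N \<sigma> g = (\<lambda>z\<in>carrier (M \<times>\<times> N). (\<rho> g (fst z), \<sigma> g (snd z)))"

definition transport_monoid :: "('a \<Rightarrow> 'b) \<Rightarrow> 'a monoid \<Rightarrow> 'b monoid" where
  "transport_monoid f L =
     \<lparr>carrier = f ` carrier L,
      monoid.mult = (\<lambda>x y. f (inv_into (carrier L) f x \<otimes>\<^bsub>L\<^esub> inv_into (carrier L) f y)),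
      one = f \<one>\<^bsub>L\<^esub>\<rparr>"

definition transport_action ::
  "('a \<Rightarrow> 'b) \<Rightarrow> 'a monoid \<Rightarrow> ('g \<Rightarrow> 'a \<Rightarrow> 'a) \<Rightarrow> 'g \<Rightarrow> 'b \<Rightarrow> 'b" where
  "transport_action f L \<rho> g = (\<lambda>x\<in>f ` carrier L. f (\<rho> g (inv_into (carrier L) f x)))"

lemma transport_monoid_carrier: "carrier (transport_monoid f L) = f ` carrier L"
  by (simp add: transport_monoid_def)

lemma transport_iso:
  assumes "inj_on f (carrier L)" "comm_group L"
  shows "f \<in> iso L (transport_monoid f L)" "comm_group (transport_monoid f L)"
proof -
  interpret L: comm_group L by fact
  show iso: "f \<in> iso L (transport_monoid f L)"
    using assms(1) by (auto simp: iso_def hom_def transport_monoid_def bij_betw_def)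
  have "monoid (transport_monoid f L)"
    by (rule monoidI) (auto simp: transport_monoid_def assms(1) L.m_assoc)
  then show "comm_group (transport_monoid f L)"
    using iso L.iso_imp_comm_group is_isoI by blast
qed

lemma transport_Z_basis:
  assumes inj: "inj_on f (carrier L)" and L: "comm_group L" and B: "Z_basis L B"
  shows "Z_basis (transport_monoid f L) (f ` B)"
proof -
  let ?L = "transport_monoid f L"
  interpret L: comm_group L by fact
  interpret L': comm_group ?L by (rule transport_iso[OF inj L])
  have iso: "f \<in> iso L ?L" by (rule transport_iso[OF inj L])
  then have hom: "f \<in> hom L ?L" and bij: "bij_betw f (carrier L) (carrier ?L)"
    by (auto simp: iso_def)
  interpret f: group_hom L ?L f by unfold_locales (rule hom)
  have fin: "finite B" and sub: "B \<subseteq> carrier L"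
    and bb: "bij_betw (\<lambda>a. \<Otimes>\<^bsub>L\<^esub>b\<in>B. b [^]\<^bsub>L\<^esub> a b) (B \<rightarrow>\<^sub>E (UNIV :: int set)) (carrier L)"
    using B by (auto simp: Z_basis_def)
  have injB: "inj_on f B" using inj sub inj_on_subset by blast
  let ?r = "\<lambda>a. \<lambda>b\<in>B. a (f b) :: int"
  have r: "bij_betw ?r (f ` B \<rightarrow>\<^sub>E UNIV) (B \<rightarrow>\<^sub>E UNIV)"
  proof (rule bij_betw_byWitness[where f' = "\<lambda>a. \<lambda>x\<in>f ` B. a (inv_into B f x)"])
    show "\<forall>a\<in>f ` B \<rightarrow>\<^sub>E UNIV. (\<lambda>x\<in>f ` B. ?r a (inv_into B f x)) = a"
      using injB by (auto simp: fun_eq_iff PiE_def extensional_def inv_into_into)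
    show "\<forall>a\<in>B \<rightarrow>\<^sub>E UNIV. ?r (\<lambda>x\<in>f ` B. a (inv_into B f x)) = a"
      using injB by (auto simp: fun_eq_iff PiE_def extensional_def)
  qed auto
  have eq: "(\<Otimes>\<^bsub>?L\<^esub>b\<in>f ` B. b [^]\<^bsub>?L\<^esub> a b) = f (\<Otimes>\<^bsub>L\<^esub>b\<in>B. b [^]\<^bsub>L\<^esub> ?r a b)" for a :: "_ \<Rightarrow> int"
  proof -
    have "(\<Otimes>\<^bsub>?L\<^esub>b\<in>f ` B. b [^]\<^bsub>?L\<^esub> a b) = (\<Otimes>\<^bsub>?L\<^esub>b\<in>B. f b [^]\<^bsub>?L\<^esub> a (f b))"
      using injB sub by (subst L'.finprod_reindex) (auto simp: Pi_def)
    also have "\<dots> = (\<Otimes>\<^bsub>?L\<^esub>b\<in>B. f (b [^]\<^bsub>L\<^esub> ?r a b))"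
      using sub by (intro L'.finprod_cong') (auto simp: f.hom_int_pow[symmetric])
    also have "\<dots> = f (\<Otimes>\<^bsub>L\<^esub>b\<in>B. b [^]\<^bsub>L\<^esub> ?r a b)"
    proof -
      have "f (finprod L u A) = (\<Otimes>\<^bsub>?L\<^esub>b\<in>A. f (u b))" if "finite A" "u \<in> A \<rightarrow> carrier L" for u A
        using that
      proof (induction A rule: finite_induct)
        case (insert x A)
        moreover have "(\<lambda>b. f (u b)) \<in> A \<rightarrow> carrier ?L" "f (u x) \<in> carrier ?L"
          using insert by (auto simp: Pi_iff intro!: f.hom_closed)
        ultimately show ?case by auto
      qed simp
      from this[OF fin, of "\<lambda>b. b [^]\<^bsub>L\<^esub> ?r a b"] show ?thesis
        using sub by (simp add: Pi_iff subset_iff)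
    qed
    finally show ?thesis .
  qed
  have "bij_betw (f \<circ> ((\<lambda>a. \<Otimes>\<^bsub>L\<^esub>b\<in>B. b [^]\<^bsub>L\<^esub> a b) \<circ> ?r)) (f ` B \<rightarrow>\<^sub>E UNIV) (carrier ?L)"
    by (rule bij_betw_trans[OF bij_betw_trans[OF r bb] bij])
  then show ?thesis
    using fin image_mono[OF sub, of f] by (simp add: Z_basis_def eq o_def transport_monoid_carrier)
qed

lemma transport_G_module:
  assumes inj: "inj_on f (carrier L)" and L: "G_module G L \<rho>"
  shows "G_module G (transport_monoid f L) (transport_action f L \<rho>)"
    and "f \<in> G_iso G L \<rho> (transport_monoid f L) (transport_action f L \<rho>)"
proof -
  let ?L = "transport_monoid f L" and ?\<rho> = "transport_action f L \<rho>"
  have comm: "comm_group L" and "group_hom G (AutoGroup L) \<rho>"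
    using L by (auto simp: G_module_def)
  then interpret act: group_hom G "AutoGroup L" \<rho> by simp
  interpret L: comm_group L by fact
  interpret L': comm_group ?L by (rule transport_iso[OF inj comm])
  have iso: "f \<in> iso L ?L" by (rule transport_iso[OF inj comm])
  have c: "carrier ?L = f ` carrier L" by (simp add: transport_monoid_def)
  have auto: "\<rho> g \<in> hom L L" "bij_betw (\<rho> g) (carrier L) (carrier L)" if "g \<in> carrier G" for g
    using act.hom_closed[OF that] by (auto simp: AutoGroup_def auto_def Bij_def)
  have clos: "\<rho> g x \<in> carrier L" if "g \<in> carrier G" "x \<in> carrier L" for g x
    using auto(1)[OF that(1)] that(2) by (auto simp: hom_def)
  have \<rho>f: "?\<rho> g (f x) = f (\<rho> g x)" if "x \<in> carrier L" for g x
    using that inj by (simp add: transport_action_def)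
  have auto': "?\<rho> g \<in> auto ?L" if g: "g \<in> carrier G" for g
  proof -
    have 1: "bij_betw (?\<rho> g) (carrier ?L) (carrier ?L)"
    proof -
      have fb: "bij_betw f (carrier L) (carrier ?L)" using iso by (simp add: iso_def)
      have "bij_betw (f \<circ> (\<rho> g \<circ> inv_into (carrier L) f)) (carrier ?L) (carrier ?L)"
        by (rule bij_betw_trans[OF bij_betw_trans[OF bij_betw_inv_into[OF fb] auto(2)[OF g]] fb])
      then show ?thesis
        by (rule bij_betw_cong[THEN iffD1, rotated]) (simp add: transport_action_def c)
    qed
    have 2: "?\<rho> g \<in> hom ?L ?L"
    proof (rule homI)
      fix x y assume "x \<in> carrier ?L" "y \<in> carrier ?L"
      then obtain u v where uv: "x = f u" "y = f v" "u \<in> carrier L" "v \<in> carrier L"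
        by (auto simp: c)
      have m: "f p \<otimes>\<^bsub>?L\<^esub> f q = f (p \<otimes>\<^bsub>L\<^esub> q)" if "p \<in> carrier L" "q \<in> carrier L" for p q
        using that inj by (simp add: transport_monoid_def)
      show "?\<rho> g (x \<otimes>\<^bsub>?L\<^esub> y) = ?\<rho> g x \<otimes>\<^bsub>?L\<^esub> ?\<rho> g y"
        using uv g auto(1)[OF g] by (simp add: m \<rho>f clos hom_def)
    qed (use g clos in \<open>auto simp: c \<rho>f\<close>)
    show ?thesis
      using 1 2 by (auto simp: auto_def Bij_def transport_action_def c)
  qed
  have mult: "?\<rho> (g \<otimes>\<^bsub>G\<^esub> h) = ?\<rho> g \<otimes>\<^bsub>AutoGroup ?L\<^esub> ?\<rho> h"
    if g: "g \<in> carrier G" and h: "h \<in> carrier G" for g h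
  proof -
    have "\<rho> (g \<otimes>\<^bsub>G\<^esub> h) x = \<rho> g (\<rho> h x)" if "x \<in> carrier L" for x
      using act.hom_mult[OF g h] act.hom_closed[OF g] act.hom_closed[OF h] that
      by (auto simp: AutoGroup_def BijGroup_def auto_def compose_def)
    then show ?thesis
      using auto'[OF g] auto'[OF h] g h clos
      by (auto simp: AutoGroup_def BijGroup_def auto_def compose_def fun_eq_iff c \<rho>f)
        (auto simp: transport_action_def)
  qed
  show "G_module G ?L ?\<rho>"
    unfolding G_module_def
  proof (intro conjI)
    show "group_hom G (AutoGroup ?L) ?\<rho>"
    proof (intro group_hom.intro group_hom_axioms.intro homI)
      show "group G" by (rule act.G.is_group)
      show "group (AutoGroup ?L)" by (rule L'.AutoGroup)
    qed (use auto' mult in \<open>auto simp: AutoGroup_def\<close>)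
  qed (rule L'.comm_group_axioms)
  show "f \<in> G_iso G L \<rho> ?L ?\<rho>"
    using iso by (auto simp: G_iso_def G_hom_def iso_def \<rho>f)
qed

lemma G_lattice_countable:
  assumes "G_lattice G L \<rho>" shows "countable (carrier L)"
proof -
  obtain B where B: "finite B" and
    "bij_betw (\<lambda>a. \<Otimes>\<^bsub>L\<^esub>b\<in>B. b [^]\<^bsub>L\<^esub> a b) (B \<rightarrow>\<^sub>E (UNIV :: int set)) (carrier L)"
    using assms by (auto simp: G_lattice_def Z_basis_def)
  then have "carrier L = (\<lambda>a. \<Otimes>\<^bsub>L\<^esub>b\<in>B. b [^]\<^bsub>L\<^esub> a b) ` (B \<rightarrow>\<^sub>E (UNIV :: int set))"
    by (simp add: bij_betw_def)
  moreover have "countable (B \<rightarrow>\<^sub>E (UNIV :: int set))"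
    using B by (induction B rule: finite_induct) (simp_all add: PiE_insert_eq)
  ultimately show ?thesis by simp
qed

lemma permutation_lattice_imp_G_lattice: "permutation_lattice G L \<rho> \<Longrightarrow> G_lattice G L \<rho>"
  by (auto simp: permutation_lattice_def G_lattice_def)

lemma G_lattice_nat_copy:
  assumes L: "G_lattice G L \<rho>"
  obtains L' :: "nat monoid" and \<rho>' f where "G_lattice G L' \<rho>'" "f \<in> G_iso G L \<rho> L' \<rho>'"
    "permutation_lattice G L \<rho> \<Longrightarrow> permutation_lattice G L' \<rho>'"
proof -
  obtain f :: "_ \<Rightarrow> nat" where inj: "inj_on f (carrier L)"
    using G_lattice_countable[OF L] by (auto simp: countable_def)
  let ?L = "transport_monoid f L" and ?\<rho> = "transport_action f L \<rho>"
  have mod: "G_module G L \<rho>" and comm: "comm_group L"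
    using L by (auto simp: G_lattice_def G_module_def)
  note tr = transport_G_module[OF inj mod]
  have "G_lattice G ?L ?\<rho>"
    using L tr(1) transport_Z_basis[OF inj comm] by (auto simp: G_lattice_def)
  moreover have "permutation_lattice G ?L ?\<rho>" if perm: "permutation_lattice G L \<rho>"
  proof -
    obtain B where B: "Z_basis L B" "\<forall>g\<in>carrier G. \<rho> g ` B = B"
      using perm unfolding permutation_lattice_def by blast
    have "?\<rho> g ` f ` B = f ` \<rho> g ` B" for g
      unfolding image_image
    proof (rule image_cong)
      fix b assume "b \<in> B"
      then have "b \<in> carrier L" using B(1) by (auto simp: Z_basis_def)
      then show "?\<rho> g (f b) = f (\<rho> g b)" using inj by (simp add: transport_action_def)
    qed simp
    then have "\<forall>g\<in>carrier G. ?\<rho> g ` f ` B = f ` B" using B(2) by simp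
    then show ?thesis
      unfolding permutation_lattice_def using tr(1) transport_Z_basis[OF inj comm B(1)] by blast
  qed
  ultimately show ?thesis using that tr(2) by blast
qed

lemma G_hom_compose:
  "f \<in> G_hom G A \<alpha> B \<beta> \<Longrightarrow> h \<in> G_hom G B \<beta> C \<gamma> \<Longrightarrow> h \<circ> f \<in> G_hom G A \<alpha> C \<gamma>"
  by (auto simp: G_hom_def hom_def Pi_def)

lemma G_iso_compose:
  assumes "f \<in> G_iso G A \<alpha> B \<beta>" "h \<in> G_iso G B \<beta> C \<gamma>"
  shows "h \<circ> f \<in> G_iso G A \<alpha> C \<gamma>"
  using assms by (auto simp: G_iso_def intro: G_hom_compose bij_betw_trans)

lemma G_iso_inv:
  assumes f: "f \<in> G_iso G A \<alpha> B \<beta>" and A: "G_module G A \<alpha>"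
  shows "inv_into (carrier A) f \<in> G_iso G B \<beta> A \<alpha>"
proof -
  have iso: "f \<in> iso A B" and bij: "bij_betw f (carrier A) (carrier B)"
    and eq: "\<And>g x. g \<in> carrier G \<Longrightarrow> x \<in> carrier A \<Longrightarrow> f (\<alpha> g x) = \<beta> g (f x)"
    using f by (auto simp: G_iso_def G_hom_def iso_def)
  interpret A: comm_group A using A by (simp add: G_module_def)
  interpret act: group_hom G "AutoGroup A" \<alpha> using A by (simp add: G_module_def)
  have clos: "\<alpha> g x \<in> carrier A" if "g \<in> carrier G" "x \<in> carrier A" for g x
    using act.hom_closed[OF that(1)] that(2) by (auto simp: AutoGroup_def auto_def hom_def)
  have inv: "inv_into (carrier A) f \<in> iso B A"
    by (rule A.iso_set_sym[OF iso])
  have "inv_into (carrier A) f (\<beta> g y) = \<alpha> g (inv_into (carrier A) f y)"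
    if g: "g \<in> carrier G" and y: "y \<in> carrier B" for g y
  proof -
    obtain x where x: "x \<in> carrier A" "y = f x" using bij y by (auto simp: bij_betw_def)
    show ?thesis
      using x g bij eq[OF g x(1), symmetric] clos[OF g x(1)] by (simp add: bij_betw_def)
  qed
  then show ?thesis
    using inv bij_betw_inv_into[OF bij] by (auto simp: G_iso_def G_hom_def iso_def)
qed

text \<open>
  HOL cannot quantify over types inside a formula, so the lattices bound existentially below have
  carriers in \<open>nat\<close>. This is no restriction: lattices are countable, see
  \<open>G_lattice_nat_copy\<close>, \<open>factors_through_permutationI\<close> and \<open>invertible_latticeI\<close>.
\<close>

definition invertible_lattice :: "'g monoid \<Rightarrow> 'm monoid \<Rightarrow> ('g \<Rightarrow> 'm \<Rightarrow> 'm) \<Rightarrow> bool" where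
  "invertible_lattice G M \<rho> \<longleftrightarrow>
     G_lattice G M \<rho> \<and>
     (\<exists>(P :: nat monoid) \<tau> (Q :: nat monoid) \<sigma> f.
        permutation_lattice G P \<tau> \<and> G_lattice G Q \<sigma> \<and>
        f \<in> G_iso G (M \<times>\<times> Q) (sum_action M \<rho> Q \<sigma>) P \<tau>)"

definition factors_through_permutation ::
  "'g monoid \<Rightarrow> 'm monoid \<Rightarrow> ('g \<Rightarrow> 'm \<Rightarrow> 'm) \<Rightarrow> int \<Rightarrow> bool" where
  "factors_through_permutation G M \<rho> a \<longleftrightarrow>
     (\<exists>(P :: nat monoid) \<tau>. permutation_lattice G P \<tau> \<and>
        (\<exists>f \<in> G_hom G M \<rho> P \<tau>. \<exists>h \<in> G_hom G P \<tau> M \<rho>.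
           \<forall>x\<in>carrier M. h (f x) = x [^]\<^bsub>M\<^esub> a))"

definition p_ord :: "'g monoid \<Rightarrow> 'm monoid \<Rightarrow> ('g \<Rightarrow> 'm \<Rightarrow> 'm) \<Rightarrow> nat" where
  "p_ord G M \<rho> = (LEAST a. 1 \<le> a \<and> factors_through_permutation G M \<rho> (int a))"

lemma factors_through_permutationI:
  assumes P: "permutation_lattice G P \<tau>"
    and f: "f \<in> G_hom G M \<rho> P \<tau>" and h: "h \<in> G_hom G P \<tau> M \<rho>"
    and hf: "\<forall>x\<in>carrier M. h (f x) = x [^]\<^bsub>M\<^esub> a"
  shows "factors_through_permutation G M \<rho> a"
proof -
  obtain P' :: "nat monoid" and \<tau>' k where P': "permutation_lattice G P' \<tau>'"
    and k: "k \<in> G_iso G P \<tau> P' \<tau>'"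
    using G_lattice_nat_copy[OF permutation_lattice_imp_G_lattice[OF P]] P by metis
  have "G_module G P \<tau>" using P by (simp add: permutation_lattice_def)
  note k' = G_iso_inv[OF k this]
  have 1: "k \<circ> f \<in> G_hom G M \<rho> P' \<tau>'"
    using G_hom_compose[OF f] k by (auto simp: G_iso_def)
  have 2: "h \<circ> inv_into (carrier P) k \<in> G_hom G P' \<tau>' M \<rho>"
    using G_hom_compose[OF _ h] k' by (auto simp: G_iso_def)
  have 3: "(h \<circ> inv_into (carrier P) k) ((k \<circ> f) x) = x [^]\<^bsub>M\<^esub> a" if x: "x \<in> carrier M" for x
  proof -
    have "f x \<in> carrier P" using f x by (auto simp: G_hom_def hom_def)
    then show ?thesis using k hf x by (simp add: G_iso_def bij_betw_def)
  qed
  show ?thesis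
    unfolding factors_through_permutation_def using P' 1 2 3 by blast
qed

lemma invertible_latticeI:
  assumes M: "G_lattice G M \<rho>" and P: "permutation_lattice G P \<tau>" and Q: "G_lattice G Q \<sigma>"
    and f: "f \<in> G_iso G (M \<times>\<times> Q) (sum_action M \<rho> Q \<sigma>) P \<tau>"
  shows "invertible_lattice G M \<rho>"
proof -
  obtain P' :: "nat monoid" and \<tau>' k where P': "permutation_lattice G P' \<tau>'"
    and k: "k \<in> G_iso G P \<tau> P' \<tau>'"
    using G_lattice_nat_copy[OF permutation_lattice_imp_G_lattice[OF P]] P by metis
  obtain Q' :: "nat monoid" and \<sigma>' l where Q': "G_lattice G Q' \<sigma>'"
    and l: "l \<in> G_iso G Q \<sigma> Q' \<sigma>'"
    using G_lattice_nat_copy[OF Q] by metis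
  have "G_module G Q \<sigma>" using Q by (simp add: G_lattice_def)
  note l' = G_iso_inv[OF l this]
  have "G_module G Q' \<sigma>'" using Q' by (simp add: G_lattice_def)
  then interpret q: group_hom G "AutoGroup Q'" \<sigma>' by (simp add: G_module_def)
  have "G_module G M \<rho>" using M by (simp add: G_lattice_def)
  then interpret m: group_hom G "AutoGroup M" \<rho> by (simp add: G_module_def)
  have clos: "\<sigma>' g y \<in> carrier Q'" if "g \<in> carrier G" "y \<in> carrier Q'" for g y
    using q.hom_closed[OF that(1)] that(2) by (auto simp: AutoGroup_def auto_def hom_def)
  have clos': "\<rho> g y \<in> carrier M" if "g \<in> carrier G" "y \<in> carrier M" for g y
    using m.hom_closed[OF that(1)] that(2) by (auto simp: AutoGroup_def auto_def hom_def)
  let ?j = "map_prod id (inv_into (carrier Q) l)"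
  have "?j \<in> G_iso G (M \<times>\<times> Q') (sum_action M \<rho> Q' \<sigma>') (M \<times>\<times> Q) (sum_action M \<rho> Q \<sigma>)"
  proof -
    have "bij_betw ?j (carrier M \<times> carrier Q') (carrier M \<times> carrier Q)"
      by (rule bij_betw_map_prod) (use l' in \<open>auto simp: G_iso_def\<close>)
    then show ?thesis
      using l' clos clos' by (auto simp: G_iso_def G_hom_def hom_def sum_action_def Pi_def)
  qed
  then have "k \<circ> (f \<circ> ?j) \<in> G_iso G (M \<times>\<times> Q') (sum_action M \<rho> Q' \<sigma>') P' \<tau>'"
    using G_iso_compose[OF G_iso_compose[OF _ f] k] by blast
  then show ?thesis
    unfolding invertible_lattice_def using M P' Q' by blast
qed

section \<open>First cohomology\<close>

definition cocycles1 :: "'g monoid \<Rightarrow> 'm monoid \<Rightarrow> ('g \<Rightarrow> 'm \<Rightarrow> 'm) \<Rightarrow> ('g \<Rightarrow> 'm) monoid" where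
  "cocycles1 G M \<rho> =
     \<lparr>carrier = {c \<in> carrier G \<rightarrow>\<^sub>E carrier M.
                  \<forall>g\<in>carrier G. \<forall>h\<in>carrier G. c (g \<otimes>\<^bsub>G\<^esub> h) = c g \<otimes>\<^bsub>M\<^esub> \<rho> g (c h)},
      monoid.mult = (\<lambda>c d. \<lambda>g\<in>carrier G. c g \<otimes>\<^bsub>M\<^esub> d g),
      one = (\<lambda>g\<in>carrier G. \<one>\<^bsub>M\<^esub>)\<rparr>"

definition coboundaries1 :: "'g monoid \<Rightarrow> 'm monoid \<Rightarrow> ('g \<Rightarrow> 'm \<Rightarrow> 'm) \<Rightarrow> ('g \<Rightarrow> 'm) set" where
  "coboundaries1 G M \<rho> = (\<lambda>m. \<lambda>g\<in>carrier G. \<rho> g m \<otimes>\<^bsub>M\<^esub> inv\<^bsub>M\<^esub> m) ` carrier M"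

definition H1 :: "'g monoid \<Rightarrow> 'm monoid \<Rightarrow> ('g \<Rightarrow> 'm \<Rightarrow> 'm) \<Rightarrow> ('g \<Rightarrow> 'm) set monoid" where
  "H1 G M \<rho> = cocycles1 G M \<rho> Mod coboundaries1 G M \<rho>"

definition coflabby :: "'g monoid \<Rightarrow> 'm monoid \<Rightarrow> ('g \<Rightarrow> 'm \<Rightarrow> 'm) \<Rightarrow> bool" where
  "coflabby G M \<rho> \<longleftrightarrow>
     G_lattice G M \<rho> \<and> (\<forall>H. subgroup H G \<longrightarrow> trivial_group (H1 (G\<lparr>carrier := H\<rparr>) M \<rho>))"

section \<open>Extensions\<close>

definition exact_seq_G_lattices ::
  "'g monoid \<Rightarrow> 'a monoid \<Rightarrow> ('g \<Rightarrow> 'a \<Rightarrow> 'a) \<Rightarrow> 'b monoid \<Rightarrow> ('g \<Rightarrow> 'b \<Rightarrow> 'b)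
     \<Rightarrow> 'c monoid \<Rightarrow> ('g \<Rightarrow> 'c \<Rightarrow> 'c) \<Rightarrow> ('a \<Rightarrow> 'b) \<Rightarrow> ('b \<Rightarrow> 'c) \<Rightarrow> bool" where
  "exact_seq_G_lattices G A \<alpha> B \<beta> C \<gamma> \<iota> \<pi> \<longleftrightarrow>
     G_lattice G A \<alpha> \<and> G_lattice G B \<beta> \<and> G_lattice G C \<gamma> \<and>
     \<iota> \<in> G_hom G A \<alpha> B \<beta> \<and> \<pi> \<in> G_hom G B \<beta> C \<gamma> \<and>
     inj_on \<iota> (carrier A) \<and> \<iota> ` carrier A = kernel B C \<pi> \<and> \<pi> ` carrier B = carrier C"

definition splits ::
  "'g monoid \<Rightarrow> 'b monoid \<Rightarrow> ('g \<Rightarrow> 'b \<Rightarrow> 'b) \<Rightarrow> 'c monoid \<Rightarrow> ('g \<Rightarrow> 'c \<Rightarrow> 'c) \<Rightarrow> ('b \<Rightarrow> 'c) \<Rightarrow> bool" where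
  "splits G B \<beta> C \<gamma> \<pi> \<longleftrightarrow> (\<exists>s \<in> G_hom G C \<gamma> B \<beta>. \<forall>x\<in>carrier C. \<pi> (s x) = x)"

definition Hom_Z :: "'c monoid \<Rightarrow> 'a monoid \<Rightarrow> ('c \<Rightarrow> 'a) monoid" where
  "Hom_Z C A =
     \<lparr>carrier = hom C A \<inter> extensional (carrier C),
      monoid.mult = (\<lambda>u v. \<lambda>x\<in>carrier C. u x \<otimes>\<^bsub>A\<^esub> v x),
      one = (\<lambda>x\<in>carrier C. \<one>\<^bsub>A\<^esub>)\<rparr>"

definition Hom_action ::
  "'g monoid \<Rightarrow> 'c monoid \<Rightarrow> ('g \<Rightarrow> 'c \<Rightarrow> 'c) \<Rightarrow> 'a monoid \<Rightarrow> ('g \<Rightarrow> 'a \<Rightarrow> 'a)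
     \<Rightarrow> 'g \<Rightarrow> ('c \<Rightarrow> 'a) \<Rightarrow> 'c \<Rightarrow> 'a" where
  "Hom_action G C \<gamma> A \<alpha> g = (\<lambda>u\<in>carrier (Hom_Z C A). \<lambda>x\<in>carrier C. \<alpha> g (u (\<gamma> (inv\<^bsub>G\<^esub> g) x)))"

text \<open>
  \<open>Ext\<^sup>1\<close> over \<open>\<int>[G]\<close> of two lattices is taken as \<open>H\<^sup>1(G, Hom\<^sub>\<int>(C, A))\<close>. Since \<open>C\<close> is free over \<open>\<int>\<close>,
  \<open>\<pi>\<close> has a \<open>\<int>\<close>-linear section \<open>s\<close>; the class of the extension is that of the cocycle
  \<open>g \<mapsto> \<iota>\<inverse> \<circ> (g s g\<inverse> - s)\<close>. Another section changes the cocycle by a coboundary.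
\<close>

definition ext_cocycle ::
  "'g monoid \<Rightarrow> 'a monoid \<Rightarrow> 'b monoid \<Rightarrow> ('g \<Rightarrow> 'b \<Rightarrow> 'b)
     \<Rightarrow> 'c monoid \<Rightarrow> ('g \<Rightarrow> 'c \<Rightarrow> 'c) \<Rightarrow> ('a \<Rightarrow> 'b) \<Rightarrow> ('c \<Rightarrow> 'b) \<Rightarrow> 'g \<Rightarrow> 'c \<Rightarrow> 'a" where
  "ext_cocycle G A B \<beta> C \<gamma> \<iota> s =
     (\<lambda>g\<in>carrier G. \<lambda>x\<in>carrier C.
        inv_into (carrier A) \<iota> (\<beta> g (s (\<gamma> (inv\<^bsub>G\<^esub> g) x)) \<otimes>\<^bsub>B\<^esub> inv\<^bsub>B\<^esub> (s x)))"

definition ext_class ::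
  "'g monoid \<Rightarrow> 'a monoid \<Rightarrow> ('g \<Rightarrow> 'a \<Rightarrow> 'a) \<Rightarrow> 'b monoid \<Rightarrow> ('g \<Rightarrow> 'b \<Rightarrow> 'b)
     \<Rightarrow> 'c monoid \<Rightarrow> ('g \<Rightarrow> 'c \<Rightarrow> 'c) \<Rightarrow> ('a \<Rightarrow> 'b) \<Rightarrow> ('b \<Rightarrow> 'c) \<Rightarrow> ('g \<Rightarrow> 'c \<Rightarrow> 'a) set" where
  "ext_class G A \<alpha> B \<beta> C \<gamma> \<iota> \<pi> =
     (THE K. \<exists>s \<in> hom C B. (\<forall>x\<in>carrier C. \<pi> (s x) = x) \<and>
        K = coboundaries1 G (Hom_Z C A) (Hom_action G C \<gamma> A \<alpha>)
              #>\<^bsub>cocycles1 G (Hom_Z C A) (Hom_action G C \<gamma> A \<alpha>)\<^esub> ext_cocycle G A B \<beta> C \<gamma> \<iota> s)"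

definition ext_ord ::
  "'g monoid \<Rightarrow> 'a monoid \<Rightarrow> ('g \<Rightarrow> 'a \<Rightarrow> 'a) \<Rightarrow> 'b monoid \<Rightarrow> ('g \<Rightarrow> 'b \<Rightarrow> 'b)
     \<Rightarrow> 'c monoid \<Rightarrow> ('g \<Rightarrow> 'c \<Rightarrow> 'c) \<Rightarrow> ('a \<Rightarrow> 'b) \<Rightarrow> ('b \<Rightarrow> 'c) \<Rightarrow> nat" where
  "ext_ord G A \<alpha> B \<beta> C \<gamma> \<iota> \<pi> =
     group.ord (H1 G (Hom_Z C A) (Hom_action G C \<gamma> A \<alpha>)) (ext_class G A \<alpha> B \<beta> C \<gamma> \<iota> \<pi>)"

definition sylow_subgroup :: "'g monoid \<Rightarrow> nat \<Rightarrow> 'g set \<Rightarrow> bool" where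
  "sylow_subgroup G p H \<longleftrightarrow> subgroup H G \<and> card H = p ^ multiplicity p (order G)"

end

theory Submission
  imports Defs
begin

text \<open>
  Unfold a factorization of \<open>a Id\<close> on \<open>M\<close> through a permutation lattice in terms of a permuted
  basis \<open>S\<close>: it is a finite \<open>G\<close>-set \<open>S\<close> with equivariant families of functionals \<open>l\<^sub>x : M \<rightarrow> \<int>\<close> and
  vectors \<open>v\<^sub>x\<close> of \<open>M\<close> such that \<open>\<Sum>\<^sub>x l\<^sub>x(m) v\<^sub>x = a m\<close>. This is called a permutation frame
  (\<open>permutation_frame_of_factorization\<close> and \<open>permutation_frame.factors\<close> are the two directions), and
  it makes three constructions easy. Disjoint unions and rescaling show that the integers \<open>a\<close> for which
  \<open>a Id\<close> factors form an ideal, generated by the permutation order (\<open>p_ord_dvd_iff\<close>). Inducing a frame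
  from a subgroup \<open>H\<close> multiplies \<open>a\<close> by \<open>[G : H]\<close> (\<open>factors_transfer\<close>); over the trivial group every
  lattice has a frame with \<open>a = 1\<close>, so the permutation order divides \<open>|G|\<close>. Restriction and transfer for
  Sylow subgroups determine every \<open>p\<close>-adic valuation, whence the product formula.

  On the side of extensions, a cocycle computation shows that \<open>n\<close> kills the class of \<open>(E)\<close> iff \<open>n Id\<close> on
  \<open>M\<close> lifts along \<open>\<pi>\<close> to a \<open>G\<close>-homomorphism \<open>M \<rightarrow> N\<close> (\<open>ext_ord_dvd_iff\<close>). Everything about \<open>ord(E)\<close>
  is read off from this criterion. The norm of a \<open>\<int>\<close>-linear section lifts \<open>|G| Id\<close>. If \<open>a Id\<close> has a frame,
  then \<open>H\<^sup>1(H, C) = 0\<close> lets a vector of \<open>M\<close> fixed by a stabilizer \<open>H\<close> be lifted to a vector of \<open>N\<close> fixed by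
  \<open>H\<close>, hence the family \<open>v\<close> to an equivariant family \<open>w\<close> in \<open>N\<close>, and \<open>m \<mapsto> \<Sum>\<^sub>x l\<^sub>x(m) w\<^sub>x\<close> lifts \<open>a Id\<close>;
  so \<open>ord(E)\<close> divides the permutation order. Conversely a lift to a permutation lattice \<open>N\<close> is a
  factorization through it. For \<open>n = 1\<close> the criterion says that \<open>(E)\<close> splits.

  Finally, if \<open>Id = h \<circ> f\<close> factors through \<open>P\<close>, then \<open>P\<close> is the direct sum of \<open>M\<close> and the kernel of \<open>h\<close>,
  which is a lattice because subgroups of lattices have bases (\<open>subgroup_has_basis\<close>). So permutation
  order \<open>1\<close> means invertible, and the statements about invertibility follow from those about the order.
\<close>

section \<open>Homomorphisms and finite products\<close>

lemma hom_finprod: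
  assumes M: "comm_group M" and N: "comm_group N" and f: "f \<in> hom M N" and u: "u \<in> A \<rightarrow> carrier M"
  shows "f (finprod M u A) = finprod N (\<lambda>i. f (u i)) A"
proof -
  interpret M: comm_group M by fact
  interpret N: comm_group N by fact
  interpret f: group_hom M N f by unfold_locales (rule f)
  show ?thesis
    using u
  proof (induction A rule: infinite_finite_induct)
    case (insert x A)
    then have "(\<lambda>i. f (u i)) \<in> A \<rightarrow> carrier N" "u \<in> A \<rightarrow> carrier M" "u x \<in> carrier M"
      by (auto simp: Pi_iff)
    then show ?case using insert by simp
  qed simp_all
qed

lemma (in comm_group) int_pow_hom: "(\<lambda>x. x [^] (k :: int)) \<in> hom G G"
  by (auto simp: hom_def int_pow_distrib)

lemma (in comm_group) finprod_int_pow: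
  assumes "u \<in> A \<rightarrow> carrier G"
  shows "finprod G u A [^] (k :: int) = (\<Otimes>i\<in>A. u i [^] k)"
  by (rule hom_finprod[OF comm_group_axioms comm_group_axioms int_pow_hom assms])

lemma (in comm_group) finprod_hom:
  assumes "\<And>i. i \<in> A \<Longrightarrow> u i \<in> hom M G"
  shows "(\<lambda>x. \<Otimes>i\<in>A. u i x) \<in> hom M G"
proof (rule homI)
  have c: "u i x \<in> carrier G" if "i \<in> A" "x \<in> carrier M" for i x
    using assms[OF that(1)] that(2) by (auto simp: hom_def)
  show "(\<Otimes>i\<in>A. u i x) \<in> carrier G" if "x \<in> carrier M" for x
    using c that by (auto intro!: finprod_closed)
  show "(\<Otimes>i\<in>A. u i (x \<otimes>\<^bsub>M\<^esub> y)) = (\<Otimes>i\<in>A. u i x) \<otimes> (\<Otimes>i\<in>A. u i y)"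
    if "x \<in> carrier M" "y \<in> carrier M" for x y
  proof -
    have "(\<Otimes>i\<in>A. u i (x \<otimes>\<^bsub>M\<^esub> y)) = (\<Otimes>i\<in>A. u i x \<otimes> u i y)"
      using assms c that by (intro finprod_cong') (auto simp: hom_mult)
    then show ?thesis using c that by (simp add: finprod_multf Pi_iff)
  qed
qed

lemma (in group) pow_coefficient_hom:
  assumes "l \<in> hom M integer_group" "v \<in> carrier G"
  shows "(\<lambda>x. v [^] (l x :: int)) \<in> hom M G"
  using assms by (auto simp: hom_def int_pow_mult)

lemma (in comm_group) mult_hom:
  assumes "f \<in> hom M G" "h \<in> hom M G"
  shows "(\<lambda>x. f x \<otimes> h x) \<in> hom M G"
  using assms by (auto simp: hom_def Pi_iff m_ac)

lemma (in comm_group) inv_hom: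
  assumes "f \<in> hom M G" shows "(\<lambda>x. inv f x) \<in> hom M G"
  using assms by (auto simp: hom_def Pi_iff inv_mult)

lemma (in comm_group) quotient_eq_iff:
  assumes "a \<in> carrier G" "b \<in> carrier G" "c \<in> carrier G" "d \<in> carrier G"
  shows "a \<otimes> inv b = c \<otimes> inv d \<longleftrightarrow> a \<otimes> d = c \<otimes> b"
proof -
  have "a \<otimes> inv b = c \<otimes> inv d \<longleftrightarrow> (a \<otimes> inv b) \<otimes> (b \<otimes> d) = (c \<otimes> inv d) \<otimes> (b \<otimes> d)"
    using assms by simp
  also have "(a \<otimes> inv b) \<otimes> (b \<otimes> d) = (b \<otimes> inv b) \<otimes> (a \<otimes> d)"
    using assms by (simp only: m_ac m_closed inv_closed)
  also have "(c \<otimes> inv d) \<otimes> (b \<otimes> d) = (d \<otimes> inv d) \<otimes> (c \<otimes> b)"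
    using assms by (simp only: m_ac m_closed inv_closed)
  finally show ?thesis using assms by simp
qed

text \<open>
  In additive notation, \<open>a - b = c - d\<close> iff \<open>a - c = b - d\<close>; comparisons of coboundaries are of this form.
\<close>

lemma (in comm_group) quotient_swap:
  assumes "a \<in> carrier G" "b \<in> carrier G" "c \<in> carrier G" "d \<in> carrier G"
  shows "a \<otimes> inv b = c \<otimes> inv d \<longleftrightarrow> a \<otimes> inv c = b \<otimes> inv d"
  using assms by (simp add: quotient_eq_iff m_comm)

lemma (in comm_monoid) finprod_Times:
  assumes "finite A" "finite B" "\<And>i j. i \<in> A \<Longrightarrow> j \<in> B \<Longrightarrow> u i j \<in> carrier G"
  shows "finprod G (\<lambda>(i, j). u i j) (A \<times> B) = (\<Otimes>i\<in>A. \<Otimes>j\<in>B. u i j)"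
  using assms(1,3)
proof (induction A rule: finite_induct)
  case (insert a A)
  have "finprod G (\<lambda>(i, j). u i j) (insert a A \<times> B) = finprod G (\<lambda>(i, j). u i j) (Pair a ` B \<union> A \<times> B)"
    by (rule arg_cong[where f = "finprod G _"]) auto
  also have "\<dots> = finprod G (\<lambda>(i, j). u i j) (Pair a ` B) \<otimes> finprod G (\<lambda>(i, j). u i j) (A \<times> B)"
    using insert assms(2) by (intro finprod_Un_disjoint) auto
  also have "finprod G (\<lambda>(i, j). u i j) (Pair a ` B) = (\<Otimes>j\<in>B. u a j)"
    using insert by (subst finprod_reindex) (auto simp: inj_on_def)
  finally show ?case
    using insert by (subst finprod_insert) (auto intro!: finprod_closed)
qed simp

lemma hom_comp: "f \<in> hom A B \<Longrightarrow> h \<in> hom B C \<Longrightarrow> (\<lambda>x. h (f x)) \<in> hom A C"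
  by (auto simp: hom_def Pi_iff)

lemma subgroup_comm_group:
  assumes "comm_group M" "subgroup K M"
  shows "comm_group (M\<lparr>carrier := K\<rparr>)"
proof -
  interpret M: comm_group M by fact
  show ?thesis
    by (rule group.group_comm_groupI[OF subgroup.subgroup_is_group[OF assms(2) M.is_group]])
      (auto simp: M.m_comm subgroup.mem_carrier[OF assms(2)])
qed

section \<open>Modules over a group\<close>

locale g_module =
  fixes G :: "'g monoid" and M :: "'m monoid" and \<rho> :: "'g \<Rightarrow> 'm \<Rightarrow> 'm"
  assumes module: "G_module G M \<rho>"
begin

sublocale G: group G
  using module by (simp add: G_module_def group_hom_def)

sublocale M: comm_group M
  using module by (simp add: G_module_def)

sublocale act: group_hom G "AutoGroup M" \<rho>
  using module by (simp add: G_module_def)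

declare act.hom_inv [simp del] act.hom_one [simp del] act.hom_mult [simp del]

lemma act_auto: "g \<in> carrier G \<Longrightarrow> \<rho> g \<in> auto M"
  using act.hom_closed[of g] by (simp add: AutoGroup_def)

lemma act_hom: "g \<in> carrier G \<Longrightarrow> \<rho> g \<in> hom M M"
  using act_auto by (simp add: auto_def)

lemma act_extensional: "g \<in> carrier G \<Longrightarrow> \<rho> g \<in> extensional (carrier M)"
  using act_auto by (simp add: auto_def Bij_def)

lemma act_closed [simp]: "g \<in> carrier G \<Longrightarrow> x \<in> carrier M \<Longrightarrow> \<rho> g x \<in> carrier M"
  using act_hom by (auto simp: hom_def)

lemma act_mult: "g \<in> carrier G \<Longrightarrow> x \<in> carrier M \<Longrightarrow> y \<in> carrier M \<Longrightarrow>
    \<rho> g (x \<otimes>\<^bsub>M\<^esub> y) = \<rho> g x \<otimes>\<^bsub>M\<^esub> \<rho> g y"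
  using act_hom by (auto simp: hom_def)

lemma act_group_hom: "g \<in> carrier G \<Longrightarrow> group_hom M M (\<rho> g)"
  using act_hom by unfold_locales

lemma act_one [simp]: "g \<in> carrier G \<Longrightarrow> \<rho> g \<one>\<^bsub>M\<^esub> = \<one>\<^bsub>M\<^esub>"
  by (rule group_hom.hom_one[OF act_group_hom])

lemma act_inv: "g \<in> carrier G \<Longrightarrow> x \<in> carrier M \<Longrightarrow> \<rho> g (inv\<^bsub>M\<^esub> x) = inv\<^bsub>M\<^esub> (\<rho> g x)"
  by (rule group_hom.hom_inv[OF act_group_hom])

lemma act_int_pow:
  "g \<in> carrier G \<Longrightarrow> x \<in> carrier M \<Longrightarrow> \<rho> g (x [^]\<^bsub>M\<^esub> (k :: int)) = \<rho> g x [^]\<^bsub>M\<^esub> k"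
  by (rule group_hom.hom_int_pow[OF act_group_hom])

lemma act_finprod: "g \<in> carrier G \<Longrightarrow> u \<in> A \<rightarrow> carrier M \<Longrightarrow>
    \<rho> g (finprod M u A) = (\<Otimes>\<^bsub>M\<^esub>i\<in>A. \<rho> g (u i))"
  by (rule hom_finprod[OF M.comm_group_axioms M.comm_group_axioms act_hom])

lemma act_comp: "g \<in> carrier G \<Longrightarrow> h \<in> carrier G \<Longrightarrow> x \<in> carrier M \<Longrightarrow>
    \<rho> (g \<otimes>\<^bsub>G\<^esub> h) x = \<rho> g (\<rho> h x)"
  using act.hom_mult[of g h] act_auto[of g] act_auto[of h]
  by (auto simp: AutoGroup_def BijGroup_def auto_def compose_def)

lemma act_id [simp]: "x \<in> carrier M \<Longrightarrow> \<rho> \<one>\<^bsub>G\<^esub> x = x"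
  using act.hom_one by (simp add: AutoGroup_def BijGroup_def)

lemma act_inv_act [simp]: "g \<in> carrier G \<Longrightarrow> x \<in> carrier M \<Longrightarrow> \<rho> (inv\<^bsub>G\<^esub> g) (\<rho> g x) = x"
  by (simp flip: act_comp)

lemma act_act_inv [simp]: "g \<in> carrier G \<Longrightarrow> x \<in> carrier M \<Longrightarrow> \<rho> g (\<rho> (inv\<^bsub>G\<^esub> g) x) = x"
  by (simp flip: act_comp)

end

lemma G_moduleI:
  assumes G: "group G" and M: "comm_group M"
    and hom: "\<And>g. g \<in> carrier G \<Longrightarrow> \<rho> g \<in> hom M M"
    and ext: "\<And>g. g \<in> carrier G \<Longrightarrow> \<rho> g \<in> extensional (carrier M)"
    and id: "\<And>x. x \<in> carrier M \<Longrightarrow> \<rho> \<one>\<^bsub>G\<^esub> x = x"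
    and comp: "\<And>g h x. g \<in> carrier G \<Longrightarrow> h \<in> carrier G \<Longrightarrow> x \<in> carrier M \<Longrightarrow>
      \<rho> (g \<otimes>\<^bsub>G\<^esub> h) x = \<rho> g (\<rho> h x)"
  shows "G_module G M \<rho>"
proof -
  interpret G: group G by fact
  interpret M: comm_group M by fact
  have clos: "\<rho> g x \<in> carrier M" if "g \<in> carrier G" "x \<in> carrier M" for g x
    using hom[OF that(1)] that(2) by (auto simp: hom_def)
  have auto: "\<rho> g \<in> auto M" if g: "g \<in> carrier G" for g
  proof -
    have "bij_betw (\<rho> g) (carrier M) (carrier M)"
      by (rule bij_betw_byWitness[where f' = "\<rho> (inv\<^bsub>G\<^esub> g)"])
        (use g clos in \<open>auto simp flip: comp simp: id\<close>)
    then show ?thesis using hom[OF g] ext[OF g] by (simp add: auto_def Bij_def)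
  qed
  have "\<rho> (g \<otimes>\<^bsub>G\<^esub> h) = compose (carrier M) (\<rho> g) (\<rho> h)"
    if "g \<in> carrier G" "h \<in> carrier G" for g h
    using that comp ext[of "g \<otimes>\<^bsub>G\<^esub> h"] by (auto simp: compose_def fun_eq_iff extensional_def)
  then have "\<rho> \<in> hom G (AutoGroup M)"
    using auto by (auto simp: hom_def AutoGroup_def BijGroup_def auto_def)
  then show ?thesis
    by (simp add: G_module_def group_hom_def group_hom_axioms_def G M M.AutoGroup)
qed

lemma G_module_restrict:
  assumes "G_module G M \<rho>" "subgroup H G"
  shows "G_module (G\<lparr>carrier := H\<rparr>) M \<rho>"
proof -
  interpret g_module G M \<rho> by unfold_locales fact
  interpret H: subgroup H G by fact
  show ?thesis
    by (rule G_moduleI)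
      (auto simp: H.subgroup_is_group[OF G.group_axioms] M.comm_group_axioms act_hom act_extensional act_comp)
qed

lemma G_hom_restrict:
  "subgroup H G \<Longrightarrow> f \<in> G_hom G M \<rho> N \<sigma> \<Longrightarrow> f \<in> G_hom (G\<lparr>carrier := H\<rparr>) M \<rho> N \<sigma>"
  by (auto simp: G_hom_def dest: subgroup.mem_carrier)

lemma G_lattice_restrict:
  "G_lattice G M \<rho> \<Longrightarrow> subgroup H G \<Longrightarrow> G_lattice (G\<lparr>carrier := H\<rparr>) M \<rho>"
  by (auto simp: G_lattice_def G_module_restrict)

lemma permutation_lattice_restrict:
  "permutation_lattice G M \<rho> \<Longrightarrow> subgroup H G \<Longrightarrow> permutation_lattice (G\<lparr>carrier := H\<rparr>) M \<rho>"
  unfolding permutation_lattice_def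
  by (fastforce simp: G_module_restrict dest: subgroup.mem_carrier)

section \<open>Bases\<close>

text \<open>
  The coefficient of \<open>x\<close> at the basis element \<open>b\<close>; meaningful only for \<open>b\<close> in \<open>B\<close> and \<open>x\<close> in the
  carrier of \<open>M\<close>.
\<close>

definition coord :: "'m monoid \<Rightarrow> 'm set \<Rightarrow> 'm \<Rightarrow> 'm \<Rightarrow> int" where
  "coord M B b x =
     inv_into (B \<rightarrow>\<^sub>E UNIV) (\<lambda>a. \<Otimes>\<^bsub>M\<^esub>b\<in>B. b [^]\<^bsub>M\<^esub> a b) x b"

context
  fixes M :: "'m monoid" and B
  assumes M: "comm_group M" and B: "Z_basis M B"
begin

interpretation M: comm_group M by (rule M)

lemma basis_finite: "finite B" and basis_closed: "b \<in> B \<Longrightarrow> b \<in> carrier M"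
  using B by (auto simp: Z_basis_def)

lemma basis_expansion:
  assumes "x \<in> carrier M"
  shows "(\<Otimes>\<^bsub>M\<^esub>b\<in>B. b [^]\<^bsub>M\<^esub> coord M B b x) = x"
proof -
  have "x \<in> (\<lambda>a. \<Otimes>\<^bsub>M\<^esub>b\<in>B. b [^]\<^bsub>M\<^esub> a b) ` (B \<rightarrow>\<^sub>E (UNIV :: int set))"
    using B assms by (simp add: Z_basis_def bij_betw_def)
  from f_inv_into_f[OF this] show ?thesis by (simp only: coord_def)
qed

lemma coord_unique:
  assumes b: "b \<in> B" and x: "x = (\<Otimes>\<^bsub>M\<^esub>b\<in>B. b [^]\<^bsub>M\<^esub> (a b :: int))"
  shows "coord M B b x = a b"
proof -
  let ?F = "\<lambda>a. \<Otimes>\<^bsub>M\<^esub>b\<in>B. b [^]\<^bsub>M\<^esub> (a b :: int)"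
  have "x = ?F (restrict a B)"
    unfolding x by (rule M.finprod_cong') (auto simp: basis_closed)
  moreover have "inj_on ?F (B \<rightarrow>\<^sub>E UNIV)" using B by (simp add: Z_basis_def bij_betw_def)
  ultimately show ?thesis
    using inv_into_f_f[of ?F "B \<rightarrow>\<^sub>E UNIV" "restrict a B"] b
    unfolding coord_def by (simp del: restrict_apply) simp
qed

lemma coord_hom:
  assumes b: "b \<in> B" shows "coord M B b \<in> hom M integer_group"
proof (rule homI)
  fix x y assume x: "x \<in> carrier M" and y: "y \<in> carrier M"
  have "x \<otimes>\<^bsub>M\<^esub> y = (\<Otimes>\<^bsub>M\<^esub>b\<in>B. b [^]\<^bsub>M\<^esub> coord M B b x \<otimes>\<^bsub>M\<^esub> b [^]\<^bsub>M\<^esub> coord M B b y)"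
    by (subst M.finprod_multf) (auto simp: basis_closed basis_expansion x y)
  also have "\<dots> = (\<Otimes>\<^bsub>M\<^esub>b\<in>B. b [^]\<^bsub>M\<^esub> (coord M B b x + coord M B b y))"
    by (rule M.finprod_cong') (auto simp: basis_closed M.int_pow_mult)
  finally show "coord M B b (x \<otimes>\<^bsub>M\<^esub> y) = coord M B b x \<otimes>\<^bsub>integer_group\<^esub> coord M B b y"
    by (simp add: coord_unique[OF b])
qed simp

lemma coord_basis:
  assumes "b \<in> B" "c \<in> B" shows "coord M B b c = (if b = c then 1 else 0)"
proof (rule coord_unique[OF assms(1)])
  have "(\<Otimes>\<^bsub>M\<^esub>b\<in>B. b [^]\<^bsub>M\<^esub> (if b = c then 1 else 0 :: int)) = (\<Otimes>\<^bsub>M\<^esub>b\<in>B. if c = b then b else \<one>\<^bsub>M\<^esub>)"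
    by (rule M.finprod_cong') (auto simp: basis_closed)
  also have "\<dots> = c"
    using M.finprod_singleton[OF assms(2) basis_finite, of "\<lambda>b. b"] by (auto simp: basis_closed)
  finally show "c = (\<Otimes>\<^bsub>M\<^esub>b\<in>B. b [^]\<^bsub>M\<^esub> (if b = c then 1 else 0 :: int))" by simp
qed

lemma basis_extension:
  assumes N: "comm_group N" and v: "\<And>b. b \<in> B \<Longrightarrow> v b \<in> carrier N"
  obtains f where "f \<in> hom M N" "\<And>b. b \<in> B \<Longrightarrow> f b = v b"
proof -
  interpret N: comm_group N by fact
  let ?f = "\<lambda>x. \<Otimes>\<^bsub>N\<^esub>b\<in>B. v b [^]\<^bsub>N\<^esub> coord M B b x"
  have "?f c = v c" if c: "c \<in> B" for c
  proof -
    have "?f c = (\<Otimes>\<^bsub>N\<^esub>b\<in>B. if c = b then v b else \<one>\<^bsub>N\<^esub>)"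
      by (rule N.finprod_cong') (auto simp: coord_basis c v)
    then show ?thesis using N.finprod_singleton[OF c basis_finite, of v] v by auto
  qed
  moreover have "?f \<in> hom M N"
    by (rule N.finprod_hom[OF N.pow_coefficient_hom]) (auto simp: coord_hom v)
  ultimately show ?thesis using that by blast
qed

lemma basis_hom_eqI:
  assumes N: "comm_group N" and f: "f \<in> hom M N" and h: "h \<in> hom M N"
    and eq: "\<And>b. b \<in> B \<Longrightarrow> f b = h b" and x: "x \<in> carrier M"
  shows "f x = h x"
proof -
  interpret N: comm_group N by fact
  have expand: "k x = (\<Otimes>\<^bsub>N\<^esub>b\<in>B. k b [^]\<^bsub>N\<^esub> coord M B b x)" if k: "k \<in> hom M N" for k
  proof -
    interpret k: group_hom M N k by unfold_locales (rule k)
    have "k x = k (\<Otimes>\<^bsub>M\<^esub>b\<in>B. b [^]\<^bsub>M\<^esub> coord M B b x)" by (simp add: basis_expansion x)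
    also have "\<dots> = (\<Otimes>\<^bsub>N\<^esub>b\<in>B. k (b [^]\<^bsub>M\<^esub> coord M B b x))"
      by (rule hom_finprod[OF M N k]) (auto simp: basis_closed)
    also have "\<dots> = (\<Otimes>\<^bsub>N\<^esub>b\<in>B. k b [^]\<^bsub>N\<^esub> coord M B b x)"
      by (rule N.finprod_cong') (auto simp: basis_closed k.hom_int_pow)
    finally show ?thesis .
  qed
  show ?thesis
    unfolding expand[OF f] expand[OF h]
    using h by (intro N.finprod_cong') (auto simp: eq hom_def basis_closed)
qed

end

lemma Z_basisI:
  assumes M: "comm_group M" and fin: "finite B" and sub: "B \<subseteq> carrier M"
    and expand: "\<And>x. x \<in> carrier M \<Longrightarrow> (\<Otimes>\<^bsub>M\<^esub>b\<in>B. b [^]\<^bsub>M\<^esub> (c b x :: int)) = x"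
    and unique: "\<And>a b. a \<in> B \<rightarrow>\<^sub>E UNIV \<Longrightarrow> b \<in> B \<Longrightarrow> c b (\<Otimes>\<^bsub>M\<^esub>b\<in>B. b [^]\<^bsub>M\<^esub> (a b :: int)) = a b"
  shows "Z_basis M B"
proof -
  interpret M: comm_group M by fact
  have "bij_betw (\<lambda>a. \<Otimes>\<^bsub>M\<^esub>b\<in>B. b [^]\<^bsub>M\<^esub> (a b :: int)) (B \<rightarrow>\<^sub>E UNIV) (carrier M)"
  proof (rule bij_betw_byWitness[where f' = "\<lambda>x. \<lambda>b\<in>B. c b x"])
    show "\<forall>a\<in>B \<rightarrow>\<^sub>E UNIV. (\<lambda>b\<in>B. c b (\<Otimes>\<^bsub>M\<^esub>b\<in>B. b [^]\<^bsub>M\<^esub> a b)) = a"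
      using unique by (auto simp: fun_eq_iff PiE_def extensional_def)
    show "\<forall>x\<in>carrier M. (\<Otimes>\<^bsub>M\<^esub>b\<in>B. b [^]\<^bsub>M\<^esub> (\<lambda>b\<in>B. c b x) b) = x"
    proof
      fix x assume x: "x \<in> carrier M"
      have "(\<Otimes>\<^bsub>M\<^esub>b\<in>B. b [^]\<^bsub>M\<^esub> (\<lambda>b\<in>B. c b x) b) = (\<Otimes>\<^bsub>M\<^esub>b\<in>B. b [^]\<^bsub>M\<^esub> c b x)"
        using sub by (intro M.finprod_cong') auto
      then show "(\<Otimes>\<^bsub>M\<^esub>b\<in>B. b [^]\<^bsub>M\<^esub> (\<lambda>b\<in>B. c b x) b) = x" using expand x by simp
    qed
  qed (use sub in \<open>auto intro!: M.finprod_closed\<close>)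
  then show ?thesis using fin sub by (simp add: Z_basis_def)
qed

section \<open>The lattice of integer-valued functions on a finite set\<close>

definition fun_lattice :: "'x set \<Rightarrow> ('x \<Rightarrow> int) monoid" where
  "fun_lattice S = \<lparr>carrier = S \<rightarrow>\<^sub>E UNIV, monoid.mult = (\<lambda>p q. \<lambda>x\<in>S. p x + q x), one = (\<lambda>x\<in>S. 0)\<rparr>"

definition fun_action :: "'g monoid \<Rightarrow> 'x set \<Rightarrow> ('g \<Rightarrow> 'x \<Rightarrow> 'x) \<Rightarrow> 'g \<Rightarrow> ('x \<Rightarrow> int) \<Rightarrow> 'x \<Rightarrow> int" where
  "fun_action G S \<alpha> g = (\<lambda>p\<in>S \<rightarrow>\<^sub>E UNIV. \<lambda>x\<in>S. p (\<alpha> (inv\<^bsub>G\<^esub> g) x))"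

definition delta :: "'x set \<Rightarrow> 'x \<Rightarrow> 'x \<Rightarrow> int" where
  "delta S x = (\<lambda>y\<in>S. if y = x then 1 else 0)"

lemma fun_lattice_carrier [simp]: "carrier (fun_lattice S) = S \<rightarrow>\<^sub>E UNIV"
  by (simp add: fun_lattice_def)

lemma fun_lattice_mult [simp]: "x \<in> S \<Longrightarrow> (p \<otimes>\<^bsub>fun_lattice S\<^esub> q) x = p x + q x"
  by (simp add: fun_lattice_def)

lemma fun_lattice_comm_group: "comm_group (fun_lattice S)"
proof (rule comm_groupI)
  fix p assume "p \<in> carrier (fun_lattice S)"
  then show "\<exists>q\<in>carrier (fun_lattice S). q \<otimes>\<^bsub>fun_lattice S\<^esub> p = \<one>\<^bsub>fun_lattice S\<^esub>"
    by (intro bexI[of _ "\<lambda>x\<in>S. - p x"]) (auto simp: fun_lattice_def)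
qed (auto simp: fun_lattice_def fun_eq_iff PiE_def extensional_def)

lemma delta_outside [simp]: "y \<notin> S \<Longrightarrow> delta S x y = undefined"
  by (simp add: delta_def)

lemma delta_carrier [simp]: "delta S x \<in> S \<rightarrow>\<^sub>E UNIV"
  by (simp add: delta_def)

lemma delta_inj: "inj_on (delta S) S"
proof (rule inj_onI)
  fix x y assume "x \<in> S" "y \<in> S" "delta S x = delta S y"
  then have "delta S x x = delta S y x" by simp
  then show "x = y" using \<open>x \<in> S\<close> by (simp add: delta_def split: if_splits)
qed

lemma finprod_integer_group: "finprod integer_group u A = sum u A"
proof -
  interpret comm_group integer_group by (rule abelian_integer_group)
  show ?thesis by (induction A rule: infinite_finite_induct) auto
qed

lemma evaluation_hom: "x \<in> S \<Longrightarrow> (\<lambda>p. p x) \<in> hom (fun_lattice S) integer_group"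
  by (auto simp: hom_def)

lemma fun_lattice_int_pow:
  assumes "x \<in> S" "p \<in> S \<rightarrow>\<^sub>E UNIV"
  shows "(p [^]\<^bsub>fun_lattice S\<^esub> (k :: int)) x = k * p x"
  using hom_int_pow[OF evaluation_hom[OF assms(1)] _ comm_group.axioms(2)[OF fun_lattice_comm_group]
      group_integer_group, of p k] assms(2) by simp

lemma fun_lattice_finprod:
  assumes "x \<in> S" "u \<in> A \<rightarrow> S \<rightarrow>\<^sub>E UNIV"
  shows "finprod (fun_lattice S) u A x = (\<Sum>i\<in>A. u i x)"
  using hom_finprod[OF fun_lattice_comm_group abelian_integer_group evaluation_hom[OF assms(1)], of u A] assms(2)
  by (simp add: finprod_integer_group)

lemma fun_lattice_basis:
  assumes S: "finite S" shows "Z_basis (fun_lattice S) (delta S ` S)"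
proof -
  interpret F: comm_group "fun_lattice S" by (rule fun_lattice_comm_group)
  let ?P = "\<lambda>a. \<Otimes>\<^bsub>fun_lattice S\<^esub>b\<in>delta S ` S. b [^]\<^bsub>fun_lattice S\<^esub> (a b :: int)"
  have pow: "b [^]\<^bsub>fun_lattice S\<^esub> (k :: int) \<in> carrier (fun_lattice S)" if "b \<in> delta S ` S" for b k
    using that by (intro F.int_pow_closed) auto
  have eval: "?P a y = a (delta S y)" if y: "y \<in> S" for a y
  proof -
    have "?P a y = (\<Sum>b\<in>delta S ` S. (b [^]\<^bsub>fun_lattice S\<^esub> a b) y)"
      using y by (intro fun_lattice_finprod) (use pow in \<open>auto simp del: PiE_iff\<close>)
    also have "\<dots> = (\<Sum>x\<in>S. a (delta S x) * delta S x y)"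
      using y by (subst sum.reindex[OF delta_inj]) (auto intro!: sum.cong simp: fun_lattice_int_pow)
    also have "\<dots> = (\<Sum>x\<in>S. if x = y then a (delta S x) else 0)"
      using y by (intro sum.cong) (auto simp: delta_def)
    finally show ?thesis using S y by simp
  qed
  have clos: "?P a \<in> carrier (fun_lattice S)" for a
    by (rule F.finprod_closed) (use pow in blast)
  show ?thesis
  proof (rule Z_basisI[where c = "\<lambda>b p. p (inv_into S (delta S) b)"])
    fix p assume "p \<in> carrier (fun_lattice S)"
    then show "?P (\<lambda>b. p (inv_into S (delta S) b)) = p"
      using clos[of "\<lambda>b. p (inv_into S (delta S) b)"]
      by (intro PiE_ext[of _ S "\<lambda>_. UNIV"]) (simp_all add: eval delta_inj)
  qed (auto simp: F.comm_group_axioms S eval delta_inj)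
qed

section \<open>Permutation frames\<close>

text \<open>
  A factorization of \<open>a Id\<close> through the permutation lattice \<open>\<int>[S]\<close>, in coordinates: \<open>l\<close> are the components
  of the map from \<open>M\<close>, and \<open>v\<close> are the images in \<open>M\<close> of the basis elements.
\<close>

locale permutation_frame = g_module G M \<rho>
  for G :: "'g monoid" and M :: "'m monoid" and \<rho> :: "'g \<Rightarrow> 'm \<Rightarrow> 'm" +
  fixes a :: int and S :: "'x set" and \<alpha> :: "'g \<Rightarrow> 'x \<Rightarrow> 'x" and l :: "'x \<Rightarrow> 'm \<Rightarrow> int" and v :: "'x \<Rightarrow> 'm"
  assumes finite_index: "finite S"
    and index_closed [simp]: "g \<in> carrier G \<Longrightarrow> x \<in> S \<Longrightarrow> \<alpha> g x \<in> S"
    and index_one [simp]: "x \<in> S \<Longrightarrow> \<alpha> \<one>\<^bsub>G\<^esub> x = x"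
    and index_comp: "g \<in> carrier G \<Longrightarrow> h \<in> carrier G \<Longrightarrow> x \<in> S \<Longrightarrow> \<alpha> (g \<otimes>\<^bsub>G\<^esub> h) x = \<alpha> g (\<alpha> h x)"
    and functional_hom: "x \<in> S \<Longrightarrow> l x \<in> hom M integer_group"
    and vector_closed [simp]: "x \<in> S \<Longrightarrow> v x \<in> carrier M"
    and functional_equivariant: "g \<in> carrier G \<Longrightarrow> x \<in> S \<Longrightarrow> m \<in> carrier M \<Longrightarrow> l (\<alpha> g x) (\<rho> g m) = l x m"
    and vector_equivariant: "g \<in> carrier G \<Longrightarrow> x \<in> S \<Longrightarrow> v (\<alpha> g x) = \<rho> g (v x)"
    and expansion: "m \<in> carrier M \<Longrightarrow> (\<Otimes>\<^bsub>M\<^esub>x\<in>S. v x [^]\<^bsub>M\<^esub> l x m) = m [^]\<^bsub>M\<^esub> a"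
begin

lemma index_inverse [simp]:
  assumes "g \<in> carrier G" "x \<in> S"
  shows "\<alpha> (inv\<^bsub>G\<^esub> g) (\<alpha> g x) = x" "\<alpha> g (\<alpha> (inv\<^bsub>G\<^esub> g) x) = x"
  using assms by (simp_all flip: index_comp)

lemma index_bij: "g \<in> carrier G \<Longrightarrow> bij_betw (\<alpha> g) S S"
  by (rule bij_betw_byWitness[where f' = "\<alpha> (inv\<^bsub>G\<^esub> g)"]) auto

lemma index_image: "g \<in> carrier G \<Longrightarrow> \<alpha> g ` S = S"
  using index_bij by (simp add: bij_betw_def)

lemma fun_lattice_module: "G_module G (fun_lattice S) (fun_action G S \<alpha>)"
proof (rule G_moduleI)
  fix g h p assume "g \<in> carrier G" "h \<in> carrier G" "p \<in> carrier (fun_lattice S)"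
  then show "fun_action G S \<alpha> (g \<otimes>\<^bsub>G\<^esub> h) p = fun_action G S \<alpha> g (fun_action G S \<alpha> h p)"
    by (auto simp: fun_action_def G.inv_mult_group index_comp)
next
  fix g assume "g \<in> carrier G"
  then show "fun_action G S \<alpha> g \<in> hom (fun_lattice S) (fun_lattice S)"
    by (auto simp: hom_def fun_action_def fun_lattice_def fun_eq_iff)
qed (auto simp: G.group_axioms fun_lattice_comm_group fun_action_def fun_eq_iff PiE_def extensional_def)

lemma fun_lattice_permutation: "permutation_lattice G (fun_lattice S) (fun_action G S \<alpha>)"
proof -
  have shift: "fun_action G S \<alpha> g (delta S x) = delta S (\<alpha> g x)" if "g \<in> carrier G" "x \<in> S" for g x
    using that by (auto simp: fun_action_def delta_def fun_eq_iff)
  have "fun_action G S \<alpha> g ` delta S ` S = delta S ` S" if g: "g \<in> carrier G" for g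
  proof -
    have "fun_action G S \<alpha> g ` delta S ` S = delta S ` \<alpha> g ` S"
      unfolding image_image using shift g by (intro image_cong) auto
    then show ?thesis using index_image[OF g] by simp
  qed
  then show ?thesis
    unfolding permutation_lattice_def using fun_lattice_module fun_lattice_basis[OF finite_index] by blast
qed

text \<open>
  An equivariant family \<open>w\<close> in any module \<open>N\<close> is a \<open>G\<close>-homomorphism \<open>\<int>[S] \<rightarrow> N\<close>; this is its composite
  with the map \<open>M \<rightarrow> \<int>[S]\<close> given by the functionals.
\<close>

lemma combination_G_hom:
  assumes N: "G_module G N \<nu>" and w: "\<And>x. x \<in> S \<Longrightarrow> w x \<in> carrier N"
    and eqv: "\<And>g x. g \<in> carrier G \<Longrightarrow> x \<in> S \<Longrightarrow> w (\<alpha> g x) = \<nu> g (w x)"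
  shows "(\<lambda>m. \<Otimes>\<^bsub>N\<^esub>x\<in>S. w x [^]\<^bsub>N\<^esub> l x m) \<in> G_hom G M \<rho> N \<nu>"
proof -
  interpret N: g_module G N \<nu> by unfold_locales fact
  have "(\<lambda>m. \<Otimes>\<^bsub>N\<^esub>x\<in>S. w x [^]\<^bsub>N\<^esub> l x m) \<in> hom M N"
    by (intro N.M.finprod_hom N.M.pow_coefficient_hom functional_hom w)
  moreover have "(\<Otimes>\<^bsub>N\<^esub>x\<in>S. w x [^]\<^bsub>N\<^esub> l x (\<rho> g m)) = \<nu> g (\<Otimes>\<^bsub>N\<^esub>x\<in>S. w x [^]\<^bsub>N\<^esub> l x m)"
    if g: "g \<in> carrier G" and m: "m \<in> carrier M" for g m
  proof -
    have "(\<Otimes>\<^bsub>N\<^esub>x\<in>\<alpha> g ` S. w x [^]\<^bsub>N\<^esub> l x (\<rho> g m)) = (\<Otimes>\<^bsub>N\<^esub>x\<in>S. w (\<alpha> g x) [^]\<^bsub>N\<^esub> l (\<alpha> g x) (\<rho> g m))"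
      using g w index_bij[OF g] by (intro N.M.finprod_reindex) (auto simp: bij_betw_def)
    also have "\<dots> = (\<Otimes>\<^bsub>N\<^esub>x\<in>S. \<nu> g (w x [^]\<^bsub>N\<^esub> l x m))"
      using g m w by (intro N.M.finprod_cong') (auto simp: eqv functional_equivariant N.act_int_pow)
    also have "\<dots> = \<nu> g (\<Otimes>\<^bsub>N\<^esub>x\<in>S. w x [^]\<^bsub>N\<^esub> l x m)"
      using g w by (intro N.act_finprod[symmetric]) auto
    finally show ?thesis using index_image[OF g] by simp
  qed
  ultimately show ?thesis by (simp add: G_hom_def)
qed

lemma factors: "factors_through_permutation G M \<rho> a"
proof (rule factors_through_permutationI[OF fun_lattice_permutation])
  let ?f = "\<lambda>m. \<lambda>x\<in>S. l x m" and ?h = "\<lambda>p. \<Otimes>\<^bsub>M\<^esub>x\<in>S. v x [^]\<^bsub>M\<^esub> (p x :: int)"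
  show "?f \<in> G_hom G M \<rho> (fun_lattice S) (fun_action G S \<alpha>)"
  proof -
    have "l x (\<rho> g m) = l (\<alpha> (inv\<^bsub>G\<^esub> g) x) m" if "g \<in> carrier G" "x \<in> S" "m \<in> carrier M" for g x m
      using functional_equivariant[of g "\<alpha> (inv\<^bsub>G\<^esub> g) x" m] that by simp
    then show ?thesis
      using functional_hom by (auto simp: G_hom_def hom_def fun_lattice_def fun_action_def fun_eq_iff)
  qed
  show "?h \<in> G_hom G (fun_lattice S) (fun_action G S \<alpha>) M \<rho>"
  proof -
    have "?h \<in> hom (fun_lattice S) M"
      by (intro M.finprod_hom M.pow_coefficient_hom evaluation_hom) auto
    moreover have "?h (fun_action G S \<alpha> g p) = \<rho> g (?h p)"
      if g: "g \<in> carrier G" and p: "p \<in> S \<rightarrow>\<^sub>E UNIV" for g p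
    proof -
      have "(\<Otimes>\<^bsub>M\<^esub>x\<in>\<alpha> g ` S. v x [^]\<^bsub>M\<^esub> fun_action G S \<alpha> g p x)
          = (\<Otimes>\<^bsub>M\<^esub>x\<in>S. v (\<alpha> g x) [^]\<^bsub>M\<^esub> fun_action G S \<alpha> g p (\<alpha> g x))"
        using g index_bij[OF g] by (intro M.finprod_reindex) (auto simp: bij_betw_def)
      also have "\<dots> = (\<Otimes>\<^bsub>M\<^esub>x\<in>S. \<rho> g (v x [^]\<^bsub>M\<^esub> p x))"
        using g p by (intro M.finprod_cong') (auto simp: fun_action_def vector_equivariant act_int_pow)
      also have "\<dots> = \<rho> g (?h p)"
        using g by (intro act_finprod[symmetric]) auto
      finally show ?thesis using index_image[OF g] by simp
    qed
    ultimately show ?thesis by (simp add: G_hom_def)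
  qed
  show "\<forall>m\<in>carrier M. ?h (?f m) = m [^]\<^bsub>M\<^esub> a"
  proof
    fix m assume m: "m \<in> carrier M"
    have "?h (?f m) = (\<Otimes>\<^bsub>M\<^esub>x\<in>S. v x [^]\<^bsub>M\<^esub> l x m)"
      by (rule M.finprod_cong') auto
    then show "?h (?f m) = m [^]\<^bsub>M\<^esub> a" using expansion[OF m] by simp
  qed
qed

end

text \<open>
  The index set is the permuted basis. Its functionals are equivariant because a group element moves the
  coordinate at \<open>b\<close> of a vector to the coordinate at the image of \<open>b\<close> of the image vector.
\<close>

lemma permutation_frame_of_factorization:
  fixes \<rho> :: "'g \<Rightarrow> 'm \<Rightarrow> 'm"
  assumes mod: "G_module G M \<rho>" and fac: "factors_through_permutation G M \<rho> a"
  obtains S :: "nat set" and \<alpha> l v where "permutation_frame G M \<rho> a S \<alpha> l v"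
proof -
  obtain P :: "nat monoid" and \<tau> f h where P: "permutation_lattice G P \<tau>"
    and f: "f \<in> G_hom G M \<rho> P \<tau>" and h: "h \<in> G_hom G P \<tau> M \<rho>"
    and hf: "\<And>x. x \<in> carrier M \<Longrightarrow> h (f x) = x [^]\<^bsub>M\<^esub> a"
    using fac unfolding factors_through_permutation_def by blast
  obtain B where B: "Z_basis P B" and perm: "\<And>g. g \<in> carrier G \<Longrightarrow> \<tau> g ` B = B"
    using P unfolding permutation_lattice_def by blast
  interpret M: g_module G M \<rho> by unfold_locales fact
  interpret P: g_module G P \<tau> using P by unfold_locales (simp add: permutation_lattice_def)
  note Pc = P.M.comm_group_axioms
  have hom: "f \<in> hom M P" "h \<in> hom P M"
    and eqv: "\<And>g x. g \<in> carrier G \<Longrightarrow> x \<in> carrier M \<Longrightarrow> f (\<rho> g x) = \<tau> g (f x)"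
      "\<And>g x. g \<in> carrier G \<Longrightarrow> x \<in> carrier P \<Longrightarrow> h (\<tau> g x) = \<rho> g (h x)"
    using f h by (auto simp: G_hom_def)
  have f_closed: "f x \<in> carrier P" if "x \<in> carrier M" for x using hom that by (auto simp: hom_def)
  have h_closed: "h x \<in> carrier M" if "x \<in> carrier P" for x using hom that by (auto simp: hom_def)
  have B_closed: "b \<in> carrier P" if "b \<in> B" for b using that basis_closed[OF Pc B] by blast
  have \<tau>B: "\<tau> g b \<in> B" if "g \<in> carrier G" "b \<in> B" for g b using perm that by blast
  have coord_shift: "coord P B (\<tau> g b) (\<tau> g y) = coord P B b y"
    if g: "g \<in> carrier G" and b: "b \<in> B" and y: "y \<in> carrier P" for g b y
  proof -
    \<comment> \<open>The coefficients of \<open>\<tau> g y\<close>: those of \<open>y\<close>, transported along \<open>\<tau> g\<close>.\<close>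
    let ?a = "\<lambda>c. coord P B (\<tau> (inv\<^bsub>G\<^esub> g) c) y"
    have inj: "inj_on (\<tau> g) B"
      by (rule inj_on_inverseI[of _ "\<tau> (inv\<^bsub>G\<^esub> g)"]) (use g B_closed in simp)
    have "\<tau> g y = \<tau> g (\<Otimes>\<^bsub>P\<^esub>c\<in>B. c [^]\<^bsub>P\<^esub> coord P B c y)"
      by (simp add: basis_expansion[OF Pc B] y)
    also have "\<dots> = (\<Otimes>\<^bsub>P\<^esub>c\<in>B. \<tau> g c [^]\<^bsub>P\<^esub> coord P B c y)"
      using g B_closed by (subst P.act_finprod) (auto intro!: P.M.finprod_cong' simp: P.act_int_pow)
    also have "\<dots> = (\<Otimes>\<^bsub>P\<^esub>c\<in>B. \<tau> g c [^]\<^bsub>P\<^esub> ?a (\<tau> g c))"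
      using g B_closed by (intro P.M.finprod_cong') auto
    also have "\<dots> = (\<Otimes>\<^bsub>P\<^esub>c\<in>\<tau> g ` B. c [^]\<^bsub>P\<^esub> ?a c)"
      using g B_closed inj by (intro P.M.finprod_reindex[symmetric]) auto
    finally have "\<tau> g y = (\<Otimes>\<^bsub>P\<^esub>c\<in>B. c [^]\<^bsub>P\<^esub> ?a c)" using perm[OF g] by simp
    from coord_unique[OF Pc B \<tau>B[OF g b] this] show ?thesis using g b B_closed by simp
  qed
  have "permutation_frame G M \<rho> a B \<tau> (\<lambda>b m. coord P B b (f m)) h"
  proof unfold_locales
    fix m assume m: "m \<in> carrier M"
    have "(\<Otimes>\<^bsub>M\<^esub>b\<in>B. h b [^]\<^bsub>M\<^esub> coord P B b (f m)) = (\<Otimes>\<^bsub>M\<^esub>b\<in>B. h (b [^]\<^bsub>P\<^esub> coord P B b (f m)))"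
      using B_closed h_closed hom_int_pow[OF hom(2)] P.M.group_axioms M.M.group_axioms
      by (intro M.M.finprod_cong') auto
    also have "\<dots> = h (\<Otimes>\<^bsub>P\<^esub>b\<in>B. b [^]\<^bsub>P\<^esub> coord P B b (f m))"
      using B_closed by (intro hom_finprod[symmetric] hom) (auto intro: P.M.comm_group_axioms M.M.comm_group_axioms)
    finally show "(\<Otimes>\<^bsub>M\<^esub>b\<in>B. h b [^]\<^bsub>M\<^esub> coord P B b (f m)) = m [^]\<^bsub>M\<^esub> a"
      by (simp add: basis_expansion[OF Pc B] f_closed m hf)
  qed (use \<tau>B B_closed h_closed f_closed basis_finite[OF Pc B] in
      \<open>auto simp: eqv coord_shift P.act_comp intro: hom_comp[OF hom(1) coord_hom[OF Pc B]]\<close>)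
  then show ?thesis by (rule that)
qed

text \<open>
  The disjoint union of two frames corresponds to the direct sum of the permutation lattices.
\<close>

lemma factors_add:
  assumes mod: "G_module G M \<rho>"
    and fac: "factors_through_permutation G M \<rho> a" "factors_through_permutation G M \<rho> b"
  shows "factors_through_permutation G M \<rho> (a + b)"
proof -
  obtain S :: "nat set" and \<alpha> l v where "permutation_frame G M \<rho> a S \<alpha> l v"
    using permutation_frame_of_factorization[OF mod fac(1)] .
  then interpret S: permutation_frame G M \<rho> a S \<alpha> l v .
  obtain T :: "nat set" and \<beta> k w where "permutation_frame G M \<rho> b T \<beta> k w"
    using permutation_frame_of_factorization[OF mod fac(2)] .
  then interpret T: permutation_frame G M \<rho> b T \<beta> k w .
  let ?k = "case_sum l k" and ?w = "case_sum v w"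
  interpret permutation_frame G M \<rho> "a + b" "S <+> T" "\<lambda>g. map_sum (\<alpha> g) (\<beta> g)" ?k ?w
  proof unfold_locales
    fix m assume m: "m \<in> carrier M"
    have "(\<Otimes>\<^bsub>M\<^esub>z\<in>S <+> T. ?w z [^]\<^bsub>M\<^esub> ?k z m)
        = (\<Otimes>\<^bsub>M\<^esub>z\<in>Inl ` S. ?w z [^]\<^bsub>M\<^esub> ?k z m) \<otimes>\<^bsub>M\<^esub> (\<Otimes>\<^bsub>M\<^esub>z\<in>Inr ` T. ?w z [^]\<^bsub>M\<^esub> ?k z m)"
      unfolding Plus_def using S.finite_index T.finite_index
      by (intro S.M.finprod_Un_disjoint) auto
    also have "\<dots> = m [^]\<^bsub>M\<^esub> a \<otimes>\<^bsub>M\<^esub> m [^]\<^bsub>M\<^esub> b"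
      using m by (subst (1 2) S.M.finprod_reindex) (auto simp: S.expansion T.expansion)
    finally show "(\<Otimes>\<^bsub>M\<^esub>z\<in>S <+> T. ?w z [^]\<^bsub>M\<^esub> ?k z m) = m [^]\<^bsub>M\<^esub> (a + b)"
      using m by (simp add: S.M.int_pow_mult)
  qed (auto simp: S.finite_index T.finite_index S.index_comp T.index_comp S.functional_hom T.functional_hom
      S.functional_equivariant T.functional_equivariant S.vector_equivariant T.vector_equivariant)
  show ?thesis by (rule factors)
qed

lemma factors_mult:
  assumes "G_module G M \<rho>" "factors_through_permutation G M \<rho> a"
  shows "factors_through_permutation G M \<rho> (a * b)"
proof -
  obtain S :: "nat set" and \<alpha> l v where "permutation_frame G M \<rho> a S \<alpha> l v"
    using permutation_frame_of_factorization[OF assms] .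
  then interpret S: permutation_frame G M \<rho> a S \<alpha> l v .
  interpret permutation_frame G M \<rho> "a * b" S \<alpha> l "\<lambda>x. v x [^]\<^bsub>M\<^esub> b"
  proof unfold_locales
    fix m assume m: "m \<in> carrier M"
    have "(\<Otimes>\<^bsub>M\<^esub>x\<in>S. (v x [^]\<^bsub>M\<^esub> b) [^]\<^bsub>M\<^esub> l x m) = (\<Otimes>\<^bsub>M\<^esub>x\<in>S. (v x [^]\<^bsub>M\<^esub> l x m) [^]\<^bsub>M\<^esub> b)"
      by (rule S.M.finprod_cong') (auto simp: S.M.int_pow_pow mult.commute)
    also have "\<dots> = (m [^]\<^bsub>M\<^esub> a) [^]\<^bsub>M\<^esub> b"
      using m S.expansion[OF m] by (subst S.M.finprod_int_pow[symmetric]) auto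
    finally show "(\<Otimes>\<^bsub>M\<^esub>x\<in>S. (v x [^]\<^bsub>M\<^esub> b) [^]\<^bsub>M\<^esub> l x m) = m [^]\<^bsub>M\<^esub> (a * b)"
      using m by (simp add: S.M.int_pow_pow)
  qed (auto simp: S.finite_index S.index_comp S.functional_hom S.functional_equivariant
      S.vector_equivariant S.act_int_pow)
  show ?thesis by (rule factors)
qed

section \<open>Restriction and transfer\<close>

text \<open>
  A choice function for the left cosets of \<open>H\<close>: the three properties say that \<open>rep g\<close> lies in \<open>g H\<close> and depends
  only on that coset.
\<close>

lemma (in group) left_transversal:
  assumes H: "subgroup H G"
  obtains rep where "\<And>g. g \<in> carrier G \<Longrightarrow> rep g \<in> carrier G"
    "\<And>g. g \<in> carrier G \<Longrightarrow> inv (rep g) \<otimes> g \<in> H"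
    "\<And>g h. g \<in> carrier G \<Longrightarrow> h \<in> H \<Longrightarrow> rep (g \<otimes> h) = rep g"
proof
  interpret H: subgroup H G by fact
  let ?rep = "\<lambda>g. SOME t. t \<in> g <# H"
  have rep: "\<exists>h\<in>H. ?rep g = g \<otimes> h" if "g \<in> carrier G" for g
  proof -
    have "g \<in> g <# H" using that H.one_closed by (force simp: l_coset_def)
    then show ?thesis using someI[of "\<lambda>t. t \<in> g <# H" g] by (auto simp: l_coset_def)
  qed
  show "?rep g \<in> carrier G" if "g \<in> carrier G" for g using rep[OF that] that by auto
  show "inv (?rep g) \<otimes> g \<in> H" if "g \<in> carrier G" for g
    using rep[OF that] that by (auto simp: inv_mult_group m_assoc)
  show "?rep (g \<otimes> h) = ?rep g" if g: "g \<in> carrier G" and h: "h \<in> H" for g h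
  proof -
    have "g \<otimes> h \<in> g <# H" using h by (auto simp: l_coset_def)
    from l_repr_independence[OF this g H] show ?thesis by simp
  qed
qed

text \<open>
  The induced frame lives on \<open>T \<times> S\<close>, where \<open>T\<close> is a left transversal of \<open>H\<close>. An element \<open>g\<close> moves \<open>(t, x)\<close>
  as in the induced set \<open>G \<times>\<^sub>H S\<close>: write \<open>g t = t' \<kappa>\<close> with \<open>t'\<close> in \<open>T\<close> and \<open>\<kappa>\<close> in \<open>H\<close>, and send \<open>(t, x)\<close> to
  \<open>(t', \<kappa> x)\<close>. For each \<open>t\<close> the terms at \<open>(t, x)\<close> add up to \<open>t (a (t\<inverse> m)) = a m\<close>.
\<close>

lemma factors_transfer:
  assumes mod: "G_module G M \<rho>" and fin: "finite (carrier G)" and H: "subgroup H G"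
    and fac: "factors_through_permutation (G\<lparr>carrier := H\<rparr>) M \<rho> a"
  shows "factors_through_permutation G M \<rho> (a * int (order G div card H))"
proof -
  interpret M: g_module G M \<rho> by unfold_locales fact
  interpret H: subgroup H G by fact
  obtain S :: "nat set" and \<alpha> l v where "permutation_frame (G\<lparr>carrier := H\<rparr>) M \<rho> a S \<alpha> l v"
    using permutation_frame_of_factorization[OF G_module_restrict[OF mod H] fac] .
  then interpret S: permutation_frame "G\<lparr>carrier := H\<rparr>" M \<rho> a S \<alpha> l v .
  obtain rep where rep: "\<And>g. g \<in> carrier G \<Longrightarrow> rep g \<in> carrier G"
    and rep_H: "\<And>g. g \<in> carrier G \<Longrightarrow> inv\<^bsub>G\<^esub> (rep g) \<otimes>\<^bsub>G\<^esub> g \<in> H"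
    and rep_eq: "\<And>g h. g \<in> carrier G \<Longrightarrow> h \<in> H \<Longrightarrow> rep (g \<otimes>\<^bsub>G\<^esub> h) = rep g"
    using M.G.left_transversal[OF H] by blast
  define T where "T = rep ` carrier G"
  have T: "t \<in> carrier G" if "t \<in> T" for t using that rep by (auto simp: T_def)
  have repT: "rep g \<in> T" if "g \<in> carrier G" for g using that by (simp add: T_def)
  have rep_split: "g = rep g \<otimes>\<^bsub>G\<^esub> (inv\<^bsub>G\<^esub> (rep g) \<otimes>\<^bsub>G\<^esub> g)" if "g \<in> carrier G" for g
    using that rep by (simp flip: M.G.m_assoc)
  have rep_mult: "rep (g \<otimes>\<^bsub>G\<^esub> rep k) = rep (g \<otimes>\<^bsub>G\<^esub> k)" if "g \<in> carrier G" "k \<in> carrier G" for g k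
    using rep_eq[of "g \<otimes>\<^bsub>G\<^esub> rep k" "inv\<^bsub>G\<^esub> (rep k) \<otimes>\<^bsub>G\<^esub> k"] rep_split[of k] rep_H[of k] that rep
    by (simp add: M.G.m_assoc)
  have rep_T: "rep t = t" if "t \<in> T" for t
    using that rep_mult[of "\<one>\<^bsub>G\<^esub>"] rep by (auto simp: T_def)
  have finT: "finite T" using fin by (simp add: T_def)
  have "bij_betw (\<lambda>(t, h). t \<otimes>\<^bsub>G\<^esub> h) (T \<times> H) (carrier G)"
    unfolding bij_betw_def
  proof (intro conjI subset_antisym inj_onI subsetI)
    fix x y assume x: "x \<in> T \<times> H" and y: "y \<in> T \<times> H"
      and eq: "(case x of (t, h) \<Rightarrow> t \<otimes>\<^bsub>G\<^esub> h) = (case y of (t, h) \<Rightarrow> t \<otimes>\<^bsub>G\<^esub> h)"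
    then have "rep (fst x) = rep (fst y)"
      using rep_eq[of "fst x" "snd x"] rep_eq[of "fst y" "snd y"] T by auto
    then show "x = y" using x y eq rep_T T by auto
  next
    fix g assume "g \<in> carrier G"
    then have "g = (\<lambda>(t, h). t \<otimes>\<^bsub>G\<^esub> h) (rep g, inv\<^bsub>G\<^esub> (rep g) \<otimes>\<^bsub>G\<^esub> g)"
      and "(rep g, inv\<^bsub>G\<^esub> (rep g) \<otimes>\<^bsub>G\<^esub> g) \<in> T \<times> H"
      using rep_split rep_H repT by auto
    then show "g \<in> (\<lambda>(t, h). t \<otimes>\<^bsub>G\<^esub> h) ` (T \<times> H)" by (rule image_eqI)
  qed (use T in auto)
  then have "card T * card H = order G"
    by (metis bij_betw_same_card card_cartesian_product order_def)
  then have cardT: "order G div card H = card T"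
    using H.one_closed finite_subset[OF H.subset fin]
    by (metis card_gt_0_iff empty_iff nonzero_mult_div_cancel_right not_gr_zero)
  define \<kappa> where "\<kappa> g t = inv\<^bsub>G\<^esub> (rep (g \<otimes>\<^bsub>G\<^esub> t)) \<otimes>\<^bsub>G\<^esub> (g \<otimes>\<^bsub>G\<^esub> t)" for g t
  have \<kappa>: "\<kappa> g t \<in> H" if "g \<in> carrier G" "t \<in> T" for g t
    using rep_H that T by (simp add: \<kappa>_def)
  have rep_\<kappa>: "rep (g \<otimes>\<^bsub>G\<^esub> t) \<otimes>\<^bsub>G\<^esub> \<kappa> g t = g \<otimes>\<^bsub>G\<^esub> t" if "g \<in> carrier G" "t \<in> T" for g t
    unfolding \<kappa>_def using that T rep_split[of "g \<otimes>\<^bsub>G\<^esub> t"] by simp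
  \<comment> \<open>The cocycle rule for \<open>\<kappa>\<close>, which makes the induced operation on \<open>T \<times> S\<close> an action.\<close>
  have \<kappa>_comp: "\<kappa> (g \<otimes>\<^bsub>G\<^esub> h) t = \<kappa> g (rep (h \<otimes>\<^bsub>G\<^esub> t)) \<otimes>\<^bsub>G\<^esub> \<kappa> h t"
    if "g \<in> carrier G" "h \<in> carrier G" "t \<in> T" for g h t
  proof -
    have c: "t \<in> carrier G" "rep (h \<otimes>\<^bsub>G\<^esub> t) \<in> carrier G" "rep (g \<otimes>\<^bsub>G\<^esub> (h \<otimes>\<^bsub>G\<^esub> t)) \<in> carrier G"
      "\<kappa> h t \<in> carrier G"
      using that T rep \<kappa> by auto
    have "\<kappa> g (rep (h \<otimes>\<^bsub>G\<^esub> t)) \<otimes>\<^bsub>G\<^esub> \<kappa> h t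
        = inv\<^bsub>G\<^esub> (rep (g \<otimes>\<^bsub>G\<^esub> (h \<otimes>\<^bsub>G\<^esub> t))) \<otimes>\<^bsub>G\<^esub> (g \<otimes>\<^bsub>G\<^esub> (rep (h \<otimes>\<^bsub>G\<^esub> t) \<otimes>\<^bsub>G\<^esub> \<kappa> h t))"
      unfolding \<kappa>_def[of g] using that c by (simp add: rep_mult M.G.m_assoc)
    also have "\<dots> = \<kappa> (g \<otimes>\<^bsub>G\<^esub> h) t"
      unfolding \<kappa>_def[of "g \<otimes>\<^bsub>G\<^esub> h"] using that c by (simp add: rep_\<kappa> M.G.m_assoc)
    finally show ?thesis by simp
  qed
  interpret permutation_frame G M \<rho> "a * int (order G div card H)" "T \<times> S"
    "\<lambda>g (t, x). (rep (g \<otimes>\<^bsub>G\<^esub> t), \<alpha> (\<kappa> g t) x)"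
    "\<lambda>(t, x) m. l x (\<rho> (inv\<^bsub>G\<^esub> t) m)" "\<lambda>(t, x). \<rho> t (v x)"
  proof (unfold_locales, goal_cases)
    case 1
    then show ?case using finT S.finite_index by simp
  next
    case (2 g y)
    then show ?case using repT T \<kappa> by auto
  next
    case (3 y)
    then show ?case using T rep_T S.index_one[simplified] by (auto simp: \<kappa>_def)
  next
    case (4 g h y)
    then show ?case
      using T rep_mult \<kappa> \<kappa>_comp S.index_comp repT by (auto simp: M.G.m_assoc)
  next
    case (5 y)
    then obtain t x where y: "y = (t, x)" and t: "t \<in> T" and x: "x \<in> S" by auto
    show ?case
      unfolding y prod.case using T[OF t] x by (intro hom_comp[OF M.act_hom S.functional_hom]) auto
  next
    case (6 y)
    then show ?case using T by auto
  next
    case (7 g y m)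
    then obtain t x where y: "y = (t, x)" and t: "t \<in> T" and x: "x \<in> S" by auto
    note c = 7(1,3) T[OF t] rep[of "g \<otimes>\<^bsub>G\<^esub> t"] \<kappa>[OF 7(1) t]
    have "\<rho> (inv\<^bsub>G\<^esub> (rep (g \<otimes>\<^bsub>G\<^esub> t))) (\<rho> g m) = \<rho> (\<kappa> g t) (\<rho> (inv\<^bsub>G\<^esub> t) m)"
      using c by (simp add: \<kappa>_def M.G.m_assoc flip: M.act_comp)
    then show ?case using c x S.functional_equivariant[of "\<kappa> g t" x "\<rho> (inv\<^bsub>G\<^esub> t) m"] by (simp add: y)
  next
    case (8 g y)
    then obtain t x where y: "y = (t, x)" and t: "t \<in> T" and x: "x \<in> S" by auto
    note c = 8(1) T[OF t] rep[of "g \<otimes>\<^bsub>G\<^esub> t"] \<kappa>[OF 8(1) t] x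
    show ?case
      using c t by (simp add: y S.vector_equivariant rep_\<kappa> flip: M.act_comp)
  next
    case (9 m)
    have "(\<Otimes>\<^bsub>M\<^esub>y\<in>T \<times> S. (case y of (t, x) \<Rightarrow> \<rho> t (v x)) [^]\<^bsub>M\<^esub> (case y of (t, x) \<Rightarrow> \<lambda>m. l x (\<rho> (inv\<^bsub>G\<^esub> t) m)) m)
        = finprod M (\<lambda>(t, x). \<rho> t (v x) [^]\<^bsub>M\<^esub> l x (\<rho> (inv\<^bsub>G\<^esub> t) m)) (T \<times> S)"
      using T by (intro M.M.finprod_cong') auto
    also have "\<dots> = (\<Otimes>\<^bsub>M\<^esub>t\<in>T. \<Otimes>\<^bsub>M\<^esub>x\<in>S. \<rho> t (v x) [^]\<^bsub>M\<^esub> l x (\<rho> (inv\<^bsub>G\<^esub> t) m))"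
      using T finT S.finite_index by (intro M.M.finprod_Times) auto
    also have "\<dots> = (\<Otimes>\<^bsub>M\<^esub>t\<in>T. m [^]\<^bsub>M\<^esub> a)"
    proof (rule M.M.finprod_cong')
      fix t assume t: "t \<in> T"
      have "(\<Otimes>\<^bsub>M\<^esub>x\<in>S. \<rho> t (v x) [^]\<^bsub>M\<^esub> l x (\<rho> (inv\<^bsub>G\<^esub> t) m))
          = \<rho> t (\<Otimes>\<^bsub>M\<^esub>x\<in>S. v x [^]\<^bsub>M\<^esub> l x (\<rho> (inv\<^bsub>G\<^esub> t) m))"
        using T[OF t] by (subst M.act_finprod) (auto intro!: M.M.finprod_cong' simp: M.act_int_pow)
      also have "\<dots> = m [^]\<^bsub>M\<^esub> a"
        using T[OF t] 9 by (simp add: S.expansion M.act_int_pow)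
      finally show "(\<Otimes>\<^bsub>M\<^esub>x\<in>S. \<rho> t (v x) [^]\<^bsub>M\<^esub> l x (\<rho> (inv\<^bsub>G\<^esub> t) m)) = m [^]\<^bsub>M\<^esub> a" .
    qed (use 9 in auto)
    also have "\<dots> = (m [^]\<^bsub>M\<^esub> a) [^]\<^bsub>M\<^esub> card T"
      using 9 by (intro M.M.finprod_const) auto
    also have "\<dots> = m [^]\<^bsub>M\<^esub> (a * int (order G div card H))"
      using 9 by (simp add: cardT M.M.int_pow_pow flip: int_pow_int)
    finally show ?case .
  qed
  show ?thesis by (rule factors)
qed

lemma factors_restrict:
  assumes "subgroup H G" "factors_through_permutation G M \<rho> a"
  shows "factors_through_permutation (G\<lparr>carrier := H\<rparr>) M \<rho> a"
proof -
  obtain P :: "nat monoid" and \<tau> f h where "permutation_lattice G P \<tau>"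
    and "f \<in> G_hom G M \<rho> P \<tau>" "h \<in> G_hom G P \<tau> M \<rho>" "\<forall>x\<in>carrier M. h (f x) = x [^]\<^bsub>M\<^esub> a"
    using assms(2) unfolding factors_through_permutation_def by blast
  then show ?thesis
    by (intro factors_through_permutationI permutation_lattice_restrict G_hom_restrict assms(1))
qed

lemma factors_trivial_subgroup:
  assumes M: "G_lattice G M \<rho>"
  shows "factors_through_permutation (G\<lparr>carrier := {\<one>\<^bsub>G\<^esub>}\<rparr>) M \<rho> 1"
proof -
  obtain B where B: "Z_basis M B" using M by (auto simp: G_lattice_def)
  interpret M: g_module G M \<rho> using M by unfold_locales (simp add: G_lattice_def)
  have "G_module (G\<lparr>carrier := {\<one>\<^bsub>G\<^esub>}\<rparr>) M \<rho>"
    by (intro G_module_restrict M.module M.G.triv_subgroup)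
  then interpret T: g_module "G\<lparr>carrier := {\<one>\<^bsub>G\<^esub>}\<rparr>" M \<rho> by unfold_locales
  note Mc = M.M.comm_group_axioms
  interpret permutation_frame "G\<lparr>carrier := {\<one>\<^bsub>G\<^esub>}\<rparr>" M \<rho> 1 B "\<lambda>g b. b" "coord M B" "\<lambda>b. b"
    by unfold_locales (auto simp: basis_finite[OF Mc B] basis_closed[OF Mc B] coord_hom[OF Mc B]
        basis_expansion[OF Mc B])
  show ?thesis by (rule factors)
qed

section \<open>The permutation order\<close>

lemma factors_order:
  assumes M: "G_lattice G M \<rho>" and fin: "finite (carrier G)"
  shows "factors_through_permutation G M \<rho> (int (order G))"
proof -
  have mod: "G_module G M \<rho>" using M by (simp add: G_lattice_def)
  then interpret g_module G M \<rho> by unfold_locales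
  show ?thesis
    using factors_transfer[OF mod fin G.triv_subgroup factors_trivial_subgroup[OF M]] by simp
qed

text \<open>
  The integers \<open>a\<close> for which \<open>a Id\<close> factors are closed under addition and under multiples and contain
  \<open>|G|\<close>, so they form a nonzero ideal; the permutation order is its least positive element.
\<close>

lemma p_ord_dvd_iff:
  assumes M: "G_lattice G M \<rho>" and fin: "finite (carrier G)"
  shows "int (p_ord G M \<rho>) dvd a \<longleftrightarrow> factors_through_permutation G M \<rho> a"
proof -
  let ?F = "factors_through_permutation G M \<rho>" and ?d = "p_ord G M \<rho>"
  have mod: "G_module G M \<rho>" using M by (simp add: G_lattice_def)
  then interpret g_module G M \<rho> by unfold_locales
  have "1 \<le> order G \<and> ?F (int (order G))"
    using factors_order[OF M fin] fin G.order_gt_0_iff_finite by auto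
  then have d: "1 \<le> ?d \<and> ?F (int ?d)"
    unfolding p_ord_def by (rule LeastI)
  show ?thesis
  proof
    assume "int ?d dvd a"
    then show "?F a" using factors_mult[OF mod] d by (auto elim!: dvdE)
  next
    assume a: "?F a"
    \<comment> \<open>The argument is the remainder of \<open>a\<close> modulo \<open>?d\<close>, kept in the form to which closure under sums and
      multiples applies.\<close>
    have "?F (a + int ?d * - (a div int ?d))"
      by (intro factors_add[OF mod] a factors_mult[OF mod]) (use d in simp)
    then have "?F (a mod int ?d)" by (simp add: minus_mult_div_eq_mod)
    moreover have "0 \<le> a mod int ?d" and lt: "a mod int ?d < int ?d" using d by auto
    ultimately have r: "?F (int (nat (a mod int ?d)))" by simp
    have "a mod int ?d = 0"
    proof (rule ccontr)
      assume "a mod int ?d \<noteq> 0"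
      then have "1 \<le> nat (a mod int ?d)" using \<open>0 \<le> a mod int ?d\<close> by linarith
      then have "?d \<le> nat (a mod int ?d)"
        unfolding p_ord_def[of G M \<rho>] using r by (intro Least_le) (simp add: p_ord_def)
      then show False using lt \<open>0 \<le> a mod int ?d\<close> by (simp add: le_nat_iff)
    qed
    then show "int ?d dvd a" by presburger
  qed
qed

lemma p_ord_dvd_iff_nat:
  assumes "G_lattice G M \<rho>" "finite (carrier G)"
  shows "p_ord G M \<rho> dvd n \<longleftrightarrow> factors_through_permutation G M \<rho> (int n)"
  using p_ord_dvd_iff[OF assms, of "int n"] by simp

lemma p_ord_eq_1_iff:
  assumes "G_lattice G M \<rho>" "finite (carrier G)"
  shows "p_ord G M \<rho> = 1 \<longleftrightarrow> factors_through_permutation G M \<rho> 1"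
  using p_ord_dvd_iff_nat[OF assms, of 1] by simp

lemma p_ord_dvd_order:
  assumes "G_lattice G M \<rho>" "finite (carrier G)"
  shows "p_ord G M \<rho> dvd order G"
  using p_ord_dvd_iff_nat[OF assms] factors_order[OF assms] by simp

lemma
  assumes M: "G_lattice G M \<rho>" and fin: "finite (carrier G)" and H: "subgroup H G"
  shows p_ord_restrict_dvd: "p_ord (G\<lparr>carrier := H\<rparr>) M \<rho> dvd p_ord G M \<rho>"
    and p_ord_transfer_dvd: "p_ord G M \<rho> dvd p_ord (G\<lparr>carrier := H\<rparr>) M \<rho> * (order G div card H)"
    and p_ord_restrict_dvd_card: "p_ord (G\<lparr>carrier := H\<rparr>) M \<rho> dvd card H"
proof -
  have MH: "G_lattice (G\<lparr>carrier := H\<rparr>) M \<rho>" by (rule G_lattice_restrict[OF M H])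
  have finH: "finite (carrier (G\<lparr>carrier := H\<rparr>))" using finite_subset[OF subgroup.subset[OF H] fin] by simp
  have mod: "G_module G M \<rho>" using M by (simp add: G_lattice_def)
  have "factors_through_permutation G M \<rho> (int (p_ord G M \<rho>))"
    by (rule p_ord_dvd_iff[OF M fin, THEN iffD1]) simp
  then show "p_ord (G\<lparr>carrier := H\<rparr>) M \<rho> dvd p_ord G M \<rho>"
    by (simp add: p_ord_dvd_iff_nat[OF MH finH] factors_restrict[OF H])
  have "factors_through_permutation (G\<lparr>carrier := H\<rparr>) M \<rho> (int (p_ord (G\<lparr>carrier := H\<rparr>) M \<rho>))"
    by (rule p_ord_dvd_iff[OF MH finH, THEN iffD1]) simp
  from factors_transfer[OF mod fin H this]
  show "p_ord G M \<rho> dvd p_ord (G\<lparr>carrier := H\<rparr>) M \<rho> * (order G div card H)"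
    using p_ord_dvd_iff_nat[OF M fin] by simp
  show "p_ord (G\<lparr>carrier := H\<rparr>) M \<rho> dvd card H"
    using p_ord_dvd_order[OF MH finH] by (simp add: order_def)
qed

text \<open>
  The factors on the right are powers of distinct primes, each dividing the left-hand side by restriction, so
  their product divides it. In the other direction the transfer bounds the \<open>p\<close>-adic valuation of the left-hand
  side by that of the factor at \<open>p\<close>, as the index of a Sylow subgroup is prime to \<open>p\<close>.
\<close>

lemma p_ord_Sylow_product:
  assumes M: "G_lattice G M \<rho>" and fin: "finite (carrier G)"
    and Syl: "\<And>p. Factorial_Ring.prime p \<Longrightarrow> sylow_subgroup G p (Syl p)"
  shows "p_ord G M \<rho> = (\<Prod>p\<in>prime_factors (order G). p_ord (G\<lparr>carrier := Syl p\<rparr>) M \<rho>)"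
proof -
  let ?d = "p_ord G M \<rho>" and ?e = "\<lambda>p. p_ord (G\<lparr>carrier := Syl p\<rparr>) M \<rho>" and ?n = "order G"
  have "G_module G M \<rho>" using M by (simp add: G_lattice_def)
  then interpret g_module G M \<rho> by unfold_locales
  have n: "?n \<noteq> 0" using fin G.order_gt_0_iff_finite by auto
  have d: "?d dvd ?n" by (rule p_ord_dvd_order[OF M fin])
  have sub: "subgroup (Syl p) G" and card: "card (Syl p) = p ^ multiplicity p ?n"
    if "Factorial_Ring.prime p" for p
    using Syl[OF that] by (auto simp: sylow_subgroup_def)
  have e_dvd: "?e p dvd p ^ multiplicity p ?n" if "Factorial_Ring.prime p" for p
    using p_ord_restrict_dvd_card[OF M fin sub[OF that]] card[OF that] by simp
  have coprime: "coprime (?e p) (?e q)" if "p \<in> prime_factors ?n" "q \<in> prime_factors ?n" "p \<noteq> q" for p q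
  proof -
    have "coprime p q" using that by (auto intro: primes_coprime)
    then have "coprime (p ^ multiplicity p ?n) (q ^ multiplicity q ?n)" by simp
    then show ?thesis
      by (rule coprime_divisors[rotated 2]) (use e_dvd[of p] e_dvd[of q] that in auto)
  qed
  have "(\<Prod>p\<in>A. ?e p) dvd ?d" if "A \<subseteq> prime_factors ?n" "finite A" for A
    using that(2,1)
  proof (induction A rule: finite_induct)
    case (insert p A)
    have "coprime (?e p) (\<Prod>p\<in>A. ?e p)"
      using insert coprime by (intro prod_coprime_right) auto
    moreover have "?e p dvd ?d" using insert sub p_ord_restrict_dvd[OF M fin] by auto
    ultimately show ?case using insert by (simp add: divides_mult)
  qed simp
  then have 1: "(\<Prod>p\<in>prime_factors ?n. ?e p) dvd ?d" by simp
  have e0: "?e p \<noteq> 0" if "Factorial_Ring.prime p" for p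
  proof
    assume "?e p = 0"
    then show False using e_dvd[OF that] that by (simp add: prime_gt_0_nat)
  qed
  have 2: "?d dvd (\<Prod>p\<in>prime_factors ?n. ?e p)"
  proof (rule multiplicity_le_imp_dvd)
    show "?d \<noteq> 0" using d n by auto
    fix p :: nat assume p: "Factorial_Ring.prime p"
    show "multiplicity p ?d \<le> multiplicity p (\<Prod>p\<in>prime_factors ?n. ?e p)"
    proof (cases "p dvd ?n")
      case True
      have "card (Syl p) dvd ?n" using card[OF p] by (simp add: multiplicity_dvd)
      then have mult: "?n = card (Syl p) * (?n div card (Syl p))" by simp
      define m where "m = ?n div card (Syl p)"
      have mn: "?n = p ^ multiplicity p ?n * m"
        using mult card[OF p] by (simp add: m_def)
      then have m0: "m \<noteq> 0" using n by (metis mult_0_right)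
      have "multiplicity p ?n = multiplicity p (p ^ multiplicity p ?n) + multiplicity p m"
        using m0 p by (subst mn, subst prime_elem_multiplicity_mult_distrib) auto
      then have m: "multiplicity p m = 0" using p by simp
      have "?d dvd ?e p * m" using p_ord_transfer_dvd[OF M fin sub[OF p]] by (simp add: m_def)
      then have "multiplicity p ?d \<le> multiplicity p (?e p * m)"
        using e0[OF p] m0 by (intro dvd_imp_multiplicity_le) auto
      also have "\<dots> = multiplicity p (?e p)"
        using e0[OF p] m0 p m by (subst prime_elem_multiplicity_mult_distrib) auto
      also have "\<dots> \<le> multiplicity p (\<Prod>p\<in>prime_factors ?n. ?e p)"
      proof (rule dvd_imp_multiplicity_le)
        show "?e p dvd (\<Prod>p\<in>prime_factors ?n. ?e p)"
          using True p n by (intro dvd_prodI) (auto simp: prime_factors_dvd)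
        show "(\<Prod>p\<in>prime_factors ?n. ?e p) \<noteq> 0" using e0 by auto
      qed
      finally show ?thesis .
    next
      case False
      then have "\<not> p dvd ?d" using d dvd_trans by blast
      then show ?thesis by (simp add: not_dvd_imp_multiplicity_0)
    qed
  qed
  show ?thesis by (rule dvd_antisym[OF 2 1])
qed

section \<open>First cohomology\<close>

context g_module
begin

lemma cocycles_carrierD:
  assumes "c \<in> carrier (cocycles1 G M \<rho>)"
  shows "g \<in> carrier G \<Longrightarrow> c g \<in> carrier M"
    and "g \<in> carrier G \<Longrightarrow> h \<in> carrier G \<Longrightarrow> c (g \<otimes>\<^bsub>G\<^esub> h) = c g \<otimes>\<^bsub>M\<^esub> \<rho> g (c h)"
    and "c \<in> extensional (carrier G)"
  using assms by (auto simp: cocycles1_def PiE_def)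

lemma cocycles_mult:
  "c \<otimes>\<^bsub>cocycles1 G M \<rho>\<^esub> d = (\<lambda>g\<in>carrier G. c g \<otimes>\<^bsub>M\<^esub> d g)"
  by (simp add: cocycles1_def)

lemma cocycles_comm_group: "comm_group (cocycles1 G M \<rho>)"
proof (rule comm_groupI)
  fix c d assume c: "c \<in> carrier (cocycles1 G M \<rho>)" and d: "d \<in> carrier (cocycles1 G M \<rho>)"
  note cd = cocycles_carrierD[OF c] cocycles_carrierD[OF d]
  show "c \<otimes>\<^bsub>cocycles1 G M \<rho>\<^esub> d \<in> carrier (cocycles1 G M \<rho>)"
    using cd by (auto simp: cocycles1_def act_mult M.m_ac)
  show "c \<otimes>\<^bsub>cocycles1 G M \<rho>\<^esub> d = d \<otimes>\<^bsub>cocycles1 G M \<rho>\<^esub> c"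
    using cd by (auto simp: cocycles_mult fun_eq_iff M.m_comm)
next
  fix c d e
  assume c: "c \<in> carrier (cocycles1 G M \<rho>)" and d: "d \<in> carrier (cocycles1 G M \<rho>)"
    and e: "e \<in> carrier (cocycles1 G M \<rho>)"
  show "c \<otimes>\<^bsub>cocycles1 G M \<rho>\<^esub> d \<otimes>\<^bsub>cocycles1 G M \<rho>\<^esub> e = c \<otimes>\<^bsub>cocycles1 G M \<rho>\<^esub> (d \<otimes>\<^bsub>cocycles1 G M \<rho>\<^esub> e)"
    using cocycles_carrierD(1)[OF c] cocycles_carrierD(1)[OF d] cocycles_carrierD(1)[OF e]
    by (auto simp: cocycles_mult fun_eq_iff M.m_assoc)
next
  fix c assume c: "c \<in> carrier (cocycles1 G M \<rho>)"
  show "\<one>\<^bsub>cocycles1 G M \<rho>\<^esub> \<otimes>\<^bsub>cocycles1 G M \<rho>\<^esub> c = c"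
    using cocycles_carrierD[OF c] by (auto simp: cocycles1_def fun_eq_iff extensional_def)
  have "(\<lambda>g\<in>carrier G. inv\<^bsub>M\<^esub> (c g)) \<in> carrier (cocycles1 G M \<rho>)"
    using cocycles_carrierD(1,2)[OF c] by (auto simp: cocycles1_def act_inv M.inv_mult)
  moreover have "(\<lambda>g\<in>carrier G. inv\<^bsub>M\<^esub> (c g)) \<otimes>\<^bsub>cocycles1 G M \<rho>\<^esub> c = \<one>\<^bsub>cocycles1 G M \<rho>\<^esub>"
    using cocycles_carrierD(1)[OF c] by (auto simp: cocycles1_def fun_eq_iff)
  ultimately show "\<exists>d\<in>carrier (cocycles1 G M \<rho>). d \<otimes>\<^bsub>cocycles1 G M \<rho>\<^esub> c = \<one>\<^bsub>cocycles1 G M \<rho>\<^esub>" by blast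
qed (auto simp: cocycles1_def)

sublocale Z: comm_group "cocycles1 G M \<rho>" by (rule cocycles_comm_group)

lemma cocycles_pow:
  assumes c: "c \<in> carrier (cocycles1 G M \<rho>)"
  shows "c [^]\<^bsub>cocycles1 G M \<rho>\<^esub> (n :: nat) = (\<lambda>g\<in>carrier G. c g [^]\<^bsub>M\<^esub> n)"
proof (induction n)
  case 0
  show ?case by (simp add: cocycles1_def)
next
  case (Suc n)
  then show ?case by (simp add: cocycles_mult fun_eq_iff)
qed

lemma coboundaries_subgroup: "subgroup (coboundaries1 G M \<rho>) (cocycles1 G M \<rho>)"
proof -
  let ?d = "\<lambda>m. \<lambda>g\<in>carrier G. \<rho> g m \<otimes>\<^bsub>M\<^esub> inv\<^bsub>M\<^esub> m"
  have "?d \<in> hom M (cocycles1 G M \<rho>)"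
  proof (rule homI)
    fix m assume m: "m \<in> carrier M"
    have "\<rho> (g \<otimes>\<^bsub>G\<^esub> h) m \<otimes>\<^bsub>M\<^esub> inv\<^bsub>M\<^esub> m = \<rho> g m \<otimes>\<^bsub>M\<^esub> inv\<^bsub>M\<^esub> m \<otimes>\<^bsub>M\<^esub> \<rho> g (\<rho> h m \<otimes>\<^bsub>M\<^esub> inv\<^bsub>M\<^esub> m)"
      if g: "g \<in> carrier G" and h: "h \<in> carrier G" for g h
    proof -
      have "\<rho> g m \<otimes>\<^bsub>M\<^esub> inv\<^bsub>M\<^esub> m \<otimes>\<^bsub>M\<^esub> \<rho> g (\<rho> h m \<otimes>\<^bsub>M\<^esub> inv\<^bsub>M\<^esub> m)
          = (\<rho> g m \<otimes>\<^bsub>M\<^esub> inv\<^bsub>M\<^esub> \<rho> g m) \<otimes>\<^bsub>M\<^esub> (\<rho> g (\<rho> h m) \<otimes>\<^bsub>M\<^esub> inv\<^bsub>M\<^esub> m)"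
        using g h m by (simp only: act_mult act_inv M.m_ac M.m_closed M.inv_closed act_closed)
      then show ?thesis using g h m by (simp add: act_comp)
    qed
    then show "?d m \<in> carrier (cocycles1 G M \<rho>)" using m by (auto simp: cocycles1_def)
  next
    fix m m' assume "m \<in> carrier M" "m' \<in> carrier M"
    then show "?d (m \<otimes>\<^bsub>M\<^esub> m') = ?d m \<otimes>\<^bsub>cocycles1 G M \<rho>\<^esub> ?d m'"
      by (auto simp: cocycles_mult fun_eq_iff act_mult M.inv_mult M.m_ac)
  qed
  then interpret d: group_hom M "cocycles1 G M \<rho>" ?d by unfold_locales
  show ?thesis using d.img_is_subgroup by (simp add: coboundaries1_def)
qed

text \<open>
  The \<open>n\<close>-th power of the coset of \<open>c\<close> is the coset of the pointwise power, and a coset is neutral iff a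
  representative is a coboundary.
\<close>

lemma H1_ord_dvd_iff:
  assumes c: "c \<in> carrier (cocycles1 G M \<rho>)"
  shows "group.ord (H1 G M \<rho>) (coboundaries1 G M \<rho> #>\<^bsub>cocycles1 G M \<rho>\<^esub> c) dvd n
    \<longleftrightarrow> (\<lambda>g\<in>carrier G. c g [^]\<^bsub>M\<^esub> n) \<in> coboundaries1 G M \<rho>"
proof -
  interpret B: normal "coboundaries1 G M \<rho>" "cocycles1 G M \<rho>"
    using coboundaries_subgroup Z.subgroup_imp_normal by blast
  interpret H1: group "H1 G M \<rho>" unfolding H1_def by (rule B.factorgroup_is_group)
  have "coboundaries1 G M \<rho> #>\<^bsub>cocycles1 G M \<rho>\<^esub> c \<in> carrier (H1 G M \<rho>)"
    using c by (auto simp: H1_def carrier_FactGroup)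
  then have "group.ord (H1 G M \<rho>) (coboundaries1 G M \<rho> #>\<^bsub>cocycles1 G M \<rho>\<^esub> c) dvd n \<longleftrightarrow>
      (coboundaries1 G M \<rho> #>\<^bsub>cocycles1 G M \<rho>\<^esub> c) [^]\<^bsub>H1 G M \<rho>\<^esub> n = \<one>\<^bsub>H1 G M \<rho>\<^esub>"
    by (simp only: H1.pow_eq_id)
  also have "\<dots> \<longleftrightarrow> coboundaries1 G M \<rho> #>\<^bsub>cocycles1 G M \<rho>\<^esub> (c [^]\<^bsub>cocycles1 G M \<rho>\<^esub> n) = coboundaries1 G M \<rho>"
    unfolding H1_def by (simp only: B.FactGroup_pow[OF c] one_FactGroup)
  also have "\<dots> \<longleftrightarrow> c [^]\<^bsub>cocycles1 G M \<rho>\<^esub> n \<in> coboundaries1 G M \<rho>"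
    using Z.coset_join1 Z.coset_join2 coboundaries_subgroup Z.nat_pow_closed[OF c] by metis
  finally show ?thesis by (simp only: cocycles_pow[OF c])
qed

lemma H1_trivial_coboundary:
  assumes triv: "trivial_group (H1 G M \<rho>)" and c: "c \<in> carrier (cocycles1 G M \<rho>)"
  obtains m where "m \<in> carrier M" "\<And>g. g \<in> carrier G \<Longrightarrow> c g = \<rho> g m \<otimes>\<^bsub>M\<^esub> inv\<^bsub>M\<^esub> m"
proof -
  have "coboundaries1 G M \<rho> #>\<^bsub>cocycles1 G M \<rho>\<^esub> c = coboundaries1 G M \<rho>"
    using triv c by (auto simp: trivial_group_def H1_def carrier_FactGroup)
  then have "c \<in> coboundaries1 G M \<rho>"
    using Z.coset_join1[OF _ c coboundaries_subgroup] by blast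
  then show ?thesis using that by (auto simp: coboundaries1_def)
qed

end

section \<open>The module of homomorphisms\<close>

lemma Hom_Z_carrier: "u \<in> carrier (Hom_Z M N) \<longleftrightarrow> u \<in> hom M N \<and> u \<in> extensional (carrier M)"
  by (simp add: Hom_Z_def)

lemma Hom_Z_restrict: "u \<in> hom M N \<Longrightarrow> group M \<Longrightarrow> restrict u (carrier M) \<in> carrier (Hom_Z M N)"
  by (auto simp: Hom_Z_carrier hom_def group.is_monoid monoid.m_closed)

lemma Hom_Z_mult: "u \<otimes>\<^bsub>Hom_Z M N\<^esub> v = (\<lambda>x\<in>carrier M. u x \<otimes>\<^bsub>N\<^esub> v x)"
  by (simp add: Hom_Z_def)

lemma Hom_Z_comm_group:
  assumes M: "group M" and N: "comm_group N"
  shows "comm_group (Hom_Z M N)"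
proof -
  interpret M: group M by fact
  interpret N: comm_group N by fact
  have clos: "u x \<in> carrier N" if "u \<in> carrier (Hom_Z M N)" "x \<in> carrier M" for u x
    using that by (auto simp: Hom_Z_carrier hom_def)
  show ?thesis
  proof (rule comm_groupI)
    fix u v assume uv: "u \<in> carrier (Hom_Z M N)" "v \<in> carrier (Hom_Z M N)"
    then show "u \<otimes>\<^bsub>Hom_Z M N\<^esub> v \<in> carrier (Hom_Z M N)"
      unfolding Hom_Z_mult by (intro Hom_Z_restrict N.mult_hom M) (auto simp: Hom_Z_carrier)
    show "u \<otimes>\<^bsub>Hom_Z M N\<^esub> v = v \<otimes>\<^bsub>Hom_Z M N\<^esub> u"
      using uv clos by (auto simp: Hom_Z_mult fun_eq_iff N.m_comm)
  next
    fix u v w assume "u \<in> carrier (Hom_Z M N)" "v \<in> carrier (Hom_Z M N)" "w \<in> carrier (Hom_Z M N)"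
    then show "u \<otimes>\<^bsub>Hom_Z M N\<^esub> v \<otimes>\<^bsub>Hom_Z M N\<^esub> w = u \<otimes>\<^bsub>Hom_Z M N\<^esub> (v \<otimes>\<^bsub>Hom_Z M N\<^esub> w)"
      using clos by (auto simp: Hom_Z_mult fun_eq_iff N.m_assoc)
  next
    fix u assume u: "u \<in> carrier (Hom_Z M N)"
    then show "\<one>\<^bsub>Hom_Z M N\<^esub> \<otimes>\<^bsub>Hom_Z M N\<^esub> u = u"
      using clos by (auto simp: Hom_Z_def fun_eq_iff extensional_def)
    have "(\<lambda>x\<in>carrier M. inv\<^bsub>N\<^esub> (u x)) \<in> carrier (Hom_Z M N)"
      using u by (intro Hom_Z_restrict N.inv_hom M) (auto simp: Hom_Z_carrier)
    moreover have "(\<lambda>x\<in>carrier M. inv\<^bsub>N\<^esub> (u x)) \<otimes>\<^bsub>Hom_Z M N\<^esub> u = \<one>\<^bsub>Hom_Z M N\<^esub>"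
      using u clos by (auto simp: Hom_Z_def fun_eq_iff)
    ultimately show "\<exists>v\<in>carrier (Hom_Z M N). v \<otimes>\<^bsub>Hom_Z M N\<^esub> u = \<one>\<^bsub>Hom_Z M N\<^esub>" by blast
  qed (auto simp: Hom_Z_def hom_def)
qed

lemma Hom_Z_pow:
  "x \<in> carrier M \<Longrightarrow> (u [^]\<^bsub>Hom_Z M N\<^esub> (n :: nat)) x = u x [^]\<^bsub>N\<^esub> n"
  by (induction n) (auto simp: Hom_Z_def)

lemma Hom_Z_inv:
  assumes "group M" "comm_group N" "u \<in> carrier (Hom_Z M N)" "x \<in> carrier M"
  shows "(inv\<^bsub>Hom_Z M N\<^esub> u) x = inv\<^bsub>N\<^esub> (u x)"
proof -
  interpret H: comm_group "Hom_Z M N" by (rule Hom_Z_comm_group[OF assms(1,2)])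
  interpret N: comm_group N by fact
  have i: "inv\<^bsub>Hom_Z M N\<^esub> u \<in> carrier (Hom_Z M N)" using assms(3) by simp
  have "(u \<otimes>\<^bsub>Hom_Z M N\<^esub> inv\<^bsub>Hom_Z M N\<^esub> u) x = \<one>\<^bsub>N\<^esub>"
    unfolding H.r_inv[OF assms(3)] using assms(4) by (simp add: Hom_Z_def)
  then show ?thesis
    using assms(3,4) i N.inv_unique'[of "u x" "(inv\<^bsub>Hom_Z M N\<^esub> u) x"]
    by (auto simp: Hom_Z_mult Hom_Z_carrier hom_def N.m_comm)
qed

lemma Hom_Z_module:
  assumes M: "G_module G M \<rho>" and N: "G_module G N \<nu>"
  shows "G_module G (Hom_Z M N) (Hom_action G M \<rho> N \<nu>)"
proof -
  interpret M: g_module G M \<rho> by unfold_locales fact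
  interpret N: g_module G N \<nu> by unfold_locales fact
  have clos: "u x \<in> carrier N" if "u \<in> carrier (Hom_Z M N)" "x \<in> carrier M" for u x
    using that by (auto simp: Hom_Z_carrier hom_def)
  have closed: "Hom_action G M \<rho> N \<nu> g u \<in> carrier (Hom_Z M N)"
    if g: "g \<in> carrier G" and u: "u \<in> carrier (Hom_Z M N)" for g u
  proof -
    have "(\<lambda>x. \<nu> g (u (\<rho> (inv\<^bsub>G\<^esub> g) x))) \<in> hom M N"
      using g u by (intro hom_comp[OF _ N.act_hom] hom_comp[OF M.act_hom, where h = u]) (auto simp: Hom_Z_carrier)
    then show ?thesis using u by (simp add: Hom_action_def Hom_Z_restrict M.M.group_axioms)
  qed
  show ?thesis
  proof (rule G_moduleI)
    fix g assume g: "g \<in> carrier G"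
    show "Hom_action G M \<rho> N \<nu> g \<in> hom (Hom_Z M N) (Hom_Z M N)"
    proof (rule homI)
      fix u v assume uv: "u \<in> carrier (Hom_Z M N)" "v \<in> carrier (Hom_Z M N)"
      then have "u \<otimes>\<^bsub>Hom_Z M N\<^esub> v \<in> carrier (Hom_Z M N)"
        using comm_group.axioms(2)[OF Hom_Z_comm_group[OF M.M.group_axioms N.M.comm_group_axioms]]
        by (simp add: group.is_monoid monoid.m_closed)
      with uv show "Hom_action G M \<rho> N \<nu> g (u \<otimes>\<^bsub>Hom_Z M N\<^esub> v)
          = Hom_action G M \<rho> N \<nu> g u \<otimes>\<^bsub>Hom_Z M N\<^esub> Hom_action G M \<rho> N \<nu> g v"
        using g clos by (simp add: Hom_action_def) (auto simp: Hom_Z_mult fun_eq_iff N.act_mult)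
    qed (rule closed[OF g])
    show "Hom_action G M \<rho> N \<nu> g \<in> extensional (carrier (Hom_Z M N))" by (simp add: Hom_action_def)
  next
    fix u assume "u \<in> carrier (Hom_Z M N)"
    then show "Hom_action G M \<rho> N \<nu> \<one>\<^bsub>G\<^esub> u = u"
      using clos by (auto simp: Hom_action_def fun_eq_iff Hom_Z_carrier extensional_def)
  next
    fix g h u assume gh: "g \<in> carrier G" "h \<in> carrier G" and u: "u \<in> carrier (Hom_Z M N)"
    have "Hom_action G M \<rho> N \<nu> g (Hom_action G M \<rho> N \<nu> h u) = (\<lambda>x\<in>carrier M. \<nu> g ((Hom_action G M \<rho> N \<nu> h u) (\<rho> (inv\<^bsub>G\<^esub> g) x)))"
      using closed[OF gh(2) u] by (simp add: Hom_action_def[of G M \<rho> N \<nu> g])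
    then show "Hom_action G M \<rho> N \<nu> (g \<otimes>\<^bsub>G\<^esub> h) u = Hom_action G M \<rho> N \<nu> g (Hom_action G M \<rho> N \<nu> h u)"
      using gh u clos by (auto simp: Hom_action_def fun_eq_iff M.G.inv_mult_group M.act_comp N.act_comp)
  qed (auto intro: M.G.group_axioms Hom_Z_comm_group M.M.group_axioms N.M.comm_group_axioms)
qed

section \<open>The order of an extension\<close>

locale lattice_extension =
  fixes G :: "'g monoid"
    and C :: "'c monoid" and \<zeta> :: "'g \<Rightarrow> 'c \<Rightarrow> 'c"
    and N :: "'n monoid" and \<nu> :: "'g \<Rightarrow> 'n \<Rightarrow> 'n"
    and M :: "'m monoid" and \<rho> :: "'g \<Rightarrow> 'm \<Rightarrow> 'm"
    and \<iota> :: "'c \<Rightarrow> 'n" and \<pi> :: "'n \<Rightarrow> 'm"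
  assumes exact: "exact_seq_G_lattices G C \<zeta> N \<nu> M \<rho> \<iota> \<pi>"
begin

sublocale C: g_module G C \<zeta>
  using exact by unfold_locales (simp add: exact_seq_G_lattices_def G_lattice_def)

sublocale N: g_module G N \<nu>
  using exact by unfold_locales (simp add: exact_seq_G_lattices_def G_lattice_def)

sublocale M: g_module G M \<rho>
  using exact by unfold_locales (simp add: exact_seq_G_lattices_def G_lattice_def)

sublocale i: group_hom C N \<iota>
  using exact by unfold_locales (simp add: exact_seq_G_lattices_def G_hom_def)

sublocale p: group_hom N M \<pi>
  using exact by unfold_locales (simp add: exact_seq_G_lattices_def G_hom_def)

sublocale Hom: g_module G "Hom_Z M C" "Hom_action G M \<rho> C \<zeta>"
  by unfold_locales (rule Hom_Z_module[OF M.module C.module])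

lemma i_act: "g \<in> carrier G \<Longrightarrow> x \<in> carrier C \<Longrightarrow> \<iota> (\<zeta> g x) = \<nu> g (\<iota> x)"
  using exact by (simp add: exact_seq_G_lattices_def G_hom_def)

lemma p_act: "g \<in> carrier G \<Longrightarrow> x \<in> carrier N \<Longrightarrow> \<pi> (\<nu> g x) = \<rho> g (\<pi> x)"
  using exact by (simp add: exact_seq_G_lattices_def G_hom_def)

lemma i_inj: "inj_on \<iota> (carrier C)"
  using exact by (simp add: exact_seq_G_lattices_def)

lemma i_eqD: "\<iota> x = \<iota> y \<Longrightarrow> x \<in> carrier C \<Longrightarrow> y \<in> carrier C \<Longrightarrow> x = y"
  using i_inj by (rule inj_onD)

lemma i_image: "\<iota> ` carrier C = {y \<in> carrier N. \<pi> y = \<one>\<^bsub>M\<^esub>}"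
  using exact by (simp add: exact_seq_G_lattices_def kernel_def)

lemma p_i [simp]: "x \<in> carrier C \<Longrightarrow> \<pi> (\<iota> x) = \<one>\<^bsub>M\<^esub>"
  using i_image by blast

lemma p_surj:
  assumes "x \<in> carrier M" obtains y where "y \<in> carrier N" "\<pi> y = x"
proof -
  have "x \<in> \<pi> ` carrier N" using exact assms by (simp add: exact_seq_G_lattices_def)
  then show ?thesis using that by auto
qed

text \<open>
  The inverse of \<open>\<iota>\<close> on its image, the kernel of \<open>\<pi>\<close>.
\<close>

definition pull :: "'n \<Rightarrow> 'c" where
  "pull = inv_into (carrier C) \<iota>"

lemma
  assumes "y \<in> carrier N" "\<pi> y = \<one>\<^bsub>M\<^esub>"
  shows pull_closed: "pull y \<in> carrier C" and i_pull: "\<iota> (pull y) = y"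
proof -
  have "y \<in> \<iota> ` carrier C" using assms by (simp add: i_image)
  then show "pull y \<in> carrier C" "\<iota> (pull y) = y"
    by (auto simp: pull_def inv_into_into f_inv_into_f)
qed

lemma pull_hom:
  assumes f: "f \<in> hom M N" and ker: "\<And>x. x \<in> carrier M \<Longrightarrow> \<pi> (f x) = \<one>\<^bsub>M\<^esub>"
  shows "(\<lambda>x. pull (f x)) \<in> hom M C"
proof (rule homI)
  have clos: "f x \<in> carrier N" if "x \<in> carrier M" for x using f that by (auto simp: hom_def)
  fix x y assume x: "x \<in> carrier M" and y: "y \<in> carrier M"
  show "pull (f x) \<in> carrier C" using clos ker x by (simp add: pull_closed)
  show "pull (f (x \<otimes>\<^bsub>M\<^esub> y)) = pull (f x) \<otimes>\<^bsub>C\<^esub> pull (f y)"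
    by (rule i_eqD) (use x y clos ker f in \<open>simp_all add: i_pull pull_closed hom_mult\<close>)
qed

text \<open>
  \<open>M\<close> is free over \<open>\<int>\<close>, so preimages of a basis determine a section.
\<close>

lemma section_exists:
  obtains s where "s \<in> hom M N" "\<And>x. x \<in> carrier M \<Longrightarrow> \<pi> (s x) = x"
proof -
  obtain B where B: "Z_basis M B"
    using exact by (auto simp: exact_seq_G_lattices_def G_lattice_def)
  note Mc = M.M.comm_group_axioms
  have "\<exists>y\<in>carrier N. \<pi> y = b" if "b \<in> B" for b
    using p_surj basis_closed[OF Mc B that] by metis
  then obtain v where v: "\<And>b. b \<in> B \<Longrightarrow> v b \<in> carrier N" "\<And>b. b \<in> B \<Longrightarrow> \<pi> (v b) = b" by metis
  obtain s where s: "s \<in> hom M N" "\<And>b. b \<in> B \<Longrightarrow> s b = v b"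
    using basis_extension[OF Mc B N.M.comm_group_axioms, of v] v(1) by metis
  have "(\<lambda>x. \<pi> (s x)) \<in> hom M M" by (rule hom_comp[OF s(1) p.homh])
  then have "\<pi> (s x) = x" if "x \<in> carrier M" for x
    by (rule basis_hom_eqI[OF Mc B Mc]) (use that s v in \<open>auto simp: hom_def\<close>)
  then show ?thesis using that s(1) by blast
qed

context
  fixes s assumes s_hom: "s \<in> hom M N" and p_s: "\<And>x. x \<in> carrier M \<Longrightarrow> \<pi> (s x) = x"
begin

lemma s_closed [simp]: "x \<in> carrier M \<Longrightarrow> s x \<in> carrier N"
  using s_hom by (auto simp: hom_def)

abbreviation "z \<equiv> ext_cocycle G C N \<nu> M \<rho> \<iota> s"

lemma z_eq:
  assumes "g \<in> carrier G" "x \<in> carrier M"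
  shows "z g x = pull (\<nu> g (s (\<rho> (inv\<^bsub>G\<^esub> g) x)) \<otimes>\<^bsub>N\<^esub> inv\<^bsub>N\<^esub> (s x))"
  using assms by (simp add: ext_cocycle_def pull_def)

lemma
  assumes "g \<in> carrier G" "x \<in> carrier M"
  shows z_closed: "z g x \<in> carrier C"
    and i_z: "\<iota> (z g x) = \<nu> g (s (\<rho> (inv\<^bsub>G\<^esub> g) x)) \<otimes>\<^bsub>N\<^esub> inv\<^bsub>N\<^esub> (s x)"
  using assms unfolding z_eq[OF assms] by (simp_all add: pull_closed i_pull p_act p_s)

lemma z_hom: assumes g: "g \<in> carrier G" shows "z g \<in> carrier (Hom_Z M C)"
proof -
  have "(\<lambda>x. \<nu> g (s (\<rho> (inv\<^bsub>G\<^esub> g) x)) \<otimes>\<^bsub>N\<^esub> inv\<^bsub>N\<^esub> (s x)) \<in> hom M N"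
    using g by (intro N.M.mult_hom N.M.inv_hom s_hom hom_comp[OF _ N.act_hom]
        hom_comp[OF M.act_hom s_hom]) auto
  from pull_hom[OF this] have "(\<lambda>x. pull (\<nu> g (s (\<rho> (inv\<^bsub>G\<^esub> g) x)) \<otimes>\<^bsub>N\<^esub> inv\<^bsub>N\<^esub> (s x))) \<in> hom M C"
    using g by (simp add: p_act p_s)
  then show ?thesis
    using g Hom_Z_restrict[OF _ M.M.group_axioms] by (simp add: ext_cocycle_def pull_def)
qed

lemma Hom_action_eq:
  "u \<in> carrier (Hom_Z M C) \<Longrightarrow> x \<in> carrier M \<Longrightarrow>
    Hom_action G M \<rho> C \<zeta> g u x = \<zeta> g (u (\<rho> (inv\<^bsub>G\<^esub> g) x))"
  by (simp add: Hom_action_def)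

lemma z_cocycle: "z \<in> carrier (cocycles1 G (Hom_Z M C) (Hom_action G M \<rho> C \<zeta>))"
proof -
  have "z (g \<otimes>\<^bsub>G\<^esub> h) = z g \<otimes>\<^bsub>Hom_Z M C\<^esub> Hom_action G M \<rho> C \<zeta> g (z h)"
    if g: "g \<in> carrier G" and h: "h \<in> carrier G" for g h
  proof (rule extensionalityI[where A = "carrier M"])
    show "z (g \<otimes>\<^bsub>G\<^esub> h) \<in> extensional (carrier M)"
      using z_hom[of "g \<otimes>\<^bsub>G\<^esub> h"] g h by (simp add: Hom_Z_carrier)
    show "z g \<otimes>\<^bsub>Hom_Z M C\<^esub> Hom_action G M \<rho> C \<zeta> g (z h) \<in> extensional (carrier M)"
      by (simp add: Hom_Z_mult)
    fix x assume x: "x \<in> carrier M"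
    let ?y = "\<rho> (inv\<^bsub>G\<^esub> g) x"
    have "\<iota> (z (g \<otimes>\<^bsub>G\<^esub> h) x) = \<nu> g (\<nu> h (s (\<rho> (inv\<^bsub>G\<^esub> h) ?y))) \<otimes>\<^bsub>N\<^esub> inv\<^bsub>N\<^esub> (s x)"
      using g h x by (simp add: i_z C.G.inv_mult_group N.act_comp M.act_comp)
    also have "\<dots> = (\<nu> g (s ?y) \<otimes>\<^bsub>N\<^esub> inv\<^bsub>N\<^esub> \<nu> g (s ?y)) \<otimes>\<^bsub>N\<^esub>
        (\<nu> g (\<nu> h (s (\<rho> (inv\<^bsub>G\<^esub> h) ?y))) \<otimes>\<^bsub>N\<^esub> inv\<^bsub>N\<^esub> (s x))"
      using g h x by simp
    also have "\<dots> = (\<nu> g (s ?y) \<otimes>\<^bsub>N\<^esub> inv\<^bsub>N\<^esub> (s x)) \<otimes>\<^bsub>N\<^esub>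
        \<nu> g (\<nu> h (s (\<rho> (inv\<^bsub>G\<^esub> h) ?y)) \<otimes>\<^bsub>N\<^esub> inv\<^bsub>N\<^esub> (s ?y))"
      using g h x by (simp only: N.act_mult N.act_inv N.M.m_ac N.M.m_closed N.M.inv_closed
          N.act_closed M.act_closed C.G.inv_closed s_closed)
    also have "\<dots> = \<iota> (z g x \<otimes>\<^bsub>C\<^esub> \<zeta> g (z h ?y))"
      using g h x by (simp add: i_z z_closed i_act)
    finally have "z (g \<otimes>\<^bsub>G\<^esub> h) x = z g x \<otimes>\<^bsub>C\<^esub> \<zeta> g (z h ?y)"
      by (rule i_eqD) (use g h x in \<open>simp_all add: z_closed\<close>)
    then show "z (g \<otimes>\<^bsub>G\<^esub> h) x = (z g \<otimes>\<^bsub>Hom_Z M C\<^esub> Hom_action G M \<rho> C \<zeta> g (z h)) x"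
      using g h x by (simp add: Hom_Z_mult Hom_action_eq z_hom)
  qed
  then show ?thesis
    using z_hom by (auto simp: cocycles1_def ext_cocycle_def)
qed

lemma coboundary_iff:
  assumes c: "c \<in> carrier G \<rightarrow>\<^sub>E carrier (Hom_Z M C)"
  shows "c \<in> coboundaries1 G (Hom_Z M C) (Hom_action G M \<rho> C \<zeta>) \<longleftrightarrow>
    (\<exists>u\<in>hom M C. \<forall>g\<in>carrier G. \<forall>x\<in>carrier M. c g x = \<zeta> g (u (\<rho> (inv\<^bsub>G\<^esub> g) x)) \<otimes>\<^bsub>C\<^esub> inv\<^bsub>C\<^esub> (u x))"
    (is "?L \<longleftrightarrow> (\<exists>u\<in>hom M C. ?P u)")
proof -
  have val: "(Hom_action G M \<rho> C \<zeta> g u \<otimes>\<^bsub>Hom_Z M C\<^esub> inv\<^bsub>Hom_Z M C\<^esub> u) x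
      = \<zeta> g (u (\<rho> (inv\<^bsub>G\<^esub> g) x)) \<otimes>\<^bsub>C\<^esub> inv\<^bsub>C\<^esub> (u x)"
    if "u \<in> carrier (Hom_Z M C)" "x \<in> carrier M" for g u x
    using that by (simp add: Hom_Z_mult Hom_action_eq Hom_Z_inv M.M.group_axioms C.M.comm_group_axioms)
  show ?thesis
  proof
    assume ?L
    then obtain u where u: "u \<in> carrier (Hom_Z M C)"
      and cu: "c = (\<lambda>g\<in>carrier G. Hom_action G M \<rho> C \<zeta> g u \<otimes>\<^bsub>Hom_Z M C\<^esub> inv\<^bsub>Hom_Z M C\<^esub> u)"
      by (auto simp: coboundaries1_def)
    have "?P u" using u by (auto simp: cu val)
    moreover have "u \<in> hom M C" using u by (simp add: Hom_Z_carrier)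
    ultimately show "\<exists>u\<in>hom M C. ?P u" by blast
  next
    assume "\<exists>u\<in>hom M C. ?P u"
    then obtain u where u: "u \<in> hom M C" and P: "?P u" by blast
    let ?u = "restrict u (carrier M)"
    have u': "?u \<in> carrier (Hom_Z M C)" by (rule Hom_Z_restrict[OF u M.M.group_axioms])
    have "c = (\<lambda>g\<in>carrier G. Hom_action G M \<rho> C \<zeta> g ?u \<otimes>\<^bsub>Hom_Z M C\<^esub> inv\<^bsub>Hom_Z M C\<^esub> ?u)"
    proof (rule extensionalityI[where A = "carrier G"])
      fix g assume g: "g \<in> carrier G"
      have "c g = Hom_action G M \<rho> C \<zeta> g ?u \<otimes>\<^bsub>Hom_Z M C\<^esub> inv\<^bsub>Hom_Z M C\<^esub> ?u"
      proof (rule extensionalityI[where A = "carrier M"])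
        show "c g \<in> extensional (carrier M)" using c g by (auto simp: Hom_Z_carrier)
        show "Hom_action G M \<rho> C \<zeta> g ?u \<otimes>\<^bsub>Hom_Z M C\<^esub> inv\<^bsub>Hom_Z M C\<^esub> ?u \<in> extensional (carrier M)"
          by (simp add: Hom_Z_mult)
      qed (use u' g P in \<open>simp add: val\<close>)
      then show "c g = (\<lambda>g\<in>carrier G. Hom_action G M \<rho> C \<zeta> g ?u \<otimes>\<^bsub>Hom_Z M C\<^esub> inv\<^bsub>Hom_Z M C\<^esub> ?u) g"
        using g by simp
    qed (use c in \<open>auto simp: PiE_def\<close>)
    then show ?L using u' by (auto simp: coboundaries1_def)
  qed
qed

text \<open>
  Additively, \<open>\<iota> z(g) = g s g\<inverse> - s\<close>. Hence \<open>n z(g) = g u g\<inverse> - u\<close> for all \<open>g\<close> says exactly that the map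
  \<open>t = n s - \<iota> u\<close> satisfies \<open>g t g\<inverse> = t\<close>. It lifts \<open>n Id\<close>, and every lift \<open>t\<close> of \<open>n Id\<close> has this form because
  \<open>n s - t\<close> has values in the kernel of \<open>\<pi>\<close>.
\<close>

lemma cocycle_power_coboundary_iff:
  "(\<lambda>g\<in>carrier G. z g [^]\<^bsub>Hom_Z M C\<^esub> n) \<in> coboundaries1 G (Hom_Z M C) (Hom_action G M \<rho> C \<zeta>) \<longleftrightarrow>
    (\<exists>t\<in>G_hom G M \<rho> N \<nu>. \<forall>x\<in>carrier M. \<pi> (t x) = x [^]\<^bsub>M\<^esub> (n :: nat))"
    (is "?L \<longleftrightarrow> ?R")
proof -
  have "?L \<longleftrightarrow> (\<exists>u\<in>hom M C. \<forall>g\<in>carrier G. \<forall>x\<in>carrier M.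
      z g x [^]\<^bsub>C\<^esub> n = \<zeta> g (u (\<rho> (inv\<^bsub>G\<^esub> g) x)) \<otimes>\<^bsub>C\<^esub> inv\<^bsub>C\<^esub> (u x))" (is "_ \<longleftrightarrow> (\<exists>u\<in>hom M C. ?P u)")
    using z_hom by (subst coboundary_iff) (auto simp: Hom_Z_pow)
  also have "\<dots> \<longleftrightarrow> ?R"
  proof
    have key: "z g x [^]\<^bsub>C\<^esub> n = \<zeta> g (u (\<rho> (inv\<^bsub>G\<^esub> g) x)) \<otimes>\<^bsub>C\<^esub> inv\<^bsub>C\<^esub> (u x) \<longleftrightarrow>
        \<nu> g (s (\<rho> (inv\<^bsub>G\<^esub> g) x) [^]\<^bsub>N\<^esub> n \<otimes>\<^bsub>N\<^esub> inv\<^bsub>N\<^esub> \<iota> (u (\<rho> (inv\<^bsub>G\<^esub> g) x))) = s x [^]\<^bsub>N\<^esub> n \<otimes>\<^bsub>N\<^esub> inv\<^bsub>N\<^esub> \<iota> (u x)"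
      if g: "g \<in> carrier G" and x: "x \<in> carrier M" and u: "u \<in> hom M C" for g x u
    proof -
      have uc: "u y \<in> carrier C" if "y \<in> carrier M" for y using u that by (auto simp: hom_def)
      let ?y = "\<rho> (inv\<^bsub>G\<^esub> g) x"
      have pow: "\<nu> g (y [^]\<^bsub>N\<^esub> n) = \<nu> g y [^]\<^bsub>N\<^esub> n" if "y \<in> carrier N" for y
        using N.act_int_pow[OF g that, of "int n"] by (simp add: int_pow_int)
      have "z g x [^]\<^bsub>C\<^esub> n = \<zeta> g (u ?y) \<otimes>\<^bsub>C\<^esub> inv\<^bsub>C\<^esub> (u x) \<longleftrightarrow>
          \<iota> (z g x [^]\<^bsub>C\<^esub> n) = \<iota> (\<zeta> g (u ?y) \<otimes>\<^bsub>C\<^esub> inv\<^bsub>C\<^esub> (u x))"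
        by (rule inj_on_eq_iff[OF i_inj, symmetric]) (use g x uc in \<open>simp_all add: z_closed\<close>)
      also have "\<dots> \<longleftrightarrow> \<nu> g (s ?y) [^]\<^bsub>N\<^esub> n \<otimes>\<^bsub>N\<^esub> inv\<^bsub>N\<^esub> (s x [^]\<^bsub>N\<^esub> n) = \<nu> g (\<iota> (u ?y)) \<otimes>\<^bsub>N\<^esub> inv\<^bsub>N\<^esub> \<iota> (u x)"
        using g x uc by (simp add: i.hom_nat_pow i_z z_closed i_act N.M.pow_mult_distrib N.M.m_comm N.M.nat_pow_inv)
      also have "\<dots> \<longleftrightarrow> \<nu> g (s ?y) [^]\<^bsub>N\<^esub> n \<otimes>\<^bsub>N\<^esub> inv\<^bsub>N\<^esub> \<nu> g (\<iota> (u ?y)) = s x [^]\<^bsub>N\<^esub> n \<otimes>\<^bsub>N\<^esub> inv\<^bsub>N\<^esub> \<iota> (u x)"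
        using g x uc by (intro N.M.quotient_swap) auto
      finally show ?thesis using g x uc by (simp add: N.act_mult N.act_inv pow)
    qed
    have pow_hom: "(\<lambda>x. s x [^]\<^bsub>N\<^esub> n) \<in> hom M N"
      using hom_comp[OF s_hom N.M.int_pow_hom[of "int n"]] by (simp add: int_pow_int)
    {
      assume "\<exists>u\<in>hom M C. ?P u"
      then obtain u where u: "u \<in> hom M C" and P: "?P u" by blast
      have uc: "u y \<in> carrier C" if "y \<in> carrier M" for y using u that by (auto simp: hom_def)
      let ?t = "\<lambda>x. s x [^]\<^bsub>N\<^esub> n \<otimes>\<^bsub>N\<^esub> inv\<^bsub>N\<^esub> \<iota> (u x)"
      have "?t \<in> hom M N" by (intro N.M.mult_hom N.M.inv_hom pow_hom hom_comp[OF u i.homh])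
      moreover have "?t (\<rho> g x) = \<nu> g (?t x)" if g: "g \<in> carrier G" and x: "x \<in> carrier M" for g x
        using P key[OF g _ u, of "\<rho> g x"] g x by simp
      moreover have "\<pi> (?t x) = x [^]\<^bsub>M\<^esub> n" if "x \<in> carrier M" for x
        using that uc by (simp add: p.hom_nat_pow p_s)
      ultimately show ?R by (intro bexI[of _ ?t]) (auto simp: G_hom_def)
    }
    {
      assume ?R
      then obtain t where t: "t \<in> hom M N" and t_act: "\<And>g x. g \<in> carrier G \<Longrightarrow> x \<in> carrier M \<Longrightarrow> t (\<rho> g x) = \<nu> g (t x)"
        and p_t: "\<And>x. x \<in> carrier M \<Longrightarrow> \<pi> (t x) = x [^]\<^bsub>M\<^esub> n"
        by (auto simp: G_hom_def)
      have tc [simp]: "t y \<in> carrier N" if "y \<in> carrier M" for y using t that by (auto simp: hom_def)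
      have ker: "\<pi> (s x [^]\<^bsub>N\<^esub> n \<otimes>\<^bsub>N\<^esub> inv\<^bsub>N\<^esub> t x) = \<one>\<^bsub>M\<^esub>" if "x \<in> carrier M" for x
        using that by (simp add: p.hom_nat_pow p_s p_t)
      let ?u = "\<lambda>x. pull (s x [^]\<^bsub>N\<^esub> n \<otimes>\<^bsub>N\<^esub> inv\<^bsub>N\<^esub> t x)"
      have u: "?u \<in> hom M C"
        by (intro pull_hom N.M.mult_hom N.M.inv_hom pow_hom t ker)
      have iu: "s x [^]\<^bsub>N\<^esub> n \<otimes>\<^bsub>N\<^esub> inv\<^bsub>N\<^esub> \<iota> (?u x) = t x" if "x \<in> carrier M" for x
      proof -
        have "s x [^]\<^bsub>N\<^esub> n \<otimes>\<^bsub>N\<^esub> inv\<^bsub>N\<^esub> \<iota> (?u x) = s x [^]\<^bsub>N\<^esub> n \<otimes>\<^bsub>N\<^esub> (inv\<^bsub>N\<^esub> (s x [^]\<^bsub>N\<^esub> n) \<otimes>\<^bsub>N\<^esub> t x)"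
          using that i_pull[OF _ ker[OF that]] by (simp add: N.M.inv_mult)
        also have "\<dots> = t x" using that by (simp flip: N.M.m_assoc)
        finally show ?thesis .
      qed
      have "?P ?u"
      proof (intro ballI)
        fix g x assume g: "g \<in> carrier G" and x: "x \<in> carrier M"
        show "z g x [^]\<^bsub>C\<^esub> n = \<zeta> g (?u (\<rho> (inv\<^bsub>G\<^esub> g) x)) \<otimes>\<^bsub>C\<^esub> inv\<^bsub>C\<^esub> (?u x)"
          unfolding key[OF g x u] using g x t_act[of g "\<rho> (inv\<^bsub>G\<^esub> g) x"] by (simp only: iu M.act_closed C.G.inv_closed) simp
      qed
      then show "\<exists>u\<in>hom M C. ?P u" by (rule bexI[of ?P, OF _ u])
    }
  qed
  finally show ?thesis .
qed

end

text \<open>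
  Two sections differ by a map into the kernel of \<open>\<pi>\<close>, that is by some \<open>\<iota> u\<close>, and their cocycles then differ
  by the coboundary of \<open>u\<close>. This makes the class of the extension well defined.
\<close>

lemma cocycle_section_independent:
  assumes s: "s \<in> hom M N" "\<And>x. x \<in> carrier M \<Longrightarrow> \<pi> (s x) = x"
    and t: "t \<in> hom M N" "\<And>x. x \<in> carrier M \<Longrightarrow> \<pi> (t x) = x"
  defines "B \<equiv> coboundaries1 G (Hom_Z M C) (Hom_action G M \<rho> C \<zeta>)"
    and "Z \<equiv> cocycles1 G (Hom_Z M C) (Hom_action G M \<rho> C \<zeta>)"
  shows "B #>\<^bsub>Z\<^esub> ext_cocycle G C N \<nu> M \<rho> \<iota> s = B #>\<^bsub>Z\<^esub> ext_cocycle G C N \<nu> M \<rho> \<iota> t"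
proof -
  let ?zs = "ext_cocycle G C N \<nu> M \<rho> \<iota> s" and ?zt = "ext_cocycle G C N \<nu> M \<rho> \<iota> t"
  have zs: "?zs \<in> carrier Z" and zt: "?zt \<in> carrier Z"
    using z_cocycle[OF s] z_cocycle[OF t] by (simp_all add: Z_def)
  let ?u = "\<lambda>x. pull (t x \<otimes>\<^bsub>N\<^esub> inv\<^bsub>N\<^esub> s x)"
  have sc [simp]: "s x \<in> carrier N" and tc [simp]: "t x \<in> carrier N" if "x \<in> carrier M" for x
    by (rule hom_in_carrier[OF s(1) that], rule hom_in_carrier[OF t(1) that])
  have ker: "\<pi> (t x \<otimes>\<^bsub>N\<^esub> inv\<^bsub>N\<^esub> s x) = \<one>\<^bsub>M\<^esub>" if "x \<in> carrier M" for x
    using that s t by simp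
  have u: "?u \<in> hom M C"
    by (intro pull_hom N.M.mult_hom N.M.inv_hom s t ker)
  have uc: "?u x \<in> carrier C" if "x \<in> carrier M" for x using u that by (auto simp: hom_def)
  have iu: "\<iota> (?u x) = t x \<otimes>\<^bsub>N\<^esub> inv\<^bsub>N\<^esub> s x" if "x \<in> carrier M" for x
    using that ker by (simp add: i_pull)
  \<comment> \<open>The difference of the two cocycles, to be recognized as the coboundary of \<open>?u\<close>.\<close>
  define w where "w = ?zt \<otimes>\<^bsub>Z\<^esub> inv\<^bsub>Z\<^esub> ?zs"
  have wZ: "w \<in> carrier Z" using zs zt by (simp add: w_def Z_def)
  have w: "w \<otimes>\<^bsub>Z\<^esub> ?zs = ?zt" using zs zt by (simp add: w_def Z_def Hom.Z.m_assoc)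
  have "w \<in> B"
    unfolding B_def
  proof (subst coboundary_iff[OF s])
    show wE: "w \<in> carrier G \<rightarrow>\<^sub>E carrier (Hom_Z M C)" using wZ by (simp add: Z_def cocycles1_def)
    show "\<exists>u\<in>hom M C. \<forall>g\<in>carrier G. \<forall>x\<in>carrier M. w g x = \<zeta> g (u (\<rho> (inv\<^bsub>G\<^esub> g) x)) \<otimes>\<^bsub>C\<^esub> inv\<^bsub>C\<^esub> (u x)"
    proof (intro bexI[OF _ u] ballI)
      fix g x assume g: "g \<in> carrier G" and x: "x \<in> carrier M"
      let ?y = "\<rho> (inv\<^bsub>G\<^esub> g) x"
      have "w g \<in> carrier (Hom_Z M C)" using wE g by auto
      then have wc: "w g x \<in> carrier C" using x by (auto simp: Hom_Z_carrier hom_def)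
      have "w g x \<otimes>\<^bsub>C\<^esub> ?zs g x = ?zt g x"
        using fun_cong[OF fun_cong[OF w, of g], of x] g x by (simp add: Z_def Hom.cocycles_mult Hom_Z_mult)
      then have "w g x = ?zt g x \<otimes>\<^bsub>C\<^esub> inv\<^bsub>C\<^esub> ?zs g x"
        using wc g x z_closed[OF s] z_closed[OF t] by (simp add: C.M.inv_solve_right)
      moreover have "\<iota> (?zt g x \<otimes>\<^bsub>C\<^esub> inv\<^bsub>C\<^esub> ?zs g x) = \<iota> (\<zeta> g (?u ?y) \<otimes>\<^bsub>C\<^esub> inv\<^bsub>C\<^esub> ?u x)"
        using g x z_closed[OF s] z_closed[OF t] uc
        by (simp add: i_z[OF s] i_z[OF t] i_act iu N.act_mult N.act_inv N.M.inv_mult N.M.m_ac)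
      ultimately show "w g x = \<zeta> g (?u ?y) \<otimes>\<^bsub>C\<^esub> inv\<^bsub>C\<^esub> ?u x"
        using g x z_closed[OF s] z_closed[OF t] uc by (auto intro: i_eqD)
    qed
  qed
  then have "?zt \<in> B #>\<^bsub>Z\<^esub> ?zs" using w by (force simp: r_coset_def)
  then show ?thesis
    using Hom.Z.repr_independence[OF _ zs[unfolded Z_def] Hom.coboundaries_subgroup] by (simp add: B_def Z_def)
qed

text \<open>
  The lift \<open>t\<close> is the difference between \<open>n\<close> times a section and a map trivializing \<open>n\<close> times its cocycle,
  so no cohomology is left in this criterion.
\<close>

theorem ext_ord_dvd_iff:
  "ext_ord G C \<zeta> N \<nu> M \<rho> \<iota> \<pi> dvd n \<longleftrightarrow>
    (\<exists>t\<in>G_hom G M \<rho> N \<nu>. \<forall>x\<in>carrier M. \<pi> (t x) = x [^]\<^bsub>M\<^esub> n)"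
proof -
  obtain s where s: "s \<in> hom M N" "\<And>x. x \<in> carrier M \<Longrightarrow> \<pi> (s x) = x"
    using section_exists by blast
  let ?Z = "cocycles1 G (Hom_Z M C) (Hom_action G M \<rho> C \<zeta>)" and ?B = "coboundaries1 G (Hom_Z M C) (Hom_action G M \<rho> C \<zeta>)"
  have "ext_class G C \<zeta> N \<nu> M \<rho> \<iota> \<pi> = ?B #>\<^bsub>?Z\<^esub> ext_cocycle G C N \<nu> M \<rho> \<iota> s"
    unfolding ext_class_def
  proof (rule the_equality)
    show "\<exists>t\<in>hom M N. (\<forall>x\<in>carrier M. \<pi> (t x) = x) \<and>
        ?B #>\<^bsub>?Z\<^esub> ext_cocycle G C N \<nu> M \<rho> \<iota> s = ?B #>\<^bsub>?Z\<^esub> ext_cocycle G C N \<nu> M \<rho> \<iota> t"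
      using s by blast
  next
    fix K assume "\<exists>t\<in>hom M N. (\<forall>x\<in>carrier M. \<pi> (t x) = x) \<and> K = ?B #>\<^bsub>?Z\<^esub> ext_cocycle G C N \<nu> M \<rho> \<iota> t"
    then show "K = ?B #>\<^bsub>?Z\<^esub> ext_cocycle G C N \<nu> M \<rho> \<iota> s"
      using cocycle_section_independent[OF _ _ s] by blast
  qed
  then show ?thesis
    unfolding ext_ord_def using Hom.H1_ord_dvd_iff[OF z_cocycle[OF s]] cocycle_power_coboundary_iff[OF s]
    by simp
qed

end

section \<open>Lifting multiples of the identity\<close>

context lattice_extension
begin

text \<open>
  The sum of the conjugates \<open>g s g\<inverse>\<close> of a \<open>\<int>\<close>-linear section is equivariant and lifts \<open>|G| Id\<close>.
\<close>

lemma ext_ord_dvd_order: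
  assumes fin: "finite (carrier G)"
  shows "ext_ord G C \<zeta> N \<nu> M \<rho> \<iota> \<pi> dvd order G"
proof -
  obtain s where s: "s \<in> hom M N" and p_s: "\<And>x. x \<in> carrier M \<Longrightarrow> \<pi> (s x) = x"
    using section_exists by blast
  have sc [simp]: "s x \<in> carrier N" if "x \<in> carrier M" for x by (rule hom_in_carrier[OF s that])
  let ?u = "\<lambda>g x. \<nu> g (s (\<rho> (inv\<^bsub>G\<^esub> g) x))"
  let ?t = "\<lambda>x. \<Otimes>\<^bsub>N\<^esub>g\<in>carrier G. ?u g x"
  have "?t \<in> hom M N"
    by (rule N.M.finprod_hom) (intro hom_comp[OF _ N.act_hom] hom_comp[OF M.act_hom s]; simp)
  moreover have "?t (\<rho> h x) = \<nu> h (?t x)" if h: "h \<in> carrier G" and x: "x \<in> carrier M" for h x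
  proof -
    have bij: "(\<lambda>g. h \<otimes>\<^bsub>G\<^esub> g) ` carrier G = carrier G" "inj_on (\<lambda>g. h \<otimes>\<^bsub>G\<^esub> g) (carrier G)"
      using h by (simp_all add: C.G.surj_const_mult C.G.inj_on_cmult)
    have "(\<Otimes>\<^bsub>N\<^esub>g\<in>(\<lambda>g. h \<otimes>\<^bsub>G\<^esub> g) ` carrier G. ?u g (\<rho> h x))
        = (\<Otimes>\<^bsub>N\<^esub>g\<in>carrier G. ?u (h \<otimes>\<^bsub>G\<^esub> g) (\<rho> h x))"
      using h x by (intro N.M.finprod_reindex bij) auto
    also have "\<dots> = (\<Otimes>\<^bsub>N\<^esub>g\<in>carrier G. \<nu> h (?u g x))"
      using h x by (intro N.M.finprod_cong') (auto simp: C.G.inv_mult_group N.act_comp M.act_comp)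
    also have "\<dots> = \<nu> h (?t x)"
      using h x by (intro N.act_finprod[symmetric]) auto
    finally show ?thesis by (simp add: bij)
  qed
  moreover have "\<pi> (?t x) = x [^]\<^bsub>M\<^esub> order G" if x: "x \<in> carrier M" for x
  proof -
    have "\<pi> (?t x) = (\<Otimes>\<^bsub>M\<^esub>g\<in>carrier G. \<pi> (?u g x))"
      using x by (intro hom_finprod[OF N.M.comm_group_axioms M.M.comm_group_axioms p.homh]) auto
    also have "\<dots> = (\<Otimes>\<^bsub>M\<^esub>g\<in>carrier G. x)"
      using x by (intro M.M.finprod_cong') (auto simp: p_act p_s)
    finally show ?thesis using x by (simp add: M.M.finprod_const order_def)
  qed
  ultimately show ?thesis
    unfolding ext_ord_dvd_iff by (intro bexI[of _ ?t]) (auto simp: G_hom_def)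
qed

text \<open>
  If \<open>x\<close> is any preimage of \<open>m\<close>, then \<open>h \<mapsto> h x - x\<close> is a cocycle of \<open>H\<close> with values in \<open>C\<close>, hence equal to
  \<open>h k - k\<close> for some \<open>k\<close> in \<open>C\<close>. The vector \<open>x - \<iota> k\<close> is a preimage fixed by \<open>H\<close>.
\<close>

lemma fixed_vector_lift:
  assumes C: "coflabby G C \<zeta>" and H: "subgroup H G"
    and m: "m \<in> carrier M" and fixed: "\<And>h. h \<in> H \<Longrightarrow> \<rho> h m = m"
  obtains y where "y \<in> carrier N" "\<pi> y = m" "\<And>h. h \<in> H \<Longrightarrow> \<nu> h y = y"
proof -
  interpret H: subgroup H G by fact
  have "G_module (G\<lparr>carrier := H\<rparr>) C \<zeta>" by (rule G_module_restrict[OF C.module H])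
  then interpret CH: g_module "G\<lparr>carrier := H\<rparr>" C \<zeta> by unfold_locales
  obtain x where x: "x \<in> carrier N" and px: "\<pi> x = m" using p_surj[OF m] .
  have triv: "trivial_group (H1 (G\<lparr>carrier := H\<rparr>) C \<zeta>)" using C H by (simp add: coflabby_def)
  let ?d = "\<lambda>h. \<nu> h x \<otimes>\<^bsub>N\<^esub> inv\<^bsub>N\<^esub> x"
  let ?c = "\<lambda>h\<in>H. pull (?d h)"
  have ker: "\<pi> (?d h) = \<one>\<^bsub>M\<^esub>" if "h \<in> H" for h using that x m by (simp add: p_act px fixed)
  have dc: "?d h \<in> carrier N" if "h \<in> H" for h using that x by simp
  have c: "pull (?d h) \<in> carrier C" "\<iota> (pull (?d h)) = ?d h" if "h \<in> H" for h
    by (rule pull_closed[OF dc[OF that] ker[OF that]], rule i_pull[OF dc[OF that] ker[OF that]])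
  have "pull (?d (g \<otimes>\<^bsub>G\<^esub> h)) = pull (?d g) \<otimes>\<^bsub>C\<^esub> \<zeta> g (pull (?d h))" if g: "g \<in> H" and h: "h \<in> H" for g h
  proof (rule i_eqD)
    have "?d g \<otimes>\<^bsub>N\<^esub> \<nu> g (?d h) = (\<nu> g x \<otimes>\<^bsub>N\<^esub> inv\<^bsub>N\<^esub> \<nu> g x) \<otimes>\<^bsub>N\<^esub> (\<nu> g (\<nu> h x) \<otimes>\<^bsub>N\<^esub> inv\<^bsub>N\<^esub> x)"
      using g h x by (simp only: N.act_mult N.act_inv N.M.m_ac N.M.m_closed N.M.inv_closed N.act_closed H.mem_carrier)
    then have "?d g \<otimes>\<^bsub>N\<^esub> \<nu> g (?d h) = ?d (g \<otimes>\<^bsub>G\<^esub> h)" using g h x by (simp add: N.act_comp)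
    then show "\<iota> (pull (?d (g \<otimes>\<^bsub>G\<^esub> h))) = \<iota> (pull (?d g) \<otimes>\<^bsub>C\<^esub> \<zeta> g (pull (?d h)))"
      using g h c by (simp add: i_act)
  qed (use g h c in simp_all)
  then have "?c \<in> carrier (cocycles1 (G\<lparr>carrier := H\<rparr>) C \<zeta>)"
    using c by (simp add: cocycles1_def)
  from CH.H1_trivial_coboundary[OF triv this] obtain k where k: "k \<in> carrier C"
    and ck: "\<And>h. h \<in> H \<Longrightarrow> pull (?d h) = \<zeta> h k \<otimes>\<^bsub>C\<^esub> inv\<^bsub>C\<^esub> k"
    by auto
  have "\<nu> h (x \<otimes>\<^bsub>N\<^esub> inv\<^bsub>N\<^esub> \<iota> k) = x \<otimes>\<^bsub>N\<^esub> inv\<^bsub>N\<^esub> \<iota> k" if h: "h \<in> H" for h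
  proof -
    have "?d h = \<nu> h (\<iota> k) \<otimes>\<^bsub>N\<^esub> inv\<^bsub>N\<^esub> \<iota> k"
      using c(2)[OF h] h k by (simp add: ck i_act)
    then have "\<nu> h x \<otimes>\<^bsub>N\<^esub> inv\<^bsub>N\<^esub> \<nu> h (\<iota> k) = x \<otimes>\<^bsub>N\<^esub> inv\<^bsub>N\<^esub> \<iota> k"
      using h x k N.M.quotient_swap[of "\<nu> h x" x "\<nu> h (\<iota> k)" "\<iota> k"] by simp
    then show ?thesis using h x k by (simp add: N.act_mult N.act_inv)
  qed
  then show ?thesis using that[of "x \<otimes>\<^bsub>N\<^esub> inv\<^bsub>N\<^esub> \<iota> k"] x k px m by simp
qed

text \<open>
  A vector \<open>v r\<close> is fixed by the stabilizer of \<open>r\<close>, so it has a lift \<open>n r\<close> with the same property. Using this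
  for one representative \<open>r\<close> of each orbit and moving the lift around by \<open>G\<close> gives a well-defined family.
\<close>

lemma equivariant_family_lift:
  fixes S :: "'x set"
  assumes C: "coflabby G C \<zeta>" and frame: "permutation_frame G M \<rho> a S \<alpha> l v"
  obtains w where "\<And>x. x \<in> S \<Longrightarrow> w x \<in> carrier N" "\<And>x. x \<in> S \<Longrightarrow> \<pi> (w x) = v x"
    "\<And>g x. g \<in> carrier G \<Longrightarrow> x \<in> S \<Longrightarrow> w (\<alpha> g x) = \<nu> g (w x)"
proof -
  interpret S: permutation_frame G M \<rho> a S \<alpha> l v by fact
  define stab where "stab r = {g \<in> carrier G. \<alpha> g r = r}" for r
  have stab: "subgroup (stab r) G" if r: "r \<in> S" for r
  proof (rule C.G.subgroupI)
    show "stab r \<noteq> {}" using r S.index_one by (auto simp: stab_def)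
    show "inv\<^bsub>G\<^esub> g \<in> stab r" if "g \<in> stab r" for g
      using that r S.index_inverse(1)[of g r] by (auto simp: stab_def)
  qed (use r in \<open>auto simp: stab_def S.index_comp\<close>)
  have "\<exists>y. y \<in> carrier N \<and> \<pi> y = v r \<and> (\<forall>h\<in>stab r. \<nu> h y = y)" if r: "r \<in> S" for r
  proof -
    have "\<rho> h (v r) = v r" if "h \<in> stab r" for h
      using that r S.vector_equivariant[of h r] by (auto simp: stab_def)
    then show ?thesis using fixed_vector_lift[OF C stab[OF r], of "v r"] r by (metis S.vector_closed)
  qed
  then obtain n where n: "\<And>r. r \<in> S \<Longrightarrow> n r \<in> carrier N" "\<And>r. r \<in> S \<Longrightarrow> \<pi> (n r) = v r"
    "\<And>r h. r \<in> S \<Longrightarrow> h \<in> stab r \<Longrightarrow> \<nu> h (n r) = n r" by metis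
  define orb where "orb x = (\<lambda>g. \<alpha> g x) ` carrier G" for x
  define r where "r x = (SOME y. y \<in> orb x)" for x
  have orb_shift: "orb (\<alpha> g x) = orb x" if g: "g \<in> carrier G" and x: "x \<in> S" for g x
  proof -
    have "orb (\<alpha> g x) = (\<lambda>h. \<alpha> h x) ` (\<lambda>h. h \<otimes>\<^bsub>G\<^esub> g) ` carrier G"
      unfolding image_image orb_def using g x by (intro image_cong) (auto simp: S.index_comp)
    also have "(\<lambda>h. h \<otimes>\<^bsub>G\<^esub> g) ` carrier G = carrier G"
    proof
      show "carrier G \<subseteq> (\<lambda>h. h \<otimes>\<^bsub>G\<^esub> g) ` carrier G"
      proof
        fix h assume "h \<in> carrier G"
        then show "h \<in> (\<lambda>h. h \<otimes>\<^bsub>G\<^esub> g) ` carrier G"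
          using g by (intro image_eqI[of _ _ "h \<otimes>\<^bsub>G\<^esub> inv\<^bsub>G\<^esub> g"]) (auto simp: C.G.m_assoc)
      qed
    qed (use g in auto)
    finally show ?thesis by (simp add: orb_def)
  qed
  have "\<exists>k\<in>carrier G. \<alpha> k (r x) = x \<and> r x \<in> S" if x: "x \<in> S" for x
  proof -
    have "x \<in> orb x" using x S.index_one[OF x] by (force simp: orb_def)
    then have "r x \<in> orb x" unfolding r_def by (rule someI)
    then obtain h where "h \<in> carrier G" "r x = \<alpha> h x" by (auto simp: orb_def)
    then show ?thesis using x by (intro bexI[of _ "inv\<^bsub>G\<^esub> h"]) auto
  qed
  then obtain k where k: "\<And>x. x \<in> S \<Longrightarrow> k x \<in> carrier G" "\<And>x. x \<in> S \<Longrightarrow> \<alpha> (k x) (r x) = x"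
    and rS: "\<And>x. x \<in> S \<Longrightarrow> r x \<in> S" by metis
  let ?w = "\<lambda>x. \<nu> (k x) (n (r x))"
  have "?w (\<alpha> g x) = \<nu> g (?w x)" if g: "g \<in> carrier G" and x: "x \<in> S" for g x
  proof -
    let ?y = "\<alpha> g x"
    have y: "?y \<in> S" using g x by simp
    have ry: "r ?y = r x" using orb_shift[OF g x] by (simp add: r_def)
    \<comment> \<open>Both \<open>k ?y\<close> and \<open>g\<close> times \<open>k x\<close> move the representative to \<open>?y\<close>, so they differ by an
      element of the stabilizer of the representative.\<close>
    let ?h = "inv\<^bsub>G\<^esub> k ?y \<otimes>\<^bsub>G\<^esub> (g \<otimes>\<^bsub>G\<^esub> k x)"
    note cl = g x y k(1)[OF x] k(1)[OF y] rS[OF x] n(1)[OF rS[OF x]]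
    have "\<alpha> ?h (r x) = \<alpha> (inv\<^bsub>G\<^esub> k ?y) ?y" using cl by (simp add: S.index_comp k(2))
    also have "\<dots> = \<alpha> (inv\<^bsub>G\<^esub> k ?y) (\<alpha> (k ?y) (r x))" using k(2)[OF y] by (simp add: ry)
    also have "\<dots> = r x" using cl by simp
    finally have "?h \<in> stab (r x)" using cl by (simp add: stab_def)
    then have "\<nu> ?h (n (r x)) = n (r x)" using n(3) rS[OF x] by blast
    then have "\<nu> (k ?y) (n (r x)) = \<nu> (k ?y) (\<nu> ?h (n (r x)))" by simp
    also have "\<dots> = \<nu> g (\<nu> (k x) (n (r x)))" using cl by (simp add: N.act_comp)
    finally show ?thesis by (simp add: ry)
  qed
  moreover have "?w x \<in> carrier N" "\<pi> (?w x) = v x" if x: "x \<in> S" for x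
    using k(1)[OF x] k(2)[OF x] n rS[OF x] S.vector_equivariant[of "k x" "r x"]
    by (simp_all add: p_act)
  ultimately show ?thesis using that[of ?w] by blast
qed

lemma ext_ord_dvd_factor:
  assumes C: "coflabby G C \<zeta>" and fac: "factors_through_permutation G M \<rho> (int n)"
  shows "ext_ord G C \<zeta> N \<nu> M \<rho> \<iota> \<pi> dvd n"
proof -
  obtain S :: "nat set" and \<alpha> l v where frame: "permutation_frame G M \<rho> (int n) S \<alpha> l v"
    using permutation_frame_of_factorization[OF M.module fac] .
  then interpret S: permutation_frame G M \<rho> "int n" S \<alpha> l v .
  obtain w where w: "\<And>x. x \<in> S \<Longrightarrow> w x \<in> carrier N" "\<And>x. x \<in> S \<Longrightarrow> \<pi> (w x) = v x"
    "\<And>g x. g \<in> carrier G \<Longrightarrow> x \<in> S \<Longrightarrow> w (\<alpha> g x) = \<nu> g (w x)"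
    using equivariant_family_lift[OF C frame] by blast
  let ?t = "\<lambda>m. \<Otimes>\<^bsub>N\<^esub>x\<in>S. w x [^]\<^bsub>N\<^esub> l x m"
  have "?t \<in> G_hom G M \<rho> N \<nu>" by (rule S.combination_G_hom[OF N.module w(1,3)])
  moreover have "\<pi> (?t m) = m [^]\<^bsub>M\<^esub> n" if m: "m \<in> carrier M" for m
  proof -
    have "\<pi> (?t m) = (\<Otimes>\<^bsub>M\<^esub>x\<in>S. \<pi> (w x [^]\<^bsub>N\<^esub> l x m))"
      using w by (intro hom_finprod[OF N.M.comm_group_axioms M.M.comm_group_axioms p.homh]) auto
    also have "\<dots> = (\<Otimes>\<^bsub>M\<^esub>x\<in>S. v x [^]\<^bsub>M\<^esub> l x m)"
      using w by (intro M.M.finprod_cong') (auto simp: p.hom_int_pow)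
    finally show ?thesis using S.expansion[OF m] by (simp add: int_pow_int)
  qed
  ultimately show ?thesis unfolding ext_ord_dvd_iff by (intro bexI[of _ ?t] ballI)
qed

lemma factors_ext_ord:
  assumes N: "permutation_lattice G N \<nu>"
  shows "factors_through_permutation G M \<rho> (int (ext_ord G C \<zeta> N \<nu> M \<rho> \<iota> \<pi>))"
proof -
  have "ext_ord G C \<zeta> N \<nu> M \<rho> \<iota> \<pi> dvd ext_ord G C \<zeta> N \<nu> M \<rho> \<iota> \<pi>" by simp
  then obtain t where "t \<in> G_hom G M \<rho> N \<nu>"
    "\<forall>x\<in>carrier M. \<pi> (t x) = x [^]\<^bsub>M\<^esub> int (ext_ord G C \<zeta> N \<nu> M \<rho> \<iota> \<pi>)"
    by (simp only: ext_ord_dvd_iff int_pow_int) (elim bexE)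
  then show ?thesis
    using exact by (intro factors_through_permutationI[OF N]) (auto simp: exact_seq_G_lattices_def)
qed

lemma splits_iff_ext_ord: "splits G N \<nu> M \<rho> \<pi> \<longleftrightarrow> ext_ord G C \<zeta> N \<nu> M \<rho> \<iota> \<pi> dvd 1"
  unfolding splits_def ext_ord_dvd_iff by (intro bex_cong refl ball_cong) simp

end

section \<open>Subgroups of lattices\<close>

lemma finprod_subgroup:
  assumes M: "comm_group M" and K: "subgroup K M" and u: "u \<in> A \<rightarrow> K"
  shows "finprod (M\<lparr>carrier := K\<rparr>) u A = finprod M u A"
proof -
  have "(\<lambda>x. x) \<in> hom (M\<lparr>carrier := K\<rparr>) M" using subgroup.subset[OF K] by (auto simp: hom_def)
  from hom_finprod[OF subgroup_comm_group[OF M K] M this, of u A] u show ?thesis by simp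
qed

text \<open>
  Induction on the number of functionals. The kernel of one of them, \<open>l\<^sub>j\<close>, is separated by the others and so has
  a basis. If \<open>l\<^sub>j\<close> is nonzero, adding an element \<open>k\<close> on which \<open>l\<^sub>j\<close> has least positive absolute value gives a
  basis of \<open>M\<close>: division with remainder by \<open>l\<^sub>j(k)\<close> shows that \<open>l\<^sub>j(k)\<close> divides all values of \<open>l\<^sub>j\<close>. Separating
  functionals, unlike a basis, restrict to subgroups.
\<close>

lemma basis_of_separating_functionals:
  assumes "finite F" and "comm_group M" and "\<And>i. i \<in> F \<Longrightarrow> l i \<in> hom M integer_group"
    and "\<And>x. x \<in> carrier M \<Longrightarrow> (\<And>i. i \<in> F \<Longrightarrow> l i x = 0) \<Longrightarrow> x = \<one>\<^bsub>M\<^esub>"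
  shows "\<exists>B. Z_basis M B"
  using assms
proof (induction F arbitrary: M rule: finite_induct)
  case empty
  interpret M: comm_group M by fact
  have "carrier M = {\<one>\<^bsub>M\<^esub>}" using empty.prems(3) by auto
  then have "Z_basis M {}" by (auto simp: Z_basis_def bij_betw_def)
  then show ?case by blast
next
  case (insert j F)
  interpret M: comm_group M by fact
  interpret l: group_hom M integer_group "l j"
    using insert.prems(2)[of j] by (simp add: group_hom_def group_hom_axioms_def M.group_axioms)
  define K where "K = {x \<in> carrier M. l j x = 0}"
  let ?K = "M\<lparr>carrier := K\<rparr>"
  have K: "subgroup K M" using l.subgroup_kernel by (simp add: K_def kernel_def)
  interpret K: comm_group ?K by (rule subgroup_comm_group[OF insert.prems(1) K])
  have "\<exists>B. Z_basis ?K B"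
  proof (rule insert.IH)
    show "comm_group ?K" by (rule K.comm_group_axioms)
    show "l i \<in> hom ?K integer_group" if "i \<in> F" for i
      using insert.prems(2)[of i] that by (auto simp: hom_def K_def)
    show "x = \<one>\<^bsub>?K\<^esub>" if "x \<in> carrier ?K" "\<And>i. i \<in> F \<Longrightarrow> l i x = 0" for x
      using insert.prems(3)[of x] that by (auto simp: K_def)
  qed
  then obtain B where B: "Z_basis ?K B" by blast
  show ?case
  proof (cases "\<forall>x\<in>carrier M. l j x = 0")
    case True
    then have "?K = M" by (simp add: K_def cong: conj_cong)
    then show ?thesis using B by auto
  next
    case False
    then obtain x0 where x0: "x0 \<in> carrier M" "l j x0 \<noteq> 0" by blast
    then obtain k where k: "k \<in> carrier M" "l j k \<noteq> 0"
      and least: "\<And>y. y \<in> carrier M \<Longrightarrow> l j y \<noteq> 0 \<Longrightarrow> nat \<bar>l j k\<bar> \<le> nat \<bar>l j y\<bar>"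
      using ex_has_least_nat[of "\<lambda>x. x \<in> carrier M \<and> l j x \<noteq> 0" x0 "\<lambda>x. nat \<bar>l j x\<bar>"] by blast
    let ?d = "l j k"
    define q where "q x = l j x div ?d" for x
    let ?r = "\<lambda>x. x \<otimes>\<^bsub>M\<^esub> inv\<^bsub>M\<^esub> (k [^]\<^bsub>M\<^esub> q x)"
    have l_r: "l j (?r x) = l j x mod ?d" if "x \<in> carrier M" for x
      using that k by (simp add: l.hom_int_pow q_def minus_div_mult_eq_mod)
    have r: "?r x \<in> K" if x: "x \<in> carrier M" for x
    proof -
      have "\<bar>l j (?r x)\<bar> < \<bar>?d\<bar>" unfolding l_r[OF x] using k(2) by (rule abs_mod_less)
      then have "l j (?r x) = 0" using least[of "?r x"] x k(1) by fastforce
      then show ?thesis using x k(1) by (simp add: K_def)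
    qed
    have Bf: "finite B" and BK: "\<And>b. b \<in> B \<Longrightarrow> b \<in> K"
      using basis_finite[OF K.comm_group_axioms B] basis_closed[OF K.comm_group_axioms B] by auto
    have KM: "x \<in> carrier M" if "x \<in> K" for x using that by (simp add: K_def)
    have kB: "k \<notin> B" using BK k(2) by (auto simp: K_def)
    have prod: "(\<Otimes>\<^bsub>?K\<^esub>b\<in>B. b [^]\<^bsub>?K\<^esub> (a b :: int)) = (\<Otimes>\<^bsub>M\<^esub>b\<in>B. b [^]\<^bsub>M\<^esub> a b)" for a
    proof -
      have "(\<Otimes>\<^bsub>?K\<^esub>b\<in>B. b [^]\<^bsub>?K\<^esub> (a b :: int)) = (\<Otimes>\<^bsub>?K\<^esub>b\<in>B. b [^]\<^bsub>M\<^esub> a b)"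
        using BK K.int_pow_closed[of _ "a _"] by (intro K.finprod_cong') (auto simp: M.int_pow_consistent[OF K])
      also have "\<dots> = (\<Otimes>\<^bsub>M\<^esub>b\<in>B. b [^]\<^bsub>M\<^esub> a b)"
        using BK by (intro finprod_subgroup[OF insert.prems(1) K]) (auto intro: M.subgroup_int_pow_closed[OF K])
      finally show ?thesis .
    qed
    have split: "(\<Otimes>\<^bsub>M\<^esub>b\<in>insert k B. b [^]\<^bsub>M\<^esub> (a b :: int)) = k [^]\<^bsub>M\<^esub> a k \<otimes>\<^bsub>M\<^esub> (\<Otimes>\<^bsub>M\<^esub>b\<in>B. b [^]\<^bsub>M\<^esub> a b)" for a
      using Bf kB k(1) BK KM by (intro M.finprod_insert) auto
    have "Z_basis M (insert k B)"
    proof (rule Z_basisI[OF insert.prems(1), where c = "\<lambda>b x. if b = k then q x else coord ?K B b (?r x)"])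
      fix x assume x: "x \<in> carrier M"
      have "(\<Otimes>\<^bsub>M\<^esub>b\<in>B. b [^]\<^bsub>M\<^esub> (if b = k then q x else coord ?K B b (?r x)))
          = (\<Otimes>\<^bsub>M\<^esub>b\<in>B. b [^]\<^bsub>M\<^esub> coord ?K B b (?r x))"
        using kB BK KM by (intro M.finprod_cong') auto
      also have "\<dots> = ?r x"
        using basis_expansion[OF K.comm_group_axioms B, of "?r x"] r[OF x] by (simp add: prod)
      finally show "(\<Otimes>\<^bsub>M\<^esub>b\<in>insert k B. b [^]\<^bsub>M\<^esub> (if b = k then q x else coord ?K B b (?r x))) = x"
        unfolding split using x k(1) by (simp add: M.m_lcomm)
    next
      fix a :: "_ \<Rightarrow> int" and b assume b: "b \<in> insert k B"
      let ?x = "\<Otimes>\<^bsub>M\<^esub>b\<in>insert k B. b [^]\<^bsub>M\<^esub> a b"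
      define y where "y = (\<Otimes>\<^bsub>?K\<^esub>b\<in>B. b [^]\<^bsub>?K\<^esub> a b)"
      have y: "y \<in> K"
        using K.finprod_closed[of "\<lambda>b. b [^]\<^bsub>?K\<^esub> a b" B] K.int_pow_closed BK
        by (simp add: y_def Pi_iff)
      have x: "?x = k [^]\<^bsub>M\<^esub> a k \<otimes>\<^bsub>M\<^esub> y" by (simp only: split y_def prod)
      have qx: "q ?x = a k"
        using y KM[OF y] k unfolding x q_def by (simp add: l.hom_int_pow K_def)
      have rx: "?r ?x = y"
        unfolding qx unfolding x using KM[OF y] k(1) by (simp add: M.m_ac M.inv_solve_left')
      show "(if b = k then q ?x else coord ?K B b (?r ?x)) = a b"
        unfolding rx using b qx coord_unique[OF K.comm_group_axioms B _ y_def] by auto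
    qed (use Bf k(1) BK KM in auto)
    then show ?thesis by blast
  qed
qed

lemma subgroup_has_basis:
  assumes M: "comm_group M" and B: "Z_basis M B" and K: "subgroup K M"
  shows "\<exists>B'. Z_basis (M\<lparr>carrier := K\<rparr>) B'"
proof (rule basis_of_separating_functionals)
  interpret M: comm_group M by fact
  show "finite B" by (rule basis_finite[OF M B])
  show "comm_group (M\<lparr>carrier := K\<rparr>)" by (rule subgroup_comm_group[OF M K])
  show "coord M B b \<in> hom (M\<lparr>carrier := K\<rparr>) integer_group" if "b \<in> B" for b
    using coord_hom[OF M B that] subgroup.mem_carrier[OF K] by (auto simp: hom_def)
  fix x assume x: "x \<in> carrier (M\<lparr>carrier := K\<rparr>)" and 0: "\<And>b. b \<in> B \<Longrightarrow> coord M B b x = 0"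
  have "(\<Otimes>\<^bsub>M\<^esub>b\<in>B. b [^]\<^bsub>M\<^esub> coord M B b x) = \<one>\<^bsub>M\<^esub>"
    by (rule M.finprod_one_eqI) (simp add: 0)
  then show "x = \<one>\<^bsub>M\<lparr>carrier := K\<rparr>\<^esub>"
    using basis_expansion[OF M B, of x] x subgroup.mem_carrier[OF K] by simp
qed

section \<open>Invertible lattices\<close>

lemma G_lattice_subgroup:
  assumes M: "G_lattice G M \<rho>" and K: "subgroup K M"
    and stable: "\<And>g x. g \<in> carrier G \<Longrightarrow> x \<in> K \<Longrightarrow> \<rho> g x \<in> K"
  shows "G_lattice G (M\<lparr>carrier := K\<rparr>) (\<lambda>g. restrict (\<rho> g) K)"
proof -
  obtain B where B: "Z_basis M B" using M by (auto simp: G_lattice_def)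
  interpret g_module G M \<rho> using M by unfold_locales (simp add: G_lattice_def)
  have KM: "x \<in> carrier M" if "x \<in> K" for x by (rule subgroup.mem_carrier[OF K that])
  have "G_module G (M\<lparr>carrier := K\<rparr>) (\<lambda>g. restrict (\<rho> g) K)"
  proof (rule G_moduleI)
    fix g assume "g \<in> carrier G"
    then show "restrict (\<rho> g) K \<in> hom (M\<lparr>carrier := K\<rparr>) (M\<lparr>carrier := K\<rparr>)"
      using stable KM subgroup.m_closed[OF K] by (auto simp: hom_def act_mult)
  qed (use stable KM in \<open>auto simp: G.group_axioms subgroup_comm_group[OF M.comm_group_axioms K] act_comp\<close>)
  then show ?thesis
    using subgroup_has_basis[OF M.comm_group_axioms B K] by (simp add: G_lattice_def)
qed

lemma sum_module:
  assumes "G_module G M \<rho>" "G_module G N \<nu>"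
  shows "G_module G (M \<times>\<times> N) (sum_action M \<rho> N \<nu>)"
proof -
  interpret M: g_module G M \<rho> by unfold_locales fact
  interpret N: g_module G N \<nu> by unfold_locales fact
  have "comm_group (M \<times>\<times> N)"
    by (rule group.group_comm_groupI[OF DirProd_group[OF M.M.group_axioms N.M.group_axioms]])
      (auto simp: M.M.m_comm N.M.m_comm)
  then show ?thesis
    by (intro G_moduleI)
      (auto simp: M.G.group_axioms sum_action_def hom_def M.act_mult N.act_mult M.act_comp N.act_comp)
qed

text \<open>
  If \<open>M \<oplus> Q\<close> is a permutation lattice, inclusion and projection factor the identity through it. Conversely,
  if \<open>h \<circ> f = Id\<close> on \<open>M\<close>, then the permutation lattice is the direct sum of the image of \<open>f\<close> and the kernel of
  \<open>h\<close>.
\<close>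

lemma invertible_iff_factors:
  assumes M: "G_lattice G M \<rho>"
  shows "invertible_lattice G M \<rho> \<longleftrightarrow> factors_through_permutation G M \<rho> 1"
proof
  have mod: "G_module G M \<rho>" using M by (simp add: G_lattice_def)
  interpret M: g_module G M \<rho> by unfold_locales fact
  {
    assume "invertible_lattice G M \<rho>"
    then obtain P :: "nat monoid" and \<tau> and Q :: "nat monoid" and \<sigma> f
      where P: "permutation_lattice G P \<tau>" and Q: "G_lattice G Q \<sigma>"
        and f: "f \<in> G_iso G (M \<times>\<times> Q) (sum_action M \<rho> Q \<sigma>) P \<tau>"
      unfolding invertible_lattice_def by blast
    have modQ: "G_module G Q \<sigma>" using Q by (simp add: G_lattice_def)
    interpret Q: g_module G Q \<sigma> by unfold_locales fact
    let ?i = "\<lambda>x. (x, \<one>\<^bsub>Q\<^esub>)" and ?k = "inv_into (carrier (M \<times>\<times> Q)) f"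
    have i: "?i \<in> G_hom G M \<rho> (M \<times>\<times> Q) (sum_action M \<rho> Q \<sigma>)"
      by (auto simp: G_hom_def hom_def sum_action_def)
    have fst: "fst \<in> G_hom G (M \<times>\<times> Q) (sum_action M \<rho> Q \<sigma>) M \<rho>"
      by (auto simp: G_hom_def hom_def sum_action_def)
    have k: "?k \<in> G_hom G P \<tau> (M \<times>\<times> Q) (sum_action M \<rho> Q \<sigma>)"
      using G_iso_inv[OF f sum_module[OF mod modQ]] by (simp add: G_iso_def)
    have f': "f \<in> G_hom G (M \<times>\<times> Q) (sum_action M \<rho> Q \<sigma>) P \<tau>" and inj: "inj_on f (carrier (M \<times>\<times> Q))"
      using f by (auto simp: G_iso_def bij_betw_def)
    show "factors_through_permutation G M \<rho> 1"
    proof (rule factors_through_permutationI[OF P G_hom_compose[OF i f'] G_hom_compose[OF k fst]])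
      show "\<forall>x\<in>carrier M. (fst \<circ> ?k) ((f \<circ> ?i) x) = x [^]\<^bsub>M\<^esub> (1 :: int)"
        using inv_into_f_f[OF inj] by simp
    qed
  }
  {
    assume "factors_through_permutation G M \<rho> 1"
    then obtain P :: "nat monoid" and \<tau> f h where P: "permutation_lattice G P \<tau>"
      and f: "f \<in> G_hom G M \<rho> P \<tau>" and h: "h \<in> G_hom G P \<tau> M \<rho>"
      and "\<forall>x\<in>carrier M. h (f x) = x [^]\<^bsub>M\<^esub> (1 :: int)"
      unfolding factors_through_permutation_def by blast
    then have hf: "h (f x) = x" if "x \<in> carrier M" for x using that by simp
    interpret P: g_module G P \<tau> using P by unfold_locales (simp add: permutation_lattice_def)
    interpret f: group_hom M P f using f by unfold_locales (simp add: G_hom_def)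
    interpret h: group_hom P M h using h by unfold_locales (simp add: G_hom_def)
    have f_act: "f (\<rho> g x) = \<tau> g (f x)" if "g \<in> carrier G" "x \<in> carrier M" for g x
      using f that by (simp add: G_hom_def)
    have h_act: "h (\<tau> g x) = \<rho> g (h x)" if "g \<in> carrier G" "x \<in> carrier P" for g x
      using h that by (simp add: G_hom_def)
    define K where "K = kernel P M h"
    have K: "x \<in> K \<longleftrightarrow> x \<in> carrier P \<and> h x = \<one>\<^bsub>M\<^esub>" for x by (simp add: K_def kernel_def)
    let ?Q = "P\<lparr>carrier := K\<rparr>" and ?\<sigma> = "\<lambda>g. restrict (\<tau> g) K" and ?F = "\<lambda>(x, y). f x \<otimes>\<^bsub>P\<^esub> y"
    have Q: "G_lattice G ?Q ?\<sigma>"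
    proof (rule G_lattice_subgroup[OF permutation_lattice_imp_G_lattice[OF P]])
      show "subgroup K P" unfolding K_def by (rule h.subgroup_kernel)
    qed (auto simp: K h_act)
    have "bij_betw ?F (carrier M \<times> K) (carrier P)"
      by (rule bij_betw_byWitness[where f' = "\<lambda>y. (h y, inv\<^bsub>P\<^esub> f (h y) \<otimes>\<^bsub>P\<^esub> y)"])
        (auto simp: K hf simp flip: P.M.m_assoc)
    moreover have "?F \<in> G_hom G (M \<times>\<times> ?Q) (sum_action M \<rho> ?Q ?\<sigma>) P \<tau>"
      by (auto simp: G_hom_def hom_def sum_action_def K P.M.m_ac P.act_mult f_act)
    ultimately have "?F \<in> G_iso G (M \<times>\<times> ?Q) (sum_action M \<rho> ?Q ?\<sigma>) P \<tau>"
      by (simp add: G_iso_def)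
    then show "invertible_lattice G M \<rho>" by (rule invertible_latticeI[OF M P Q])
  }
qed

lemma p_ord_eq_1_iff_invertible:
  assumes "G_lattice G M \<rho>" "finite (carrier G)"
  shows "p_ord G M \<rho> = 1 \<longleftrightarrow> invertible_lattice G M \<rho>"
  by (simp only: p_ord_eq_1_iff[OF assms] invertible_iff_factors[OF assms(1)])

section \<open>Comparison of the two orders\<close>

theorem proposition6p5:
  fixes G :: "'g monoid"
    and C :: "'c monoid" and \<zeta> :: "'g \<Rightarrow> 'c \<Rightarrow> 'c"
    and N :: "'n monoid" and \<nu> :: "'g \<Rightarrow> 'n \<Rightarrow> 'n"
    and M :: "'m monoid" and \<rho> :: "'g \<Rightarrow> 'm \<Rightarrow> 'm"
    and \<iota> :: "'c \<Rightarrow> 'n" and \<pi> :: "'n \<Rightarrow> 'm"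
    and Syl :: "nat \<Rightarrow> 'g set"
  assumes G: "group G" "finite (carrier G)"
    and M: "G_lattice G M \<rho>" and N: "G_lattice G N \<nu>"
    and E: "exact_seq_G_lattices G C \<zeta> N \<nu> M \<rho> \<iota> \<pi>"
    and C: "coflabby G C \<zeta>"
    and Syl: "\<And>p. Factorial_Ring.prime p \<Longrightarrow> sylow_subgroup G p (Syl p)"
  shows "ext_ord G C \<zeta> N \<nu> M \<rho> \<iota> \<pi> dvd order G
    \<and> ext_ord G C \<zeta> N \<nu> M \<rho> \<iota> \<pi> dvd p_ord G M \<rho>
    \<and> (permutation_lattice G N \<nu> \<longrightarrow> p_ord G M \<rho> = ext_ord G C \<zeta> N \<nu> M \<rho> \<iota> \<pi>)
    \<and> (\<forall>(P :: 'p monoid) \<tau> f h (a :: int).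
         permutation_lattice G P \<tau> \<and> f \<in> G_hom G M \<rho> P \<tau> \<and> h \<in> G_hom G P \<tau> M \<rho> \<and>
         (\<forall>x\<in>carrier M. h (f x) = x [^]\<^bsub>M\<^esub> a)
         \<longrightarrow> int (p_ord G M \<rho>) dvd a)
    \<and> p_ord G M \<rho> dvd order G
    \<and> p_ord G M \<rho> = (\<Prod>p\<in>prime_factors (order G). p_ord (G\<lparr>carrier := Syl p\<rparr>) M \<rho>)
    \<and> (\<forall>p. Factorial_Ring.prime p \<longrightarrow> p_ord (G\<lparr>carrier := Syl p\<rparr>) M \<rho> dvd card (Syl p))
    \<and> (p_ord G M \<rho> = 1 \<longleftrightarrow> (\<forall>p. Factorial_Ring.prime p \<longrightarrow> p_ord (G\<lparr>carrier := Syl p\<rparr>) M \<rho> = 1))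
    \<and> (p_ord G M \<rho> = 1 \<longleftrightarrow>
         (\<forall>p. Factorial_Ring.prime p \<and> p dvd order G \<longrightarrow> p_ord (G\<lparr>carrier := Syl p\<rparr>) M \<rho> = 1))
    \<and> (permutation_lattice G N \<nu> \<longrightarrow> (p_ord G M \<rho> = 1 \<longleftrightarrow> splits G N \<nu> M \<rho> \<pi>))
    \<and> (p_ord G M \<rho> = 1 \<longleftrightarrow> invertible_lattice G M \<rho>)
    \<and> (invertible_lattice G M \<rho> \<longleftrightarrow>
         (\<forall>p. Factorial_Ring.prime p \<longrightarrow> invertible_lattice (G\<lparr>carrier := Syl p\<rparr>) M \<rho>))
    \<and> (invertible_lattice G M \<rho> \<longleftrightarrow>
         (\<forall>p. Factorial_Ring.prime p \<and> p dvd order G \<longrightarrow> invertible_lattice (G\<lparr>carrier := Syl p\<rparr>) M \<rho>))"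
proof -
  interpret lattice_extension G C \<zeta> N \<nu> M \<rho> \<iota> \<pi> by unfold_locales (rule E)
  let ?ord = "ext_ord G C \<zeta> N \<nu> M \<rho> \<iota> \<pi>" and ?d = "p_ord G M \<rho>"
    and ?e = "\<lambda>p. p_ord (G\<lparr>carrier := Syl p\<rparr>) M \<rho>"
  note fin = G(2)
  have sub: "subgroup (Syl p) G" if "Factorial_Ring.prime p" for p
    using Syl[OF that] by (simp add: sylow_subgroup_def)
  have 1: "?ord dvd order G" by (rule ext_ord_dvd_order[OF fin])
  have 2: "?ord dvd ?d"
    by (rule ext_ord_dvd_factor[OF C p_ord_dvd_iff_nat[OF M fin, THEN iffD1]]) simp
  have 3: "?d = ?ord" if "permutation_lattice G N \<nu>"
    using p_ord_dvd_iff_nat[OF M fin, THEN iffD2, OF factors_ext_ord[OF that]] 2 by (rule dvd_antisym)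
  have 4: "int ?d dvd a"
    if "permutation_lattice G P \<tau>" "f \<in> G_hom G M \<rho> P \<tau>" "h \<in> G_hom G P \<tau> M \<rho>"
      "\<forall>x\<in>carrier M. h (f x) = x [^]\<^bsub>M\<^esub> a" for P :: "'p monoid" and \<tau> f h a
    unfolding p_ord_dvd_iff[OF M fin] by (rule factors_through_permutationI[OF that])
  have 5: "?d = (\<Prod>p\<in>prime_factors (order G). ?e p)"
    by (rule p_ord_Sylow_product[OF M fin Syl])
  have 6: "?e p dvd card (Syl p)" if "Factorial_Ring.prime p" for p
    by (rule p_ord_restrict_dvd_card[OF M fin sub[OF that]])
  have down: "?e p = 1" if "?d = 1" "Factorial_Ring.prime p" for p
    using p_ord_restrict_dvd[OF M fin sub[OF that(2)]] that(1) by simp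
  have up: "?d = 1" if "\<And>p. Factorial_Ring.prime p \<Longrightarrow> p dvd order G \<Longrightarrow> ?e p = 1"
    unfolding 5 using that by (intro prod.neutral) (auto simp: prime_factors_dvd)
  have 7: "?d = 1 \<longleftrightarrow> splits G N \<nu> M \<rho> \<pi>" if "permutation_lattice G N \<nu>"
    by (simp add: splits_iff_ext_ord 3[OF that])
  have 8: "?d = 1 \<longleftrightarrow> invertible_lattice G M \<rho>"
    by (rule p_ord_eq_1_iff_invertible[OF M fin])
  have 9: "?e p = 1 \<longleftrightarrow> invertible_lattice (G\<lparr>carrier := Syl p\<rparr>) M \<rho>" if "Factorial_Ring.prime p" for p
    using finite_subset[OF subgroup.subset[OF sub[OF that]] fin]
    by (intro p_ord_eq_1_iff_invertible G_lattice_restrict[OF M sub[OF that]]) simp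
  have 10: "?d = 1 \<longleftrightarrow> (\<forall>p. Factorial_Ring.prime p \<longrightarrow> ?e p = 1)"
    and 11: "?d = 1 \<longleftrightarrow> (\<forall>p. Factorial_Ring.prime p \<and> p dvd order G \<longrightarrow> ?e p = 1)"
    using down up by blast+
  have 12: "invertible_lattice G M \<rho> \<longleftrightarrow>
      (\<forall>p. Factorial_Ring.prime p \<longrightarrow> invertible_lattice (G\<lparr>carrier := Syl p\<rparr>) M \<rho>)"
    unfolding 8[symmetric] 10 using 9 by blast
  have 13: "invertible_lattice G M \<rho> \<longleftrightarrow>
      (\<forall>p. Factorial_Ring.prime p \<and> p dvd order G \<longrightarrow> invertible_lattice (G\<lparr>carrier := Syl p\<rparr>) M \<rho>)"
    unfolding 8[symmetric] 11 using 9 by blast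
  show ?thesis
    by (intro conjI allI impI; (elim conjE)?)
      (fact 1 2 3 4 p_ord_dvd_order[OF M fin] 5 6 10 11 7 8 12 13)+
qed

end
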